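(* Let $f_0$ be any density on $\mathbb{R}^d$ (not necessarily log-concave) with $\int_{\mathbb{R}^d} \|x\| f_0(x)\,dx < \infty$, $\int_{\mathbb{R}^d} f_0 \log_+ f_0 < \infty$ and $\mathrm{int}(E) \neq \emptyset$, where $E$ is the support of $f_0$. Then there exists a log-concave density $f^*$ on $\mathbb{R}^d$, unique almost everywhere, that minimises the Kullback--Leibler divergence $d_{KL}(f_0,f)$ over all log-concave densities $f$ on $\mathbb{R}^d$. Moreover, let $X_1,X_2,\ldots$ be independent and identically distributed random vectors with density $f_0$, and for $n \geq d+1$ let $\hat{f}_n$ be the log-concave maximum likelihood estimator based on $X_1,\ldots,X_n$. Taking $a_0 > 0$ and $b_0 \in \mathbb{R}$ such that $f^*(x) \leq e^{-a_0\|x\|+b_0}$ for all $x \in \mathbb{R}^d$, we have for any $a < a_0$ that \[ \int_{\mathbb{R}^d} e^{a\|x\|}\,|\hat{f}_n(x) - f^*(x)|\,dx \to 0 \quad \text{almost surely as } n \to \infty, \] and, if $f^*$ is continuous on $\mathbb{R}^d$, \[ \sup_{x \in \mathbb{R}^d} e^{a\|x\|}\,|\hat{f}_n(x) - f^*(x)| \to 0 \quad \text{almost surely as } n \to \infty. \]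
   Context: Densities are probability densities with respect to Lebesgue measure on $\mathbb{R}^d$, and $\|\cdot\|$ is the Euclidean norm. A density $f:\mathbb{R}^d \to [0,\infty)$ is log-concave if $\log f:\mathbb{R}^d \to [-\infty,\infty)$ is concave (with $\log 0 = -\infty$). The support $E$ of $f_0$ is the smallest closed set with $\int_E f_0 = 1$, and $\mathrm{int}(E)$ is its interior. $\log_+ x = \max(\log x, 0)$. The Kullback--Leibler divergence of a density $f$ from $f_0$ is $d_{KL}(f_0,f) = \int_{\mathbb{R}^d} f_0 \log (f_0/f)$, taking values in $[0,\infty]$. The log-concave maximum likelihood estimator $\hat{f}_n$ based on $X_1,\ldots,X_n$ ($n \geq d+1$) is the maximiser of $f \mapsto \frac{1}{n}\sum_{i=1}^n \log f(X_i)$ over all log-concave densities $f$ on $\mathbb{R}^d$; it is known that for $n \ge d+1$ it exists and is unique with probability one. *)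

theory Defs
  imports "HOL-Probability.Probability"
begin

(* The logarithm [0,\<infinity>) \<rightarrow> [-\<infinity>,\<infinity>) with log 0 = -\<infinity>; the library's real ln has ln 0 = 0. *)
definition elog :: "real \<Rightarrow> ereal" where
  "elog u = (if u \<le> 0 then -\<infinity> else ereal (ln u))"

(* Measurability is with respect to the completed Lebesgue sigma-algebra: a log-concave
   function is always Lebesgue measurable, but not always Borel measurable (its values on the
   boundary of its convex support can be irregular), so lborel would exclude some of them. *)
definition prob_density :: "('a::euclidean_space \<Rightarrow> real) \<Rightarrow> bool" where
  "prob_density f \<longleftrightarrow>
     f \<in> borel_measurable lebesgue \<and> (\<forall>x. 0 \<le> f x) \<and> (\<integral>\<^sup>+x. ennreal (f x) \<partial>lebesgue) = 1"

(* Concavity of log f as a function into [-\<infinity>,\<infinity>). As elog never takes the value \<infinity>,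
   the sum below is never of the form \<infinity> - \<infinity>; recall also 0 * (-\<infinity>) = 0 in ereal. *)
definition log_concave_fun :: "('a::euclidean_space \<Rightarrow> real) \<Rightarrow> bool" where
  "log_concave_fun f \<longleftrightarrow>
     (\<forall>x y. \<forall>t\<in>{0..1}. ereal (1 - t) * elog (f x) + ereal t * elog (f y)
                          \<le> elog (f ((1 - t) *\<^sub>R x + t *\<^sub>R y)))"

definition log_concave_density :: "('a::euclidean_space \<Rightarrow> real) \<Rightarrow> bool" where
  "log_concave_density f \<longleftrightarrow> prob_density f \<and> log_concave_fun f"

definition density_support :: "('a::euclidean_space \<Rightarrow> real) \<Rightarrow> 'a set" where
  "density_support f =
     (LEAST E. closed E \<and> (\<integral>\<^sup>+x\<in>E. ennreal (f x) \<partial>lebesgue) = 1)"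

definition log_plus :: "real \<Rightarrow> real" where
  "log_plus u = (if u \<le> 0 then 0 else max (ln u) 0)"

(* f0 log (f0/f), with the conventions 0 log (0/v) = 0 and u log (u/0) = \<infinity> for u > 0. *)
definition kl_integrand :: "real \<Rightarrow> real \<Rightarrow> ereal" where
  "kl_integrand u v =
     (if u = 0 then 0 else if v = 0 then \<infinity> else ereal (u * ln (u / v)))"

(* The integral is the difference of the integrals of the positive and negative parts (e2ennreal
   sends negative numbers to 0). For densities the latter is at most 1, because
   u log (v/u) \<le> v, so the difference is never \<infinity> - \<infinity>. The library's KL_divergence is a
   real-valued Bochner integral, which would be 0 instead of \<infinity> for a divergent integral. *)
definition kl_div :: "('a::euclidean_space \<Rightarrow> real) \<Rightarrow> ('a \<Rightarrow> real) \<Rightarrow> ereal" where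
  "kl_div f0 f =
     enn2ereal (\<integral>\<^sup>+x. e2ennreal (kl_integrand (f0 x) (f x)) \<partial>lebesgue)
     - enn2ereal (\<integral>\<^sup>+x. e2ennreal (- kl_integrand (f0 x) (f x)) \<partial>lebesgue)"

definition kl_minimiser :: "('a::euclidean_space \<Rightarrow> real) \<Rightarrow> ('a \<Rightarrow> real) \<Rightarrow> bool" where
  "kl_minimiser f0 f \<longleftrightarrow>
     log_concave_density f \<and> (\<forall>g. log_concave_density g \<longrightarrow> kl_div f0 f \<le> kl_div f0 g)"

(* X is a Borel random vector whose law has density f. The library's distributed is not used,
   since over lborel it needs f to be Borel, and over lebesgue it needs the preimages under X of
   all Lebesgue measurable sets to be events. *)
definition has_density ::
    "'w measure \<Rightarrow> ('w \<Rightarrow> 'a::euclidean_space) \<Rightarrow> ('a \<Rightarrow> real) \<Rightarrow> bool" where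
  "has_density M X f \<longleftrightarrow>
     X \<in> borel_measurable M \<and>
     (\<forall>A\<in>sets borel. emeasure (distr M borel X) A = (\<integral>\<^sup>+x\<in>A. ennreal (f x) \<partial>lebesgue))"

(* The sample of size n is x 0, ..., x (n - 1). *)
definition avg_log_lik :: "nat \<Rightarrow> (nat \<Rightarrow> 'a::euclidean_space) \<Rightarrow> ('a \<Rightarrow> real) \<Rightarrow> ereal" where
  "avg_log_lik n x f = ereal (1 / real n) * (\<Sum>i<n. elog (f (x i)))"

definition is_log_concave_mle ::
    "nat \<Rightarrow> (nat \<Rightarrow> 'a::euclidean_space) \<Rightarrow> ('a \<Rightarrow> real) \<Rightarrow> bool" where
  "is_log_concave_mle n x f \<longleftrightarrow>
     log_concave_density f \<and>
     (\<forall>g. log_concave_density g \<longrightarrow> avg_log_lik n x g \<le> avg_log_lik n x f)"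

end

theory Submission
  imports Defs
begin

text \<open>
  Write \<open>Q\<close> for the law with density \<open>f0\<close> and \<open>loglik f\<close> for the integral of \<open>ln f\<close> with respect to \<open>Q\<close>.
  The argument avoids compactness of the class of log-concave functions. For log-concave
  densities \<open>f\<close>, \<open>g\<close> the normalised geometric mean \<open>sqrt (f g) / \<rho>\<close> is log-concave with
  \<open>loglik = (loglik f + loglik g) / 2 - ln \<rho>\<close>, so near-maximisers of the likelihood have
  Hellinger affinity \<open>\<rho>\<close> near 1 and are close in \<open>L1\<close>. Uniqueness is immediate, and a maximising
  sequence is Cauchy in \<open>L1\<close>; its pointwise limit inferior is log-concave everywhere and is the
  minimiser.

  The same inequality, applied to the empirical likelihood, reduces consistency of the maximum
  likelihood estimator to showing that its empirical likelihood is asymptotically at most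
  the optimal value. For this, \<open>f\<close> is replaced by its sup-convolution with \<open>exp (- L |x|)\<close>, which
  is log-concave, dominates \<open>f\<close>, has a Lipschitz logarithm (so that a uniform law of large numbers
  is elementary), and has integral tending to 1 uniformly over the relevant densities \<open>f\<close> as \<open>L\<close>
  grows. Finally, \<open>L1\<close> convergence is upgraded by comparing integrals over small balls on which
  log-concavity controls the densities.
\<close>

section \<open>Strong law of large numbers\<close>

text \<open>The obstacle to a uniform law of large numbers for \<open>ln f\<close> is that ln f is
  -\<infinity> off a convex set that varies with the sample. Only an upper bound on the empirical
  likelihood of the estimator is required, so enlarging \<open>f\<close> is harmless as long as its
  integral stays near 1. Uniformity comes from a ball inside the support of \<open>f0\<close>. By
  separation, a convex superlevel set that does not contain a smaller ball misses one of finitely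
  many test balls, each of positive mass; a lower bound on the likelihood therefore bounds the
  density from below on the smaller ball in terms of its maximum. Conversely, a density that is at
  least \<open>exp (- K)\<close> on a ball can have neither a high peak nor a slow tail, since the
  cone spanned with the ball would carry mass above 1. Together these facts give constants
  \<open>M\<close>, \<open>K\<close> and an exponential tail common to near-maximisers and, for
  large samples, to the estimators. Randomness enters only through averages of countably many test
  functions, so the consistency argument proper concerns one fixed sequence of points.\<close>

primrec max_partial_sum :: "nat \<Rightarrow> (nat \<Rightarrow> real) \<Rightarrow> real" where
  "max_partial_sum 0 y = 0"
| "max_partial_sum (Suc n) y = max 0 (y 0 + max_partial_sum n (\<lambda>i. y (Suc i)))"

lemma max_partial_sum_nonneg: "0 \<le> max_partial_sum n y"
  by (cases n) auto

lemma max_partial_sum_mono: "max_partial_sum n y \<le> max_partial_sum (Suc n) y"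
proof (induction n arbitrary: y)
  case (Suc n)
  show ?case using Suc[of "\<lambda>i. y (Suc i)"] by (subst (1 2) max_partial_sum.simps(2)) (auto simp del: max_partial_sum.simps)
qed simp

lemma sum_le_max_partial_sum: "k \<le> n \<Longrightarrow> (\<Sum>i<k. y i) \<le> max_partial_sum n y"
proof (induction n arbitrary: y k)
  case (Suc n)
  show ?case
  proof (cases k)
    case (Suc j)
    have "(\<Sum>i<k. y i) = y 0 + (\<Sum>i<j. y (Suc i))"
      unfolding Suc by (rule sum.lessThan_Suc_shift)
    also have "\<dots> \<le> y 0 + max_partial_sum n (\<lambda>i. y (Suc i))"
      using Suc.IH[of j "\<lambda>i. y (Suc i)"] Suc.prems Suc by simp
    finally show ?thesis by simp
  qed (simp add: max_partial_sum_nonneg del: max_partial_sum.simps)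
qed simp

lemma max_partial_sum_le: "\<bar>max_partial_sum n y\<bar> \<le> (\<Sum>i<n. \<bar>y i\<bar>)"
proof (induction n arbitrary: y)
  case (Suc n)
  have "\<bar>max_partial_sum (Suc n) y\<bar> \<le> \<bar>y 0\<bar> + \<bar>max_partial_sum n (\<lambda>i. y (Suc i))\<bar>"
    by auto
  also have "\<dots> \<le> \<bar>y 0\<bar> + (\<Sum>i<n. \<bar>y (Suc i)\<bar>)" using Suc by simp
  also have "\<dots> = (\<Sum>i<Suc n. \<bar>y i\<bar>)" by (rule sum.lessThan_Suc_shift[symmetric])
  finally show ?case .
qed simp

lemma borel_measurable_max_partial_sum[measurable (raw)]:
  "(\<And>i. (\<lambda>x. Y i x) \<in> borel_measurable N) \<Longrightarrow> (\<lambda>x. max_partial_sum n (\<lambda>i. Y i x)) \<in> borel_measurable N"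
proof (induction n arbitrary: Y)
  case (Suc n)
  note [measurable] = Suc.prems Suc.IH[of "\<lambda>i. Y (Suc i)"]
  show ?case by simp
qed simp

lemma bdd_sums_Suc:
  fixes y :: "nat \<Rightarrow> real"
  shows "(\<exists>B. \<forall>k. (\<Sum>i<k. y i) \<le> B) \<longleftrightarrow> (\<exists>B. \<forall>k. (\<Sum>i<k. y (Suc i)) \<le> B)"
proof
  assume "\<exists>B. \<forall>k. (\<Sum>i<k. y i) \<le> B"
  then obtain B where "\<And>k. (\<Sum>i<Suc k. y i) \<le> B" by blast
  then show "\<exists>B. \<forall>k. (\<Sum>i<k. y (Suc i)) \<le> B"
    unfolding sum.lessThan_Suc_shift by (intro exI[of _ "B - y 0"]) (simp add: le_diff_eq add.commute)
next
  assume "\<exists>B. \<forall>k. (\<Sum>i<k. y (Suc i)) \<le> B"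
  then obtain B where B: "\<And>k. (\<Sum>i<k. y (Suc i)) \<le> B" by blast
  have "(\<Sum>i<k. y i) \<le> max 0 (y 0 + B)" for k
    using B by (cases k) (auto simp: sum.lessThan_Suc_shift le_max_iff_disj simp del: sum.lessThan_Suc)
  then show "\<exists>B. \<forall>k. (\<Sum>i<k. y i) \<le> B" by blast
qed

text \<open>Finitely many terms do not affect boundedness, so the event belongs to the tail of the
  sequence; a natural number as bound makes it a countable union of measurable sets.\<close>

lemma bdd_sums_shift:
  fixes y :: "nat \<Rightarrow> real"
  shows "(\<exists>B. \<forall>k. (\<Sum>i<k. y i) \<le> B) \<longleftrightarrow> (\<exists>B::nat. \<forall>k. (\<Sum>i<k. y (i + n)) \<le> real B)"
proof -
  have "(\<exists>B. \<forall>k. (\<Sum>i<k. y i) \<le> B) \<longleftrightarrow> (\<exists>B. \<forall>k. (\<Sum>i<k. y (i + n)) \<le> B)"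
    by (induction n) (use bdd_sums_Suc[of "\<lambda>i. y (i + _)"] in simp_all)
  then show ?thesis by (meson order_trans real_arch_simple)
qed

context prob_space
begin

lemma indep_vars_Suc:
  assumes "indep_vars (\<lambda>_. N) Y (UNIV::nat set)"
  shows "indep_vars (\<lambda>_. N) (\<lambda>i. Y (Suc i)) UNIV"
  unfolding indep_vars_def2 indep_sets_def
proof (intro conjI ballI allI impI; clarsimp?)
  show "Y (Suc i) \<in> measurable M N" for i using assms by (auto simp: indep_vars_def2)
next
  fix i B assume "B \<in> sets N" 
  then show "Y (Suc i) -` B \<inter> space M \<in> events" using assms unfolding indep_vars_def2 by (auto intro: measurable_sets)
next
  fix J A assume J: "J \<noteq> {}" "finite J" and A: "A \<in> (\<Pi> j\<in>J. {Y (Suc j) -` A \<inter> space M |A. A \<in> sets N})"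
  \<comment> \<open>The predecessor undoes \<open>Suc\<close>, so that the family indexed by
    \<open>J\<close> becomes one indexed by the image of \<open>J\<close> under
    \<open>Suc\<close>.\<close>
  let ?A = "\<lambda>i. A (i - 1)"
  have *: "\<forall>J. J \<noteq> {} \<longrightarrow> finite J \<longrightarrow> (\<forall>A\<in>(\<Pi> j\<in>J. {Y j -` A \<inter> space M |A. A \<in> sets N}). prob (\<Inter>(A ` J)) = (\<Prod>j\<in>J. prob (A j)))"
    using assms unfolding indep_vars_def2 indep_sets_def by simp
  have "prob (\<Inter>(?A ` (Suc ` J))) = (\<Prod>j\<in>Suc ` J. prob (?A j))"
    by (rule *[rule_format]) (use J A in \<open>auto simp: Pi_iff\<close>)
  then show "prob (\<Inter>(A ` J)) = (\<Prod>j\<in>J. prob (A j))"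
    by (simp add: prod.reindex image_image)
qed

lemma bdd_partial_sums_0_1:
  fixes Y :: "nat \<Rightarrow> 'a \<Rightarrow> real"
  assumes indep: "indep_vars (\<lambda>_. borel) Y UNIV"
  defines "A \<equiv> {\<omega> \<in> space M. \<exists>B. \<forall>k. (\<Sum>i<k. Y i \<omega>) \<le> B}"
  shows "A \<in> events" "prob A = 0 \<or> prob A = 1"
proof -
  have [measurable]: "Y i \<in> borel_measurable M" for i
    using indep unfolding indep_vars_def by auto
  let ?F = "\<lambda>i. {Y i -` B \<inter> space M | B. B \<in> sets borel}"
  let ?A = "\<lambda>i. sigma_sets (space M) (?F i)"
  have sub: "?F i \<subseteq> Pow (space M)" for i by auto
  have tail: "A \<in> tail_events ?A"
    unfolding tail_events_def
  proof
    fix n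
    let ?N = "sigma (space M) (\<Union> (?A ` {n..}))"
    have P: "\<Union> (?A ` {n..}) \<subseteq> Pow (space M)"
      using sigma_sets_into_sp[OF sub] by blast
    have Y: "Y (i + n) \<in> borel_measurable ?N" for i
    proof (rule measurableI)
      fix B :: "real set" assume "B \<in> sets borel"
      then have "Y (i + n) -` B \<inter> space M \<in> ?A (i + n)" by (intro sigma_sets.Basic) auto
      then have "Y (i + n) -` B \<inter> space M \<in> \<Union> (?A ` {n..})" by auto
      then show "Y (i + n) -` B \<inter> space ?N \<in> sets ?N"
        using P by (auto simp: space_measure_of sets_measure_of intro!: sigma_sets.Basic)
    qed simp
    have "A = {\<omega> \<in> space ?N. \<exists>B::nat. \<forall>k. (\<Sum>i<k. Y (i + n) \<omega>) \<le> real B}"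
      unfolding A_def using bdd_sums_shift[where n = n] by (auto simp: space_measure_of_conv)
    also have "\<dots> \<in> sets ?N"
      using Y by measurable
    finally show "A \<in> sigma_sets (space M) (\<Union> (?A ` {n..}))"
      using P by (simp add: sets_measure_of)
  qed
  have sa: "sigma_algebra (space M) (?A i)" for i
    by (rule sigma_algebra_sigma_sets[OF sub])
  have "indep_sets ?A UNIV" using indep by (simp add: indep_vars_def)
  from kolmogorov_0_1_law[OF sa this tail] show "prob A = 0 \<or> prob A = 1" .
  show "A \<in> events"
  proof -
    have "A = {\<omega> \<in> space M. \<exists>B::nat. \<forall>k. (\<Sum>i<k. Y i \<omega>) \<le> real B}"
      unfolding A_def using bdd_sums_shift[where n = 0] by auto
    then show ?thesis by simp
  qed
qed

text \<open>With \<open>m n\<close> the maximum of the first \<open>n\<close> partial sums and \<open>m' n\<close> that of the shifted sequence,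
  \<open>m (Suc n) - m' n = max (- m' n) (Y 0)\<close> has nonnegative mean, but it would tend to \<open>Y 0\<close> if the
  partial sums were unbounded with probability one.\<close>

lemma iid_negative_drift:
  fixes Y :: "nat \<Rightarrow> 'a \<Rightarrow> real"
  assumes indep: "indep_vars (\<lambda>_. borel) Y UNIV"
    and id: "\<And>i. distr M borel (Y i) = distr M borel (Y 0)"
    and int: "integrable M (Y 0)" and neg: "expectation (Y 0) < 0"
  shows "AE \<omega> in M. \<exists>B. \<forall>k. (\<Sum>i<k. Y i \<omega>) \<le> B"
proof -
  have Y[measurable]: "Y i \<in> borel_measurable M" for i
    using indep unfolding indep_vars_def by auto
  have intY: "integrable M (Y i)" for i
  proof -
    have "integrable (distr M borel (Y 0)) (\<lambda>x. x)"
      using int by (subst integrable_distr_eq) auto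
    then have "integrable (distr M borel (Y i)) (\<lambda>x. x)" by (simp only: id[of i])
    then show ?thesis by (subst (asm) integrable_distr_eq) auto
  qed
  let ?m = "\<lambda>n \<omega>. max_partial_sum n (\<lambda>i. Y i \<omega>)"
  let ?m' = "\<lambda>n \<omega>. max_partial_sum n (\<lambda>i. Y (Suc i) \<omega>)"
  have int_max: "integrable M (\<lambda>\<omega>. max_partial_sum n (\<lambda>i. Z i \<omega>))"
    if "\<And>i. integrable M (Z i)" for n Z
  proof (rule Bochner_Integration.integrable_bound)
    show "integrable M (\<lambda>\<omega>. \<Sum>i<n. \<bar>Z i \<omega>\<bar>)" using that by auto
    have [measurable]: "Z i \<in> borel_measurable M" for i using that[of i] by auto
    show "(\<lambda>\<omega>. max_partial_sum n (\<lambda>i. Z i \<omega>)) \<in> borel_measurable M" by measurable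
    show "AE \<omega> in M. norm (max_partial_sum n (\<lambda>i. Z i \<omega>)) \<le> norm (\<Sum>i<n. \<bar>Z i \<omega>\<bar>)"
      by (auto intro!: AE_I2 order_trans[OF max_partial_sum_le])
  qed
  have indep': "indep_vars (\<lambda>_. borel) (\<lambda>i. Y (Suc i)) UNIV"
    using indep by (rule indep_vars_Suc)
  let ?P = "PiM UNIV (\<lambda>_::nat. borel :: real measure)"
  have "distr M ?P (\<lambda>\<omega>. \<lambda>i\<in>UNIV. Y i \<omega>) = PiM UNIV (\<lambda>i. distr M borel (Y i))"
    using indep by (subst (asm) indep_vars_iff_distr_eq_PiM) auto
  moreover have "distr M ?P (\<lambda>\<omega>. \<lambda>i\<in>UNIV. Y (Suc i) \<omega>) = PiM UNIV (\<lambda>i. distr M borel (Y (Suc i)))"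
    using indep' by (subst (asm) indep_vars_iff_distr_eq_PiM) auto
  moreover have "(\<lambda>i. distr M borel (Y i)) = (\<lambda>i. distr M borel (Y (Suc i)))"
    by (intro ext) (metis id)
  \<comment> \<open>The joint law of an iid sequence is the product of its marginals and hence
    invariant under the shift. This is what gives \<open>?m n\<close> and \<open>?m' n\<close> the
    same mean.\<close>
  ultimately have distr_eq: "distr M ?P (\<lambda>\<omega> i. Y i \<omega>) = distr M ?P (\<lambda>\<omega> i. Y (Suc i) \<omega>)"
    by (simp add: restrict_def)
  have mP: "max_partial_sum n \<in> borel_measurable ?P" for n
  proof -
    have "(\<lambda>y::nat\<Rightarrow>real. max_partial_sum n (\<lambda>i. y i)) \<in> borel_measurable ?P"
      by (rule borel_measurable_max_partial_sum) measurable
    then show ?thesis by simp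
  qed
  have mY: "(\<lambda>\<omega> i. Y i \<omega>) \<in> measurable M ?P" "(\<lambda>\<omega> i. Y (Suc i) \<omega>) \<in> measurable M ?P"
    by (auto intro!: measurable_PiM_single')
  have shift: "expectation (?m n) = expectation (?m' n)" for n
    using integral_distr[OF mY(1) mP] integral_distr[OF mY(2) mP] distr_eq by simp
  define A where "A = {\<omega> \<in> space M. \<exists>B. \<forall>k. (\<Sum>i<k. Y i \<omega>) \<le> B}"
  note A = bdd_partial_sums_0_1[OF indep, folded A_def]
  have "prob A \<noteq> 0"
  proof
    assume "prob A = 0"
    then have "A \<in> null_sets M" using A(1) by (simp add: emeasure_eq_measure null_setsI)
    then have unb: "AE \<omega> in M. \<omega> \<notin> A" by (rule AE_not_in)
    have "(\<lambda>n. expectation (\<lambda>\<omega>. max (- ?m' n \<omega>) (Y 0 \<omega>))) \<longlonglongrightarrow> expectation (Y 0)"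
    proof (rule integral_dominated_convergence)
      show "integrable M (\<lambda>\<omega>. \<bar>Y 0 \<omega>\<bar>)" using int by auto
      \<comment> \<open>As \<open>?m' n\<close> is nonnegative, the maximum lies between
        \<open>Y 0\<close> and \<open>max 0 (Y 0)\<close>.\<close>
      show "AE \<omega> in M. norm (max (- ?m' n \<omega>) (Y 0 \<omega>)) \<le> \<bar>Y 0 \<omega>\<bar>" for n
        using max_partial_sum_nonneg by (intro AE_I2) (smt (verit) real_norm_def)
      show "AE \<omega> in M. (\<lambda>n. max (- ?m' n \<omega>) (Y 0 \<omega>)) \<longlonglongrightarrow> Y 0 \<omega>"
        using unb AE_space
      proof eventually_elim
        case (elim \<omega>)
          from elim have "\<not> (\<exists>B. \<forall>k. (\<Sum>i<k. Y i \<omega>) \<le> B)" by (simp add: A_def)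
          then have "\<not> (\<exists>B::nat. \<forall>k. (\<Sum>i<k. Y (i + 1) \<omega>) \<le> real B)"
            using bdd_sums_shift[where n=1 and y = "\<lambda>i. Y i \<omega>"] by simp
          then obtain k where k: "(\<Sum>i<k. Y (Suc i) \<omega>) > real (nat \<lceil>- Y 0 \<omega>\<rceil>)"
            by (auto simp: not_le)
          have ev: "max (- ?m' n \<omega>) (Y 0 \<omega>) = Y 0 \<omega>" if "n \<ge> k" for n
            using sum_le_max_partial_sum[OF that, of "\<lambda>i. Y (Suc i) \<omega>"] k
              real_nat_ceiling_ge[of "- Y 0 \<omega>"] by linarith
          show ?case
            by (rule tendsto_eventually) (use ev in \<open>auto simp: eventually_sequentially\<close>)
      qed
    qed measurable
    moreover have "0 \<le> expectation (\<lambda>\<omega>. max (- ?m' n \<omega>) (Y 0 \<omega>))" for n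
    proof -
      have "(\<lambda>\<omega>. max (- ?m' n \<omega>) (Y 0 \<omega>)) = (\<lambda>\<omega>. ?m (Suc n) \<omega> - ?m' n \<omega>)"
        by (auto simp: fun_eq_iff max_def)
      then have "expectation (\<lambda>\<omega>. max (- ?m' n \<omega>) (Y 0 \<omega>)) = expectation (?m (Suc n)) - expectation (?m n)"
        using int_max[of Y "Suc n", OF intY] int_max[of "\<lambda>i. Y (Suc i)" n, OF intY] shift[of n]
        by (simp del: max_partial_sum.simps)
      moreover have "expectation (?m n) \<le> expectation (?m (Suc n))"
        using int_max[of Y, OF intY] max_partial_sum_mono
        by (intro integral_mono) (auto simp del: max_partial_sum.simps)
      ultimately show ?thesis by linarith
    qed
    ultimately have "0 \<le> expectation (Y 0)"
      by (meson LIMSEQ_le_const)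
    with neg show False by simp
  qed
  with A have "prob A = 1" by simp
  then have "AE \<omega> in M. \<omega> \<in> A" using A(1) by (simp add: prob_eq_1)
  then show ?thesis by eventually_elim (simp add: A_def)
qed

text \<open>The variables \<open>s * (Y i - \<mu>) - e\<close> have mean - e, so their partial sums
  are bounded above: s times the deviation of the n-th sum from n \<mu> is at most n e + B. The
  signs s = 1 and s = -1 give both sides, and letting e run through 1 / (j + 1) keeps the
  exceptional set a countable union of null sets.\<close>

theorem strong_law_of_large_numbers:
  fixes Y :: "nat \<Rightarrow> 'a \<Rightarrow> real"
  assumes indep: "indep_vars (\<lambda>_. borel) Y UNIV"
    and id: "\<And>i. distr M borel (Y i) = distr M borel (Y 0)"
    and int: "integrable M (Y 0)"
  shows "AE \<omega> in M. (\<lambda>n. (\<Sum>i<n. Y i \<omega>) / real n) \<longlonglongrightarrow> expectation (Y 0)"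
proof -
  have Y[measurable]: "Y i \<in> borel_measurable M" for i
    using indep unfolding indep_vars_def by auto
  define \<mu> where "\<mu> = expectation (Y 0)"
  have key: "AE \<omega> in M. \<exists>B. \<forall>k. (\<Sum>i<k. s * (Y i \<omega> - \<mu>) - e) \<le> B" if "e > 0" for s e :: real
  proof (rule iid_negative_drift)
    show "indep_vars (\<lambda>_. borel) (\<lambda>i \<omega>. s * (Y i \<omega> - \<mu>) - e) UNIV"
      by (rule indep_vars_compose2[OF indep]) measurable
    show "distr M borel (\<lambda>\<omega>. s * (Y i \<omega> - \<mu>) - e) = distr M borel (\<lambda>\<omega>. s * (Y 0 \<omega> - \<mu>) - e)" for i
    proof -
      have "distr M borel (\<lambda>\<omega>. s * (Y j \<omega> - \<mu>) - e) = distr (distr M borel (Y j)) borel (\<lambda>y. s * (y - \<mu>) - e)" for j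
        by (subst distr_distr) (auto simp: comp_def)
      then show ?thesis using id[of i] by simp
    qed
    show "integrable M (\<lambda>\<omega>. s * (Y 0 \<omega> - \<mu>) - e)" using int by auto
    show "expectation (\<lambda>\<omega>. s * (Y 0 \<omega> - \<mu>) - e) < 0"
      using int that by (simp add: \<mu>_def prob_space)
  qed
  have "AE \<omega> in M. \<forall>j. (\<exists>B. \<forall>k. (\<Sum>i<k. 1 * (Y i \<omega> - \<mu>) - 1 / Suc j) \<le> B) \<and>
      (\<exists>B. \<forall>k. (\<Sum>i<k. (-1) * (Y i \<omega> - \<mu>) - 1 / Suc j) \<le> B)"
    unfolding AE_all_countable by (intro allI AE_conjI key) auto
  then show ?thesis unfolding \<mu>_def[symmetric]
  proof eventually_elim
    case (elim \<omega>)
    show ?case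
    proof (rule LIMSEQ_I)
      fix e :: real assume "e > 0"
      then obtain j where j: "1 / real (Suc j) < e / 2"
        by (meson half_gt_zero nat_approx_posE)
      obtain B1 where B1: "\<And>k. (\<Sum>i<k. 1 * (Y i \<omega> - \<mu>) - 1 / Suc j) \<le> B1" using elim by blast
      obtain B2 where B2: "\<And>k. (\<Sum>i<k. (-1) * (Y i \<omega> - \<mu>) - 1 / Suc j) \<le> B2" using elim by blast
      obtain N where N: "real N > 2 * (\<bar>B1\<bar> + \<bar>B2\<bar>) / e" using reals_Archimedean2 by blast
      have "norm ((\<Sum>i<n. Y i \<omega>) / real n - \<mu>) < e" if "n \<ge> Suc N" for n
      proof -
        have n: "real n > 0" "real n > 2 * (\<bar>B1\<bar> + \<bar>B2\<bar>) / e" using that N by auto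
        then have n2: "\<bar>B1\<bar> + \<bar>B2\<bar> < real n * e / 2" using \<open>e > 0\<close> by (simp add: field_simps)
        have n3: "real n * (1 / real (Suc j)) < real n * (e / 2)"
          using j n by (intro mult_strict_left_mono) auto
        define S where "S = (\<Sum>i<n. Y i \<omega>)"
        have "S - real n * \<mu> - real n * (1 / real (Suc j)) \<le> B1"
          using B1[of n] by (simp add: sum_subtractf S_def)
        moreover have "- (S - real n * \<mu>) - real n * (1 / real (Suc j)) \<le> B2"
          using B2[of n] by (simp add: sum_subtractf S_def sum_negf)
        ultimately have "\<bar>S - real n * \<mu>\<bar> < real n * e"
          using n2 n3 by linarith
        then have "\<bar>S - real n * \<mu>\<bar> / real n < e" using n by (simp add: field_simps)
        moreover have "\<bar>S - real n * \<mu>\<bar> / real n = \<bar>S / real n - \<mu>\<bar>"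
        proof -
          have "S / real n - \<mu> = (S - real n * \<mu>) / real n" using n by (simp add: field_simps)
          then show ?thesis by simp
        qed
        ultimately show ?thesis by (simp add: S_def)
      qed
      then show "\<exists>no. \<forall>n\<ge>no. norm ((\<Sum>i<n. Y i \<omega>) / real n - \<mu>) < e" by blast
    qed
  qed
qed

end

section \<open>Log-concave functions\<close>

text \<open>In this form zero values need no extended reals: a factor \<open>0 powr s = 0\<close>
  makes the left-hand side vanish, as -\<infinity> does in the sum of logarithms.\<close>

lemma log_concave_fun_iff:
  fixes f :: "'a::euclidean_space \<Rightarrow> real"
  assumes nn: "\<And>x. 0 \<le> f x"
  shows "log_concave_fun f \<longleftrightarrow>
    (\<forall>x y. \<forall>t\<in>{0<..<1}. f x powr (1 - t) * f y powr t \<le> f ((1 - t) *\<^sub>R x + t *\<^sub>R y))"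
proof (intro iffI allI ballI)
  fix x y :: 'a and t :: real assume lc: "log_concave_fun f" and t: "t \<in> {0<..<1}"
  let ?z = "(1 - t) *\<^sub>R x + t *\<^sub>R y"
  show "f x powr (1 - t) * f y powr t \<le> f ?z"
  proof (cases "f x = 0 \<or> f y = 0")
    case True then show ?thesis using nn by auto
  next
    case False
    then have pos: "0 < f x" "0 < f y" using nn by (auto simp: less_le)
    have *: "ereal (1 - t) * elog (f x) + ereal t * elog (f y) \<le> elog (f ?z)"
      using lc t unfolding log_concave_fun_def by auto
    then have zpos: "0 < f ?z" using pos by (auto simp: elog_def split: if_splits)
    with * pos have "(1 - t) * ln (f x) + t * ln (f y) \<le> ln (f ?z)" by (simp add: elog_def)
    then have "exp ((1 - t) * ln (f x) + t * ln (f y)) \<le> f ?z"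
      using zpos by (metis exp_le_cancel_iff exp_ln)
    then show ?thesis using pos by (simp add: powr_def exp_add)
  qed
next
  fix x y :: 'a and t :: real
  assume R: "\<forall>x y. \<forall>t\<in>{0<..<1}. f x powr (1 - t) * f y powr t \<le> f ((1 - t) *\<^sub>R x + t *\<^sub>R y)"
  show "log_concave_fun f" unfolding log_concave_fun_def
  proof (intro allI ballI)
    fix x y :: 'a and t :: real assume t: "t \<in> {0..1}"
    let ?z = "(1 - t) *\<^sub>R x + t *\<^sub>R y"
    consider "t = 0" | "t = 1" | "0 < t" "t < 1" "f x \<le> 0 \<or> f y \<le> 0" | "0 < t" "t < 1" "0 < f x" "0 < f y"
      using t by force
    then show "ereal (1 - t) * elog (f x) + ereal t * elog (f y) \<le> elog (f ?z)"
    proof cases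
      case 1 then show ?thesis by (simp add: zero_ereal_def[symmetric] one_ereal_def[symmetric])
    next
      case 2 then show ?thesis by (simp add: zero_ereal_def[symmetric] one_ereal_def[symmetric])
    next
      case 3 then show ?thesis by (auto simp: elog_def)
    next
      case 4
      then have *: "exp ((1 - t) * ln (f x) + t * ln (f y)) \<le> f ?z"
        using R[rule_format, of t x y] by (simp add: powr_def exp_add)
      then have "0 < f ?z" by (meson exp_gt_zero less_le_trans)
      with * have "(1 - t) * ln (f x) + t * ln (f y) \<le> ln (f ?z)" by (simp add: ln_ge_iff)
      then show ?thesis using 4 \<open>0 < f ?z\<close> by (simp add: elog_def)
    qed
  qed
qed

lemma log_concave_fun_ln:
  assumes "log_concave_fun f" "0 < f x" "0 < f y" "0 \<le> t" "t \<le> 1"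
  shows "0 < f ((1 - t) *\<^sub>R x + t *\<^sub>R y)"
    and "(1 - t) * ln (f x) + t * ln (f y) \<le> ln (f ((1 - t) *\<^sub>R x + t *\<^sub>R y))"
proof -
  have *: "ereal (1 - t) * elog (f x) + ereal t * elog (f y) \<le> elog (f ((1 - t) *\<^sub>R x + t *\<^sub>R y))"
    using assms unfolding log_concave_fun_def by auto
  then show "0 < f ((1 - t) *\<^sub>R x + t *\<^sub>R y)"
    using assms by (auto simp: elog_def split: if_splits)
  with * assms show "(1 - t) * ln (f x) + t * ln (f y) \<le> ln (f ((1 - t) *\<^sub>R x + t *\<^sub>R y))"
    by (auto simp: elog_def split: if_splits)
qed

text \<open>Lower bounds written as exponentials carry positivity with them, so the later estimates
  compute with exponents only.\<close>

lemma log_concave_fun_exp: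
  assumes "log_concave_fun f" "exp a \<le> f x" "exp b \<le> f y" "0 \<le> t" "t \<le> 1"
  shows "exp ((1 - t) * a + t * b) \<le> f ((1 - t) *\<^sub>R x + t *\<^sub>R y)"
proof -
  have pos: "0 < f x" "0 < f y" using assms by (meson exp_gt_zero less_le_trans)+
  have "a \<le> ln (f x)" "b \<le> ln (f y)" using assms pos by (simp_all add: ln_ge_iff)
  then have "(1 - t) * a + t * b \<le> (1 - t) * ln (f x) + t * ln (f y)"
    using assms by (intro add_mono mult_left_mono) auto
  also note log_concave_fun_ln(2)[OF assms(1) pos assms(4,5)]
  finally show ?thesis using log_concave_fun_ln(1)[OF assms(1) pos assms(4,5)] by (simp add: ln_ge_iff)
qed

lemma convex_superlevel:
  assumes lc: "log_concave_fun f" and c: "0 < c"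
  shows "convex {x. c \<le> f x}"
proof (rule convexI)
  fix x y and u v :: real
  assume *: "x \<in> {x. c \<le> f x}" "y \<in> {x. c \<le> f x}" "0 \<le> u" "0 \<le> v" "u + v = 1"
  have "exp ((1 - v) * ln c + v * ln c) \<le> f ((1 - v) *\<^sub>R x + v *\<^sub>R y)"
    using * c by (intro log_concave_fun_exp[OF lc]) auto
  moreover have "1 - v = u" using * by simp
  moreover have "(1 - v) * ln c + v * ln c = ln c" by (simp add: algebra_simps)
  ultimately show "u *\<^sub>R x + v *\<^sub>R y \<in> {x. c \<le> f x}" using c by simp
qed

lemma log_concave_fun_sqrt_mult:
  fixes f g :: "'a::euclidean_space \<Rightarrow> real"
  assumes f: "log_concave_fun f" "\<And>x. 0 \<le> f x" and g: "log_concave_fun g" "\<And>x. 0 \<le> g x"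
  shows "log_concave_fun (\<lambda>x. sqrt (f x * g x))"
proof (subst log_concave_fun_iff)
  show "0 \<le> sqrt (f x * g x)" for x using assms by simp
  show "\<forall>x y. \<forall>t\<in>{0<..<1}. sqrt (f x * g x) powr (1 - t) * sqrt (f y * g y) powr t
     \<le> sqrt (f ((1 - t) *\<^sub>R x + t *\<^sub>R y) * g ((1 - t) *\<^sub>R x + t *\<^sub>R y))"
  proof (intro allI ballI)
    fix x y :: 'a and t :: real assume t: "t \<in> {0<..<1}"
    have s: "sqrt u powr a = sqrt (u powr a)" if "0 \<le> u" for u a
      using that by (simp add: powr_half_sqrt[symmetric] powr_powr mult.commute)
    have "sqrt (f x * g x) powr (1 - t) * sqrt (f y * g y) powr t =
      sqrt ((f x powr (1 - t) * f y powr t) * (g x powr (1 - t) * g y powr t))"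
      using assms by (simp add: s powr_mult real_sqrt_mult ac_simps)
    also have "\<dots> \<le> sqrt (f ((1 - t) *\<^sub>R x + t *\<^sub>R y) * g ((1 - t) *\<^sub>R x + t *\<^sub>R y))"
      using f(1) g(1) t assms unfolding log_concave_fun_iff[of f, OF f(2)] log_concave_fun_iff[of g, OF g(2)]
      by (intro real_sqrt_le_mono mult_mono) auto
    finally show "sqrt (f x * g x) powr (1 - t) * sqrt (f y * g y) powr t
     \<le> sqrt (f ((1 - t) *\<^sub>R x + t *\<^sub>R y) * g ((1 - t) *\<^sub>R x + t *\<^sub>R y))" .
  qed
qed

lemma log_concave_fun_divide:
  fixes f :: "'a::euclidean_space \<Rightarrow> real"
  assumes f: "log_concave_fun f" "\<And>x. 0 \<le> f x" and c: "0 < c"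
  shows "log_concave_fun (\<lambda>x. f x / c)"
proof (subst log_concave_fun_iff)
  show "0 \<le> f x / c" for x using assms by simp
  show "\<forall>x y. \<forall>t\<in>{0<..<1}. (f x / c) powr (1 - t) * (f y / c) powr t
     \<le> f ((1 - t) *\<^sub>R x + t *\<^sub>R y) / c"
  proof (intro allI ballI)
    fix x y :: 'a and t :: real assume t: "t \<in> {0<..<1}"
    have "(f x / c) powr (1 - t) * (f y / c) powr t = (f x powr (1 - t) * f y powr t) / (c powr (1 - t) * c powr t)"
      using assms by (simp add: powr_divide)
    also have "c powr (1 - t) * c powr t = c" using c by (simp add: powr_add[symmetric])
    also have "(f x powr (1 - t) * f y powr t) / c \<le> f ((1 - t) *\<^sub>R x + t *\<^sub>R y) / c"
      using f(1) t c unfolding log_concave_fun_iff[of f, OF f(2)] by (intro divide_right_mono) auto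
    finally show "(f x / c) powr (1 - t) * (f y / c) powr t \<le> f ((1 - t) *\<^sub>R x + t *\<^sub>R y) / c" .
  qed
qed

text \<open>Suprema and lower limits provide information only about values strictly below them.
  Continuity of the weighted geometric mean under scaling by s < 1 closes the gap.\<close>

lemma powr_mult_le_approx:
  fixes a b c t :: real
  assumes t: "t \<in> {0<..<1}" and ab: "0 \<le> a" "0 \<le> b" and c: "0 \<le> c"
    and le: "\<And>u v. 0 < u \<Longrightarrow> u < a \<Longrightarrow> 0 < v \<Longrightarrow> v < b \<Longrightarrow> u powr (1 - t) * v powr t \<le> c"
  shows "a powr (1 - t) * b powr t \<le> c"
proof (cases "a = 0 \<or> b = 0")
  case True then show ?thesis using c by auto
next
  case False
  then have pos: "0 < a" "0 < b" using ab by auto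
  have "((\<lambda>s. (s * a) powr (1 - t) * (s * b) powr t) \<longlongrightarrow> (1 * a) powr (1 - t) * (1 * b) powr t) (at_left 1)"
    using pos by (intro tendsto_intros) auto
  moreover have "\<forall>\<^sub>F s in at_left 1. (s * a) powr (1 - t) * (s * b) powr t \<le> c"
  proof (rule eventually_at_leftI[of 0])
    fix s :: real assume "s \<in> {0<..<1}"
    then show "(s * a) powr (1 - t) * (s * b) powr t \<le> c" using pos by (intro le) auto
  qed simp
  ultimately have "(1 * a) powr (1 - t) * (1 * b) powr t \<le> c"
    by (rule tendsto_upperbound) simp
  then show ?thesis by simp
qed

text \<open>A strict lower bound for a lower limit holds for all large k, so bounds at two points
  hold for the same k and can be combined. This works at every point, whereas an almost everywhere
  limit would be determined only up to a null set. The bound \<open>B\<close> ensures that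
  \<open>enn2real\<close> loses nothing.\<close>

lemma log_concave_fun_liminf:
  fixes f :: "nat \<Rightarrow> 'a::euclidean_space \<Rightarrow> real"
  assumes f: "\<And>k. log_concave_fun (f k)" and nn: "\<And>k x. 0 \<le> f k x" and bd: "\<And>k x. f k x \<le> B"
  defines "g \<equiv> \<lambda>x. enn2real (liminf (\<lambda>k. ennreal (f k x)))"
  shows "log_concave_fun g"
proof (subst log_concave_fun_iff)
  show "0 \<le> g x" for x by (simp add: g_def)
  have B: "0 \<le> B" using nn bd order_trans by blast
  have fin: "liminf (\<lambda>k. ennreal (f k x)) = ennreal (g x)" for x
  proof -
    have "liminf (\<lambda>k. ennreal (f k x)) \<le> liminf (\<lambda>k::nat. ennreal B)"
      by (rule Liminf_mono) (use bd B in \<open>auto intro!: ennreal_leI\<close>)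
    also have "\<dots> = ennreal B" by (simp add: Liminf_const)
    also have "\<dots> < \<top>" by simp
    finally have "liminf (\<lambda>k. ennreal (f k x)) < \<top>" .
    then show ?thesis unfolding g_def by simp
  qed
  show "\<forall>x y. \<forall>t\<in>{0<..<1}. g x powr (1 - t) * g y powr t \<le> g ((1 - t) *\<^sub>R x + t *\<^sub>R y)"
  proof (intro allI ballI, rule powr_mult_le_approx)
    fix x y :: 'a and t u v :: real
    assume t: "t \<in> {0<..<1}" and uv: "0 < u" "u < g x" "0 < v" "v < g y"
    let ?z = "(1 - t) *\<^sub>R x + t *\<^sub>R y"
    have "ennreal u < liminf (\<lambda>k. ennreal (f k x))" "ennreal v < liminf (\<lambda>k. ennreal (f k y))"
      unfolding fin using uv by (auto intro!: ennreal_lessI)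
    then have "\<forall>\<^sub>F k in sequentially. ennreal u < f k x" "\<forall>\<^sub>F k in sequentially. ennreal v < f k y"
      by (auto dest!: less_LiminfD)
    then have "\<forall>\<^sub>F k in sequentially. ennreal (u powr (1 - t) * v powr t) \<le> ennreal (f k ?z)"
    proof eventually_elim
      case (elim k)
      then have "u < f k x" "v < f k y" using uv by (auto simp: ennreal_less_iff)
      then have "u powr (1 - t) * v powr t \<le> f k x powr (1 - t) * f k y powr t"
        using uv t by (intro mult_mono powr_mono2) auto
      also have "\<dots> \<le> f k ?z"
        using f[of k] t unfolding log_concave_fun_iff[of "f k", OF nn] by auto
      finally show ?case by (rule ennreal_leI)
    qed
    then have "ennreal (u powr (1 - t) * v powr t) \<le> liminf (\<lambda>k. ennreal (f k ?z))"
      by (rule Liminf_bounded)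
    then show "u powr (1 - t) * v powr t \<le> g ?z" unfolding fin by (simp add: g_def)
  qed (auto simp: g_def)
qed

section \<open>Sup-convolution\<close>

text \<open>For a nonnegative bounded \<open>f\<close> that is not identically 0, the logarithm of
  this function is the Pasch-Hausdorff envelope of \<open>ln f\<close>, its least L-Lipschitz
  majorant.\<close>

definition sup_conv :: "real \<Rightarrow> ('a::euclidean_space \<Rightarrow> real) \<Rightarrow> 'a \<Rightarrow> real" where
  "sup_conv L f x = (SUP y. f y * exp (- L * norm (x - y)))"

context
  fixes f :: "'a::euclidean_space \<Rightarrow> real" and L B :: real
  assumes nn: "\<And>x. 0 \<le> f x" and bd: "\<And>x. f x \<le> B" and L: "0 \<le> L"
begin

lemma sup_conv_term_le: "f y * exp (- L * norm (x - y)) \<le> B"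
proof -
  have "f y * exp (- L * norm (x - y)) \<le> f y * 1"
    using nn L by (intro mult_left_mono) auto
  with bd[of y] show ?thesis by simp
qed

lemma bdd_sup_conv: "bdd_above (range (\<lambda>y. f y * exp (- L * norm (x - y))))"
  using sup_conv_term_le by (intro bdd_aboveI2)

lemma sup_conv_ge_term: "f y * exp (- L * norm (x - y)) \<le> sup_conv L f x"
  unfolding sup_conv_def by (rule cSUP_upper[OF _ bdd_sup_conv]) simp

lemma sup_conv_ge: "f x \<le> sup_conv L f x"
  using sup_conv_ge_term[of x x] by simp

lemma sup_conv_nonneg: "0 \<le> sup_conv L f x"
  using sup_conv_ge[of x] nn[of x] by simp

lemma sup_conv_le: "sup_conv L f x \<le> B"
  unfolding sup_conv_def by (rule cSUP_least) (use sup_conv_term_le in auto)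

lemma sup_conv_Harnack: "sup_conv L f x * exp (- L * norm (x - x')) \<le> sup_conv L f x'"
proof -
  have "sup_conv L f x \<le> sup_conv L f x' * exp (L * norm (x - x'))"
    unfolding sup_conv_def[of L f x]
  proof (rule cSUP_least)
    fix y
    have "norm (x' - y) \<le> norm (x - x') + norm (x - y)"
      by (metis add.commute dist_norm dist_triangle3)
    then have "L * norm (x' - y) \<le> L * norm (x - x') + L * norm (x - y)"
      using L by (metis distrib_left mult_left_mono)
    then have "exp (- L * norm (x - y)) \<le> exp (- L * norm (x' - y)) * exp (L * norm (x - x'))"
      by (simp add: exp_add[symmetric])
    then have "f y * exp (- L * norm (x - y)) \<le> (f y * exp (- L * norm (x' - y))) * exp (L * norm (x - x'))"
      using nn[of y] by (simp add: mult.assoc mult_left_mono)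
    also have "\<dots> \<le> sup_conv L f x' * exp (L * norm (x - x'))"
      by (intro mult_right_mono sup_conv_ge_term) auto
    finally show "f y * exp (- L * norm (x - y)) \<le> sup_conv L f x' * exp (L * norm (x - x'))" .
  qed simp
  then have "sup_conv L f x * exp (- L * norm (x - x')) \<le>
      sup_conv L f x' * exp (L * norm (x - x')) * exp (- L * norm (x - x'))"
    by (intro mult_right_mono) auto
  then show ?thesis by (simp add: mult.assoc exp_add[symmetric])
qed

lemma sup_conv_pos:
  assumes "0 < f z" shows "0 < sup_conv L f x"
  using sup_conv_ge_term[of z x] assms by (smt (verit) exp_gt_zero mult_pos_pos)

lemma lipschitz_ln_sup_conv:
  assumes "0 < f z"
  shows "\<bar>ln (sup_conv L f x) - ln (sup_conv L f y)\<bar> \<le> L * norm (x - y)"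
proof -
  have *: "ln (sup_conv L f x) - L * norm (x - y) \<le> ln (sup_conv L f y)" for x y
  proof -
    note p = sup_conv_pos[OF assms]
    have "ln (sup_conv L f x * exp (- L * norm (x - y))) \<le> ln (sup_conv L f y)"
      using p[of x] p[of y] sup_conv_Harnack[of x y] by (intro ln_mono) auto
    then show ?thesis using p[of x] by (simp add: ln_mult)
  qed
  from *[of x y] *[of y x] show ?thesis by (simp add: norm_minus_commute abs_le_iff)
qed

lemma log_concave_fun_sup_conv:
  assumes lc: "log_concave_fun f"
  shows "log_concave_fun (sup_conv L f)"
proof (subst log_concave_fun_iff)
  show "\<forall>x y. \<forall>t\<in>{0<..<1}. sup_conv L f x powr (1 - t) * sup_conv L f y powr t
      \<le> sup_conv L f ((1 - t) *\<^sub>R x + t *\<^sub>R y)"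
  proof (intro allI ballI, rule powr_mult_le_approx)
    fix x y :: 'a and t u v :: real
    assume t: "t \<in> {0<..<1}" and uv: "0 < u" "u < sup_conv L f x" "0 < v" "v < sup_conv L f y"
    let ?z = "(1 - t) *\<^sub>R x + t *\<^sub>R y"
    obtain x' where x': "u < f x' * exp (- L * norm (x - x'))"
      using uv(2) less_cSUP_iff[OF UNIV_not_empty bdd_sup_conv[of x], of u] unfolding sup_conv_def by blast
    obtain y' where y': "v < f y' * exp (- L * norm (y - y'))"
      using uv(4) less_cSUP_iff[OF UNIV_not_empty bdd_sup_conv[of y], of v] unfolding sup_conv_def by blast
    \<comment> \<open>Concavity of ln f and of - L times the norm act together: the combination of
      near-optimal points for \<open>x\<close> and \<open>y\<close> is a competitor in the supremum
      at the combination of \<open>x\<close> and \<open>y\<close>.\<close>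
    let ?w = "(1 - t) *\<^sub>R x' + t *\<^sub>R y'"
    have "norm (?z - ?w) = norm ((1 - t) *\<^sub>R (x - x') + t *\<^sub>R (y - y'))"
      by (simp add: algebra_simps)
    also have "\<dots> \<le> (1 - t) * norm (x - x') + t * norm (y - y')"
      using t by (intro order_trans[OF norm_triangle_ineq]) auto
    finally have "L * norm (?z - ?w) \<le> L * ((1 - t) * norm (x - x') + t * norm (y - y'))"
      using L by (rule mult_left_mono)
    then have n: "exp (- L * norm (x - x')) powr (1 - t) * exp (- L * norm (y - y')) powr t \<le> exp (- L * norm (?z - ?w))"
      by (simp add: powr_def exp_add[symmetric] algebra_simps)
    have "u powr (1 - t) * v powr t \<le>
      (f x' * exp (- L * norm (x - x'))) powr (1 - t) * (f y' * exp (- L * norm (y - y'))) powr t"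
      using uv t x' y' by (intro mult_mono powr_mono2) auto
    also have "\<dots> = (f x' powr (1 - t) * f y' powr t) *
      (exp (- L * norm (x - x')) powr (1 - t) * exp (- L * norm (y - y')) powr t)"
      using nn by (simp add: powr_mult)
    also have "\<dots> \<le> f ?w * exp (- L * norm (?z - ?w))"
      using lc t nn n unfolding log_concave_fun_iff[of f, OF nn]
      by (intro mult_mono) auto
    also have "\<dots> \<le> sup_conv L f ?z" by (rule sup_conv_ge_term)
    finally show "u powr (1 - t) * v powr t \<le> sup_conv L f ?z" .
  qed (auto simp: sup_conv_nonneg)
qed (rule sup_conv_nonneg)

end

section \<open>Log-concave densities\<close>

lemma prob_densityD:
  assumes "prob_density f"
  shows "f \<in> borel_measurable lebesgue" "0 \<le> f x" "integrable lebesgue f" "integral\<^sup>L lebesgue f = 1"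
    "(\<integral>\<^sup>+x. ennreal (f x) \<partial>lebesgue) = 1"
proof -
  show m: "f \<in> borel_measurable lebesgue" "0 \<le> f x" "(\<integral>\<^sup>+x. ennreal (f x) \<partial>lebesgue) = 1" for x
    using assms by (auto simp: prob_density_def)
  then show i: "integrable lebesgue f" by (intro integrableI_nonneg) auto
  show "integral\<^sup>L lebesgue f = 1" using m by (simp add: integral_eq_nn_integral)
qed

lemma log_concave_densityD:
  assumes "log_concave_density f"
  shows "prob_density f" "log_concave_fun f"
  using assms by (auto simp: log_concave_density_def)

lemma log_concave_density_normalise:
  fixes f :: "'a::euclidean_space \<Rightarrow> real"
  assumes "log_concave_fun f" "\<And>x. 0 \<le> f x" "integrable lebesgue f" "0 < integral\<^sup>L lebesgue f"
  shows "log_concave_density (\<lambda>x. f x / integral\<^sup>L lebesgue f)"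
proof -
  have "(\<integral>\<^sup>+x. ennreal (f x / integral\<^sup>L lebesgue f) \<partial>lebesgue) = ennreal (LINT x|lebesgue. f x / integral\<^sup>L lebesgue f)"
    by (rule nn_integral_eq_integral) (use assms in auto)
  also have "\<dots> = 1" using assms(4) by simp
  finally have "prob_density (\<lambda>x. f x / integral\<^sup>L lebesgue f)"
    unfolding prob_density_def using assms by auto
  then show ?thesis
    using log_concave_fun_divide[OF assms(1,2,4)] by (simp add: log_concave_density_def)
qed

lemma prob_density_superlevel:
  assumes "prob_density f" "A \<in> sets lebesgue" "\<And>x. x \<in> A \<Longrightarrow> c \<le> f x" "0 \<le> c"
  shows "ennreal c * emeasure lebesgue A \<le> 1"
proof -
  have "ennreal c * emeasure lebesgue A = (\<integral>\<^sup>+x. ennreal c * indicator A x \<partial>lebesgue)"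
    using assms by (simp add: nn_integral_cmult_indicator)
  also have "\<dots> \<le> (\<integral>\<^sup>+x. ennreal (f x) \<partial>lebesgue)"
    using assms by (intro nn_integral_mono) (auto simp: indicator_def intro!: ennreal_leI)
  finally show ?thesis using prob_densityD(5)[OF assms(1)] by simp
qed

section \<open>Pointwise bounds forced by total mass one\<close>

lemma emeasure_lebesgue_ball:
  "0 \<le> r \<Longrightarrow> emeasure lebesgue (ball z r :: 'a::euclidean_space set) = ennreal (unit_ball_vol DIM('a) * r ^ DIM('a))"
  by (simp add: emeasure_ball)

lemma prob_density_ball_le:
  fixes f :: "'a::euclidean_space \<Rightarrow> real"
  assumes "prob_density f" "\<And>x. x \<in> ball z r \<Longrightarrow> c \<le> f x" "0 \<le> c" "0 \<le> r"
  shows "c * (unit_ball_vol DIM('a) * r ^ DIM('a)) \<le> 1"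
proof -
  have "ennreal c * ennreal (unit_ball_vol DIM('a) * r ^ DIM('a)) \<le> 1"
    using prob_density_superlevel[of f "ball z r" c] assms by (simp add: emeasure_ball)
  then show ?thesis
    using assms by (subst (asm) ennreal_mult[symmetric]) (auto simp: ennreal_le_1)
qed

text \<open>The homothety with centre \<open>x\<close> and ratio \<eta> maps \<open>ball z r\<close>
  onto the ball in the last premise; \<open>w\<close> is the preimage of \<open>y\<close>. Points of
  that ball are thus convex combinations of \<open>x\<close>, with weight 1 - \<eta>, and a point of
  \<open>ball z r\<close>. A value at one point becomes a lower bound on a set of known volume,
  which is how pointwise and integral information are exchanged below.\<close>

lemma log_concave_density_cone_ball:
  fixes f :: "'a::euclidean_space \<Rightarrow> real"
  assumes f: "log_concave_density f" and ball: "\<And>y. y \<in> ball z r \<Longrightarrow> exp (- K) \<le> f y"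
    and x: "exp v \<le> f x" and eta: "0 < \<eta>" "\<eta> \<le> 1" and y: "y \<in> ball (x + \<eta> *\<^sub>R (z - x)) (\<eta> * r)"
  shows "exp ((1 - \<eta>) * v - \<eta> * K) \<le> f y"
proof -
  define w where "w = x + (1 / \<eta>) *\<^sub>R (y - x)"
  have yw: "y = (1 - \<eta>) *\<^sub>R x + \<eta> *\<^sub>R w" using eta by (simp add: w_def algebra_simps)
  have "z - w = (1 / \<eta>) *\<^sub>R (x + \<eta> *\<^sub>R (z - x) - y)" using eta by (simp add: w_def algebra_simps)
  then have "norm (z - w) = (1 / \<eta>) * norm (x + \<eta> *\<^sub>R (z - x) - y)" using eta by simp
  also have "\<dots> < (1 / \<eta>) * (\<eta> * r)" using y eta by (intro mult_strict_left_mono) (auto simp: dist_norm)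
  finally have "w \<in> ball z r" using eta by (simp add: dist_norm)
  from log_concave_fun_exp[OF log_concave_densityD(2)[OF f] x ball[OF this], of \<eta>] eta show ?thesis
    by (simp add: yw)
qed

lemma L1_dist_ge_ball:
  fixes f g :: "'a::euclidean_space \<Rightarrow> real"
  assumes "integrable lebesgue f" "integrable lebesgue g" and s: "0 \<le> s"
    and far: "\<And>y. y \<in> ball w s \<Longrightarrow> \<delta> \<le> \<bar>f y - g y\<bar>"
  shows "\<delta> * (unit_ball_vol DIM('a) * s ^ DIM('a)) \<le> (LINT y|lebesgue. \<bar>f y - g y\<bar>)"
proof -
  have "measure lebesgue (ball w s) = unit_ball_vol DIM('a) * s ^ DIM('a)"
    using s by (simp add: content_ball)
  then have "\<delta> * (unit_ball_vol DIM('a) * s ^ DIM('a)) = (LINT y|lebesgue. \<delta> * indicator (ball w s) y)"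
    by simp
  also have "\<dots> \<le> (LINT y|lebesgue. \<bar>f y - g y\<bar>)"
  proof (rule integral_mono)
    have "integrable lebesgue (indicator (ball w s) :: 'a \<Rightarrow> real)"
      by (rule integrable_real_indicator) (use emeasure_lebesgue_ball[OF s, of w] in auto)
    then show "integrable lebesgue (\<lambda>y. \<delta> * indicator (ball w s) y)" by simp
    show "integrable lebesgue (\<lambda>y. \<bar>f y - g y\<bar>)" using assms by auto
    show "\<delta> * indicator (ball w s) y \<le> \<bar>f y - g y\<bar>" for y
      using far[of y] by (auto simp: indicator_def)
  qed
  finally show ?thesis .
qed

text \<open>The cone with apex \<open>x\<close> is cut at the fraction
  \<open>s = 1 / (m - q)\<close>, where the exponent has dropped by exactly 1: (1 - s) m + s q = m -
  1. The small ball there has radius s r and mass at most 1. Height thus enters exponentially on the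
  left and only polynomially on the right.\<close>

lemma log_concave_density_peak:
  fixes f :: "'a::euclidean_space \<Rightarrow> real"
  assumes f: "log_concave_density f" and ball: "\<And>y. y \<in> ball z r \<Longrightarrow> exp q \<le> f y"
    and x: "exp m \<le> f x" and q: "q + 1 \<le> m" and r: "0 \<le> r"
  shows "exp (m - 1) * (unit_ball_vol DIM('a) * r ^ DIM('a)) \<le> (m - q) ^ DIM('a)"
proof -
  note f' = log_concave_densityD[OF f]
  define s where "s = 1 / (m - q)"
  have s: "0 < s" "s \<le> 1" using q by (auto simp: s_def)
  have "s * (m - q) = 1" using q by (simp add: s_def)
  then have "(1 - s) * m - s * (- q) = m - 1" by (simp add: algebra_simps)
  then have "exp (m - 1) \<le> f y" if "y \<in> ball (x + s *\<^sub>R (z - x)) (s * r)" for y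
    using log_concave_density_cone_ball[OF f _ x s that, of "- q"] ball by simp
  from prob_density_ball_le[OF f'(1) this] s r
  have "exp (m - 1) * (unit_ball_vol DIM('a) * (s * r) ^ DIM('a)) \<le> 1" by simp
  then have "exp (m - 1) * (unit_ball_vol DIM('a) * (s * r) ^ DIM('a)) * (m - q) ^ DIM('a) \<le> 1 * (m - q) ^ DIM('a)"
    using q by (intro mult_right_mono) auto
  moreover have "(s * r) ^ DIM('a) * (m - q) ^ DIM('a) = r ^ DIM('a)"
    using q by (simp add: power_mult_distrib[symmetric] s_def)
  ultimately show ?thesis by (simp add: mult.assoc)
qed

lemma exp_beats_power:
  fixes a b v :: real
  assumes "0 < v" "0 \<le> a"
  shows "\<exists>T\<ge>1. \<forall>m\<ge>T. (a * m + b) ^ d < v * exp m \<or> a * m + b < 0"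
proof -
  define C where "C = (a + \<bar>b\<bar>) ^ d"
  have "((\<lambda>m. C * (m ^ d / exp m)) \<longlongrightarrow> C * 0) at_top"
    by (intro tendsto_intros tendsto_power_div_exp_0)
  then have "\<forall>\<^sub>F m in at_top. C * (m ^ d / exp m) < v"
    using assms by (intro order_tendstoD(2)) auto
  then obtain T where T: "\<And>m. m \<ge> T \<Longrightarrow> C * (m ^ d / exp m) < v"
    unfolding eventually_at_top_linorder by blast
  have "(a * m + b) ^ d < v * exp m \<or> a * m + b < 0" if m: "m \<ge> max T 1" for m
  proof (cases "a * m + b < 0")
    case False
    have "b \<le> \<bar>b\<bar> * m" using m mult_left_mono[of 1 m "\<bar>b\<bar>"] by simp
    then have "a * m + b \<le> (a + \<bar>b\<bar>) * m" by (simp add: algebra_simps)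
    then have "(a * m + b) ^ d \<le> C * m ^ d"
      unfolding C_def power_mult_distrib[symmetric] using False by (intro power_mono) auto
    also have "\<dots> < v * exp m" using T[of m] m by (simp add: field_simps)
    finally show ?thesis by simp
  qed simp
  then show ?thesis by (intro exI[of _ "max T 1"]) auto
qed

text \<open>Convex sets with empty interior are negligible. If all superlevel sets were such, their
  countable union, the set where \<open>f\<close> is positive, would be null.\<close>

lemma log_concave_density_ball:
  fixes f :: "'a::euclidean_space \<Rightarrow> real"
  assumes f: "log_concave_density f"
  obtains z r K where "0 < r" "0 \<le> K" "\<And>y. y \<in> ball z r \<Longrightarrow> exp (- K) \<le> f y"
proof -
  note f' = log_concave_densityD[OF f]
  define S where "S = (\<lambda>j::nat. {x. exp (- real j) \<le> f x})"
  have "\<exists>j. interior (S j) \<noteq> {}"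
  proof (rule ccontr)
    assume "\<not> (\<exists>j. interior (S j) \<noteq> {})"
    then have "negligible (S j)" for j
      using negligible_convex_interior[of "S j"] convex_superlevel[OF f'(2), of "exp (- real j)"]
      by (simp add: S_def)
    then have "(\<Union>j. S j) \<in> null_sets lebesgue"
      by (intro null_sets_UN) (simp add: negligible_iff_null_sets)
    then have "AE x in lebesgue. x \<notin> (\<Union>j. S j)" by (rule AE_not_in)
    then have "AE x in lebesgue. ennreal (f x) = 0"
    proof eventually_elim
      case (elim x)
      show ?case
      proof (rule ccontr)
        assume "ennreal (f x) \<noteq> 0"
        then have pos: "0 < f x" using prob_densityD(2)[OF f'(1)] by (simp add: less_le)
        obtain j :: nat where "- ln (f x) \<le> real j" using real_arch_simple by blast
        then have "exp (- real j) \<le> f x" using pos by (subst ln_ge_iff[symmetric]) auto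
        with elim show False by (auto simp: S_def)
      qed
    qed
    then have "(\<integral>\<^sup>+x. ennreal (f x) \<partial>lebesgue) = 0"
      by (subst nn_integral_cong_AE[of _ "\<lambda>_. 0"]) auto
    with prob_densityD(5)[OF f'(1)] show False by simp
  qed
  then obtain j z where "z \<in> interior (S j)" by blast
  then obtain r where "0 < r" "ball z r \<subseteq> S j" by (meson mem_interior)
  then show ?thesis by (intro that[of r "real j" z]) (auto simp: S_def)
qed

text \<open>With the ball fixed, \<open>log_concave_density_peak\<close> bounds exp m by a constant
  times a power of m + K, which fails for all large m.\<close>

lemma log_concave_density_bounded:
  fixes f :: "'a::euclidean_space \<Rightarrow> real"
  assumes f: "log_concave_density f"
  obtains M where "0 \<le> M" "\<And>x. f x \<le> exp M"
proof -
  obtain z r K where K: "0 < r" "0 \<le> K" and ball: "\<And>y. y \<in> ball z r \<Longrightarrow> exp (- K) \<le> f y"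
    by (rule log_concave_density_ball[OF f]) blast
  define V where "V = unit_ball_vol DIM('a) * r ^ DIM('a)"
  have V: "V > 0" using K by (simp add: V_def)
  obtain T where T: "T \<ge> 1" "\<And>m. m \<ge> T \<Longrightarrow> (1 * m + K) ^ DIM('a) < (V / exp 1) * exp m \<or> 1 * m + K < 0"
    using exp_beats_power[of "V / exp 1" 1 K "DIM('a)"] V by auto
  have "f x \<le> exp T" for x
  proof (rule ccontr)
    assume "\<not> f x \<le> exp T"
    then have "exp T \<le> f x" by simp
    from log_concave_density_peak[OF f ball this] T K
    have "exp (T - 1) * V \<le> (T + K) ^ DIM('a)" by (simp add: V_def)
    with T(2)[of T] K T(1) show False by (simp add: exp_diff field_simps)
  qed
  with T(1) show ?thesis by (intro that[of T]) auto
qed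

text \<open>The last premise is what a lower bound \<open>l\<close> on the mean of \<open>ln f\<close> gives, for any law that charges
  every set missed by a convex set not containing the ball with mass at least \<open>c\<close>. It is used for
  \<open>Q\<close> and for the empirical laws.\<close>

lemma log_concave_density_class_bounds:
  assumes c: "0 < c" "c \<le> 1" and r: "0 < r"
  obtains M K where "0 \<le> M" "0 \<le> K"
    "\<And>f (z::'a::euclidean_space). log_concave_density f \<Longrightarrow>
      (\<And>M q. q \<le> M \<Longrightarrow> (\<And>x. f x \<le> exp M) \<Longrightarrow> \<not> ball z r \<subseteq> {y. exp q \<le> f y} \<Longrightarrow> l \<le> M - (M - q) * c) \<Longrightarrow>
      (\<forall>x. f x \<le> exp M) \<and> (\<forall>y\<in>ball z r. exp (- K) \<le> f y)"
proof -
  define V where "V = unit_ball_vol DIM('a) * r ^ DIM('a)"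
  have V: "V > 0" using r by (simp add: V_def)
  \<comment> \<open>Chosen so that (1 + C) c = 2: for q = - C M0 the premise then reads l \<le> M0 -
    2 M0 = - M0, which contradicts M0 > - l.\<close>
  define C where "C = 2 / c - 1"
  have C: "1 \<le> C" "(1 + C) * c = 2" using c by (auto simp: C_def field_simps)
  obtain T where T: "T \<ge> 1" "\<And>m. m \<ge> T \<Longrightarrow> ((1 + C) * m + 0) ^ DIM('a) < (V / exp 2) * exp m \<or> (1 + C) * m + 0 < 0"
    using exp_beats_power[of "V / exp 2" "1 + C" 0 "DIM('a)"] V C by auto
  define M where "M = max T (\<bar>l\<bar> + 1)"
  define K where "K = max 0 ((M - l) / c) + 1"
  have M: "M \<ge> T" "M > - l" "M \<ge> 1" using T(1) by (auto simp: M_def)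
  show ?thesis
  proof (rule that[of M K])
    show "0 \<le> M" "0 \<le> K" using M by (auto simp: K_def)
    fix f :: "'a \<Rightarrow> real" and z
    assume f: "log_concave_density f"
      and H: "\<And>M q. q \<le> M \<Longrightarrow> (\<And>x. f x \<le> exp M) \<Longrightarrow> \<not> ball z r \<subseteq> {y. exp q \<le> f y} \<Longrightarrow> l \<le> M - (M - q) * c"
    have bd: "f x \<le> exp M" for x
    proof (rule ccontr)
      assume x: "\<not> f x \<le> exp M"
      obtain B where B: "\<And>x. f x \<le> exp B" using log_concave_density_bounded[OF f] by auto
      define S where "S = (SUP x. f x)"
      have bdd: "bdd_above (range f)" using B by (intro bdd_aboveI2)
      have S: "f y \<le> S" for y unfolding S_def by (rule cSUP_upper[OF _ bdd]) simp
      have SM: "exp M < S" using S[of x] x by simp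
      then have Spos: "0 < S" by (meson exp_gt_zero less_trans)
      define M0 where "M0 = ln S"
      have eM0: "exp M0 = S" using Spos by (simp add: M0_def)
      have M0: "M0 > M" using SM eM0 by (metis exp_less_cancel_iff)
      have "exp (M0 - 1) < S" unfolding eM0[symmetric] by simp
      \<comment> \<open>The supremum exp M0 need not be attained, so a point of height exp (M0 - 1)
        is used; the peak estimate loses another unit, hence the \<open>exp 2\<close> in the choice
        of \<open>T\<close>.\<close>
      then obtain x0 where x0: "exp (M0 - 1) < f x0"
        unfolding S_def by (subst (asm) less_cSUP_iff[OF _ bdd]) auto
      have CM: "C * M0 \<ge> M0" using C M M0 by simp
      have q: "- C * M0 + 1 \<le> M0 - 1" using CM M M0 by linarith
      \<comment> \<open>A supremum exp M0 above exp M is excluded in two ways: if \<open>f\<close>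
        is at least exp (- C M0) on the ball, the peak carries too much mass; otherwise
        \<open>f\<close> is so small on a set of mass \<open>c\<close> that the mean of ln f is too
        low.\<close>
      show False
      proof (cases "ball z r \<subseteq> {y. exp (- C * M0) \<le> f y}")
        case True
        have "exp (M0 - 1 - 1) * V \<le> (M0 - 1 - (- C * M0)) ^ DIM('a)"
          unfolding V_def
          by (rule log_concave_density_peak[OF f, of z r "- C * M0" "M0 - 1" x0])
            (use True x0 r q in auto)
        also have "\<dots> \<le> ((1 + C) * M0) ^ DIM('a)"
          using q by (intro power_mono) (auto simp: algebra_simps)
        finally have "exp (M0 - 2) * V \<le> ((1 + C) * M0) ^ DIM('a)" by simp
        moreover have "\<not> (1 + C) * M0 < 0" using C M M0 by (simp add: not_less)
        ultimately show False using T(2)[of M0] M M0 by (simp add: exp_diff field_simps)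
      next
        case False
        have "l \<le> M0 - (M0 - (- C * M0)) * c"
          by (rule H[OF _ _ False]) (use S eM0 q in auto)
        also have "\<dots> = M0 - M0 * ((1 + C) * c)" by (simp add: algebra_simps)
        also have "\<dots> = - M0" using C by simp
        finally show False using M M0 by simp
      qed
    qed
    moreover have "ball z r \<subseteq> {y. exp (- K) \<le> f y}"
    proof (rule ccontr)
      assume n: "\<not> ball z r \<subseteq> {y. exp (- K) \<le> f y}"
      have "l \<le> M - (M - (- K)) * c"
        by (rule H[OF _ _ n]) (use bd M in \<open>auto simp: K_def\<close>)
      moreover have "(M + K) * c \<ge> ((M - l) / c + M + 1) * c"
        using c by (intro mult_right_mono) (auto simp: K_def)
      moreover have "((M - l) / c + M + 1) * c = M - l + (M + 1) * c" using c by (simp add: field_simps)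
      moreover have "0 < (M + 1) * c" using M c by simp
      ultimately show False by simp
    qed
    ultimately show "(\<forall>x. f x \<le> exp M) \<and> (\<forall>y\<in>ball z r. exp (- K) \<le> f y)" by blast
  qed
qed

lemma nn_integral_exp_abs_finite:
  fixes a :: real
  assumes "0 < a"
  shows "(\<integral>\<^sup>+x. ennreal (exp (- a * \<bar>x\<bar>)) \<partial>lborel) < \<infinity>"
proof -
  have half: "(\<integral>\<^sup>+x. ennreal (exp (- a * x)) * indicator {0..} x \<partial>lborel) < \<infinity>"
  proof -
    have "(\<integral>\<^sup>+x. ennreal (exp (- a * x)) * indicator {0..} x \<partial>lborel) = ennreal (0 - (- exp (- a * 0) / a))"
    proof (rule nn_integral_FTC_atLeast)
      show "DERIV (\<lambda>x. - exp (- a * x) / a) x :> exp (- a * x)" for x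
        using assms by (auto intro!: derivative_eq_intros)
      have "((\<lambda>x. - exp (- (a * x)) / a) \<longlongrightarrow> - 0 / a) at_top"
        using assms by (intro tendsto_intros filterlim_compose[OF exp_at_bot] filterlim_compose[OF filterlim_uminus_at_bot_at_top]
          filterlim_tendsto_pos_mult_at_top[OF tendsto_const] filterlim_ident) auto
      then show "((\<lambda>x. - exp (- a * x) / a) \<longlongrightarrow> 0) at_top" by simp
    qed auto
    then show ?thesis by simp
  qed
  have refl: "(\<integral>\<^sup>+x. ennreal (exp (a * x)) * indicator {..0} x \<partial>lborel) =
      (\<integral>\<^sup>+x. ennreal (exp (- a * x)) * indicator {0..} x \<partial>lborel)"
    by (subst nn_integral_real_affine[where c = "-1" and t = 0])
       (auto intro!: nn_integral_cong simp: indicator_def)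
  have "(\<integral>\<^sup>+x. ennreal (exp (- a * \<bar>x\<bar>)) \<partial>lborel) \<le>
      (\<integral>\<^sup>+x. ennreal (exp (- a * x)) * indicator {0..} x + ennreal (exp (a * x)) * indicator {..0} x \<partial>lborel)"
    by (intro nn_integral_mono) (auto simp: indicator_def)
  also have "\<dots> = (\<integral>\<^sup>+x. ennreal (exp (- a * x)) * indicator {0..} x \<partial>lborel) +
      (\<integral>\<^sup>+x. ennreal (exp (a * x)) * indicator {..0} x \<partial>lborel)"
    by (rule nn_integral_add) auto
  also have "\<dots> < \<infinity>" using half refl by simp
  finally show ?thesis .
qed

lemma integrable_exp_norm:
  fixes z :: "'a::euclidean_space"
  assumes "0 < a"
  shows "integrable lebesgue (\<lambda>x. exp (- a * norm (x - z)))"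
proof -
  \<comment> \<open>The norm dominates the absolute value of each coordinate, hence their average;
    with \<open>a\<close> shared equally among the coordinates, the bound factorises into
    one-dimensional integrals.\<close>
  define b where "b = a / DIM('a)"
  have b: "0 < b" using assms by (simp add: b_def)
  have le: "exp (- a * norm x) \<le> (\<Prod>i\<in>Basis. exp (- b * \<bar>x \<bullet> i\<bar>))" for x :: 'a
  proof -
    have "(\<Sum>i\<in>Basis. b * \<bar>x \<bullet> i\<bar>) \<le> (\<Sum>i\<in>(Basis::'a set). b * norm x)"
      using b by (intro sum_mono mult_left_mono Basis_le_norm) auto
    also have "\<dots> = a * norm x" by (simp add: b_def)
    finally show ?thesis by (simp add: exp_sum[symmetric] sum_negf)
  qed
  have "(\<integral>\<^sup>+x. ennreal (exp (- a * norm (x::'a))) \<partial>lborel) \<le>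
      (\<integral>\<^sup>+x. (\<Prod>i\<in>Basis. ennreal (exp (- b * \<bar>(x::'a) \<bullet> i\<bar>))) \<partial>lborel)"
    using le by (intro nn_integral_mono) (auto simp add: prod_ennreal simp del: mult_minus_left intro!: ennreal_leI)
  also have "\<dots> = (\<Prod>i\<in>(Basis::'a set). \<integral>\<^sup>+x. ennreal (exp (- b * \<bar>x\<bar>)) \<partial>lborel)"
    by (rule nn_integral_lborel_prod) auto
  also have "\<dots> < \<infinity>"
    using nn_integral_exp_abs_finite[OF b] by (simp add: power_less_top_ennreal)
  finally have fin: "(\<integral>\<^sup>+x. ennreal (exp (- a * norm (x::'a))) \<partial>lborel) < \<infinity>" .
  have "integrable lborel (\<lambda>x::'a. exp (- a * norm x))"
    using fin by (intro integrableI_nonneg) auto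
  then have "integrable lborel (\<lambda>x::'a. exp (a * norm z) * exp (- a * norm x))" by simp
  then have "integrable lborel (\<lambda>x. exp (- a * norm (x - z)))"
  proof (rule Bochner_Integration.integrable_bound)
    have "- (a * norm (x - z)) \<le> a * norm z - a * norm x" for x
      using assms norm_triangle_ineq[of "x - z" z] mult_left_mono[of "norm x" "norm (x - z) + norm z" a]
      by (simp add: algebra_simps)
    then show "AE x in lborel. norm (exp (- a * norm (x - z))) \<le> norm (exp (a * norm z) * exp (- a * norm x))"
      by (simp add: exp_add[symmetric])
  qed simp
  then show ?thesis by (simp add: integrable_completion)
qed

text \<open>Along a ray from \<open>z\<close> the function ln f is concave, at least - K at
  \<open>z\<close> and below - K - c at distance R. From R on it therefore stays below the line
  through these two values, whose slope is - c / R.\<close>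

lemma log_concave_density_radial_decay:
  fixes f :: "'a::euclidean_space \<Rightarrow> real"
  assumes f: "log_concave_density f" and z: "exp (- K) \<le> f z" and R: "0 < R"
    and sphere: "\<And>x. norm (x - z) = R \<Longrightarrow> f x < exp (- K - c)" and x: "R \<le> norm (x - z)"
  shows "f x \<le> exp (- K - c * norm (x - z) / R)"
proof (rule ccontr)
  assume "\<not> f x \<le> exp (- K - c * norm (x - z) / R)"
  then have fx: "exp (- K - c * norm (x - z) / R) \<le> f x" by simp
  define s where "s = R / norm (x - z)"
  have nz: "0 < norm (x - z)" using x R by linarith
  then have s: "0 < s" "s \<le> 1" using x R by (auto simp: s_def field_simps)
  let ?w = "(1 - s) *\<^sub>R z + s *\<^sub>R x"
  have "?w - z = s *\<^sub>R (x - z)" by (simp add: algebra_simps)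
  then have "norm (?w - z) = R" using nz R by (simp add: s_def)
  then have "f ?w < exp (- K - c)" by (rule sphere)
  moreover have "exp ((1 - s) * (- K) + s * (- K - c * norm (x - z) / R)) \<le> f ?w"
    by (rule log_concave_fun_exp[OF log_concave_densityD(2)[OF f] z fx]) (use s in auto)
  moreover have "s * (c * norm (x - z) / R) = c" using nz R by (simp add: s_def)
  then have "(1 - s) * (- K) + s * (- K - c * norm (x - z) / R) = - K - c" by (simp add: algebra_simps)
  ultimately show False by simp
qed

text \<open>A value of exp (- K - 1) or more far from \<open>z\<close> would create more than unit
  mass. Such values therefore stop at a radius R that depends on r and K only, and
  \<open>log_concave_density_radial_decay\<close> with c = 1 gives the rate 1 / R for the whole
  class.\<close>

lemma log_concave_density_class_tail:
  assumes r: "0 < r" and MK: "0 \<le> M" "0 \<le> K"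
  obtains a b where "0 < a" "\<And>f (z::'a::euclidean_space) x. log_concave_density f \<Longrightarrow> (\<And>x. f x \<le> exp M) \<Longrightarrow>
      (\<And>y. y \<in> ball z r \<Longrightarrow> exp (- K) \<le> f y) \<Longrightarrow> f x \<le> exp (- a * norm (x - z) + b)"
proof -
  define v where "v = unit_ball_vol DIM('a) * (r / 2) ^ DIM('a)"
  have v: "v > 0" using r by (simp add: v_def)
  obtain N :: nat where "real N > exp (K + 1) / v" using reals_Archimedean2 by blast
  then have N: "real N * v > exp (K + 1)" using v by (simp add: field_simps)
  then have Npos: "N > 0" by (intro Nat.gr0I) (simp add: not_less[symmetric])
  \<comment> \<open>N centres spaced r apart then occupy at most half of the segment from
    \<open>z\<close> to a point at distance R or more. In that half the cone over
    \<open>ball z r\<close> still has radius at least r / 2, so disjoint balls of that radius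
    fit.\<close>
  define R where "R = 2 * r * N"
  have R: "R > 0" using r Npos by (simp add: R_def)
  have far: "f x < exp (- K - 1)"
    if f: "log_concave_density f" and ball: "\<And>y. y \<in> ball z r \<Longrightarrow> exp (- K) \<le> f y"
      and x: "R \<le> norm (x - z)" for f and z x :: 'a
  proof (rule ccontr)
    assume "\<not> f x < exp (- K - 1)"
    then have fx: "exp (- K - 1) \<le> f x" by simp
    \<comment> \<open>the convex hull of \<open>x\<close> and \<open>ball z r\<close> contains \<open>N\<close> disjoint balls of radius \<open>r / 2\<close>\<close>
    define p where "p = (\<lambda>j::nat. z + (j * r / norm (x - z)) *\<^sub>R (x - z))"
    have nz: "norm (x - z) > 0" using x R by linarith
    have sub: "exp (- K - 1) \<le> f y" if j: "j < N" and y: "y \<in> ball (p j) (r / 2)" for j y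
    proof -
      define t where "t = j * r / norm (x - z)"
      have "j * r \<le> N * r" using j r by simp
      also have "\<dots> = R / 2" by (simp add: R_def)
      also have "\<dots> \<le> norm (x - z) / 2" using x by simp
      finally have t: "0 \<le> t" "t \<le> 1 / 2" using nz r by (auto simp: t_def field_simps)
      have p: "p j = z + t *\<^sub>R (x - z)" by (simp add: p_def t_def)
      define w where "w = z + (1 / (1 - t)) *\<^sub>R (y - p j)"
      have "(1 - t) *\<^sub>R w = (1 - t) *\<^sub>R z + (y - p j)"
        using t by (simp add: w_def scaleR_add_right)
      then have yw: "(1 - t) *\<^sub>R w + t *\<^sub>R x = y"
        by (simp add: p algebra_simps)
      have "norm (w - z) = norm (y - p j) / (1 - t)" using t by (simp add: w_def)
      also have "\<dots> < (r / 2) / (1 - t)"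
        using y t by (intro divide_strict_right_mono) (auto simp: dist_norm norm_minus_commute)
      also have "\<dots> \<le> r" using t r by (simp add: field_simps)
      finally have "w \<in> ball z r" by (simp add: dist_norm norm_minus_commute)
      from log_concave_fun_exp[OF log_concave_densityD(2)[OF f] ball[OF this] fx, of t] t
      have "exp ((1 - t) * (- K) + t * (- K - 1)) \<le> f y" by (simp add: yw)
      moreover have "- K - 1 \<le> (1 - t) * (- K) + t * (- K - 1)" using t by (simp add: algebra_simps)
      ultimately show ?thesis by (meson exp_le_cancel_iff order_trans)
    qed
    have disj: "disjoint_family_on (\<lambda>j. ball (p j) (r / 2)) {..<N}"
    unfolding disjoint_family_on_def
    proof (intro ballI impI)
      fix i j assume "i \<in> {..<N}" "j \<in> {..<N}" "i \<noteq> j"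
      have "p i - p j = ((real i - real j) * r / norm (x - z)) *\<^sub>R (x - z)"
        by (simp add: p_def algebra_simps diff_divide_distrib)
      then have "dist (p i) (p j) = \<bar>real i - real j\<bar> * r"
        using nz r by (simp add: dist_norm abs_mult)
      moreover have "1 \<le> \<bar>real i - real j\<bar>" using \<open>i \<noteq> j\<close> by linarith
      ultimately have "r \<le> dist (p i) (p j)" using r by (simp add: mult_right_mono[of 1, simplified])
      then show "ball (p i) (r / 2) \<inter> ball (p j) (r / 2) = {}" by (intro disjoint_ballI) auto
    qed
    let ?U = "\<Union>j<N. ball (p j) (r / 2)"
    have "emeasure lebesgue ?U = (\<Sum>j<N. emeasure lebesgue (ball (p j) (r / 2)))"
      by (rule sum_emeasure[symmetric]) (use disj in auto)
    also have "\<dots> = (\<Sum>j<N. ennreal v)"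
      using r by (intro sum.cong refl) (simp add: emeasure_ball v_def)
    also have "\<dots> = ennreal (N * v)" using v by (simp add: ennreal_mult ennreal_of_nat_eq_real_of_nat)
    finally have eU: "emeasure lebesgue ?U = ennreal (N * v)" .
    have "ennreal (exp (- K - 1)) * emeasure lebesgue ?U \<le> 1"
      by (rule prob_density_superlevel[OF log_concave_densityD(1)[OF f]]) (use sub in auto)
    then have "exp (- K - 1) * (N * v) \<le> 1"
      unfolding eU using v by (subst (asm) ennreal_mult[symmetric]) (auto simp: ennreal_le_1)
    moreover have "exp (- K - 1) * (N * v) > exp (- K - 1) * exp (K + 1)"
      using N by (intro mult_strict_left_mono) auto
    ultimately show False by (simp add: exp_add[symmetric])
  qed
  show ?thesis
  \<comment> \<open>The 1 in \<open>M + 1\<close> covers the points within distance R of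
    \<open>z\<close>, where only the bound exp M is known but norm (x - z) / R < 1.\<close>
  proof (rule that[of "1 / R" "M + 1"])
    show "0 < 1 / R" using R by simp
    fix f and z x :: 'a
    assume f: "log_concave_density f" and bd: "\<And>x. f x \<le> exp M"
      and ball: "\<And>y. y \<in> ball z r \<Longrightarrow> exp (- K) \<le> f y"
    show "f x \<le> exp (- (1 / R) * norm (x - z) + (M + 1))"
    proof (cases "norm (x - z) < R")
      case True
      then have "norm (x - z) / R < 1" using R by simp
      then have "exp M \<le> exp (- (1 / R) * norm (x - z) + (M + 1))" by simp
      with bd[of x] show ?thesis by linarith
    next
      case False
      have "f x \<le> exp (- K - 1 * norm (x - z) / R)"
        by (rule log_concave_density_radial_decay[OF f ball R far[OF f ball]]) (use False r in auto)
      also have "\<dots> \<le> exp (- (1 / R) * norm (x - z) + (M + 1))"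
        using MK by simp
      finally show ?thesis .
    qed
  qed
qed

lemma log_concave_density_tail:
  fixes f :: "'a::euclidean_space \<Rightarrow> real"
  assumes f: "log_concave_density f"
  obtains a b where "0 < a" "\<And>x. f x \<le> exp (- a * norm x + b)"
proof -
  obtain z r K where K: "0 < r" "0 \<le> K" and ball: "\<And>y. y \<in> ball z r \<Longrightarrow> exp (- K) \<le> f y"
    by (rule log_concave_density_ball[OF f]) blast
  obtain M where M: "0 \<le> M" "\<And>x. f x \<le> exp M" by (rule log_concave_density_bounded[OF f]) blast
  obtain a b where ab: "0 < a" "\<And>f (z::'a) x. log_concave_density f \<Longrightarrow> (\<And>x. f x \<le> exp M) \<Longrightarrow>
      (\<And>y. y \<in> ball z r \<Longrightarrow> exp (- K) \<le> f y) \<Longrightarrow> f x \<le> exp (- a * norm (x - z) + b)"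
    by (rule log_concave_density_class_tail[OF K(1) M(1) K(2)]) blast
  have "f x \<le> exp (- a * norm x + (b + a * norm z))" for x
  proof -
    have "a * norm x \<le> a * (norm (x - z) + norm z)"
      using ab(1) norm_triangle_ineq[of "x - z" z] by (intro mult_left_mono) auto
    then have "exp (- a * norm (x - z) + b) \<le> exp (- a * norm x + (b + a * norm z))"
      by (simp add: algebra_simps)
    with ab(2)[of f z x, OF f M(2) ball] show ?thesis by linarith
  qed
  with ab(1) show ?thesis by (rule that)
qed

section \<open>Integral of the sup-convolution by comparison with a dilation\<close>

lemma nn_integral_lebesgue_dilation:
  fixes f :: "'a::euclidean_space \<Rightarrow> real" and z :: 'a
  assumes f: "f \<in> borel_measurable lebesgue" and s: "0 < s"
  shows "(\<integral>\<^sup>+x. ennreal (f (z + s *\<^sub>R (x - z))) \<partial>lebesgue) = ennreal (1 / s ^ DIM('a)) * (\<integral>\<^sup>+x. ennreal (f x) \<partial>lebesgue)"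
    and "(\<lambda>x. f (z + s *\<^sub>R (x - z))) \<in> borel_measurable lebesgue"
proof -
  define T where "T = (\<lambda>x::'a. (z - s *\<^sub>R z) + (\<Sum>j\<in>Basis. (s * (x \<bullet> j)) *\<^sub>R j))"
  have T: "T x = z + s *\<^sub>R (x - z)" for x
  proof -
    have "(\<Sum>j\<in>Basis. (s * (x \<bullet> j)) *\<^sub>R j) = s *\<^sub>R (\<Sum>j\<in>Basis. (x \<bullet> j) *\<^sub>R j)"
      by (simp add: scaleR_sum_right)
    then show ?thesis by (simp add: T_def euclidean_representation algebra_simps)
  qed
  have mT: "T \<in> lebesgue \<rightarrow>\<^sub>M lebesgue"
    unfolding T_def by (rule lebesgue_affine_measurable) (use s in auto)
  show "(\<lambda>x. f (z + s *\<^sub>R (x - z))) \<in> borel_measurable lebesgue"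
    using measurable_compose[OF mT f] by (simp add: T)
  have "lebesgue = density (distr lebesgue lebesgue T) (\<lambda>_. (\<Prod>j\<in>(Basis::'a set). ennreal \<bar>s\<bar>))"
    using lebesgue_affine_euclidean[of "\<lambda>_. s" "z - s *\<^sub>R z"] s unfolding T_def by (simp add: prod_ennreal ennreal_power)
  also have "(\<Prod>j\<in>(Basis::'a set). ennreal \<bar>s\<bar>) = ennreal (s ^ DIM('a))" using s by (simp add: ennreal_power)
  finally have leb: "lebesgue = density (distr lebesgue lebesgue T) (\<lambda>_. ennreal (s ^ DIM('a)))" .
  have "(\<integral>\<^sup>+x. ennreal (f x) \<partial>lebesgue) = (\<integral>\<^sup>+x. ennreal (s ^ DIM('a)) * ennreal (f x) \<partial>(distr lebesgue lebesgue T))"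
    by (subst leb, subst nn_integral_density) (use f in auto)
  also have "\<dots> = (\<integral>\<^sup>+x. ennreal (s ^ DIM('a)) * ennreal (f (T x)) \<partial>lebesgue)"
    by (rule nn_integral_distr[OF mT]) (use f in auto)
  also have "\<dots> = ennreal (s ^ DIM('a)) * (\<integral>\<^sup>+x. ennreal (f (T x)) \<partial>lebesgue)"
    by (rule nn_integral_cmult) (use measurable_compose[OF mT f] in auto)
  finally have "ennreal (1 / s ^ DIM('a)) * (\<integral>\<^sup>+x. ennreal (f x) \<partial>lebesgue) =
      (ennreal (1 / s ^ DIM('a)) * ennreal (s ^ DIM('a))) * (\<integral>\<^sup>+x. ennreal (f (T x)) \<partial>lebesgue)"
    by (simp add: mult.assoc)
  also have "ennreal (1 / s ^ DIM('a)) * ennreal (s ^ DIM('a)) = 1"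
    using s by (subst ennreal_mult[symmetric]) auto
  finally show "(\<integral>\<^sup>+x. ennreal (f (z + s *\<^sub>R (x - z))) \<partial>lebesgue) = ennreal (1 / s ^ DIM('a)) * (\<integral>\<^sup>+x. ennreal (f x) \<partial>lebesgue)"
    by (simp add: T)
qed

text \<open>The supremum is split at norm (x - y) = \<eta> r. For nearer \<open>y\<close>, the
  contraction of \<open>x\<close> towards \<open>z\<close> lies in the cone ball spanned by
  \<open>y\<close> and \<open>ball z r\<close>, so \<open>f\<close> there is at least
  \<open>f y\<close> up to the factor exp (- \<eta> (M + K)). For farther \<open>y\<close>, a part a
  of the rate L moves the decay of \<open>f\<close> from \<open>y\<close> to \<open>x\<close>, and
  the remaining L - a yields the small factor.\<close>

lemma sup_conv_le_dilation:
  fixes f :: "'a::euclidean_space \<Rightarrow> real"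
  assumes f: "log_concave_density f" and bd: "\<And>x. f x \<le> exp M"
    and ball: "\<And>y. y \<in> ball z r \<Longrightarrow> exp (- K) \<le> f y"
    and tail: "\<And>x. f x \<le> exp (- a * norm (x - z) + b)"
    and eta: "0 < \<eta>" "\<eta> < 1" and r: "0 < r" and L: "0 < a" "a \<le> L"
  shows "sup_conv L f x \<le> exp (\<eta> * (M + K)) * f (z + (1 - \<eta>) *\<^sub>R (x - z)) +
    exp (b - (L - a) * (\<eta> * r)) * exp (- a * norm (x - z))" (is "_ \<le> ?A + ?B")
  unfolding sup_conv_def
proof (rule cSUP_least)
  fix y
  have nn: "0 \<le> f x" for x using prob_densityD(2)[OF log_concave_densityD(1)[OF f]] .
  have AB: "0 \<le> ?A" "0 \<le> ?B" using nn by auto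
  show "f y * exp (- L * norm (x - y)) \<le> ?A + ?B"
  proof (cases "f y = 0")
    case True then show ?thesis using AB by simp
  next
    case False
    then have fy: "0 < f y" using nn[of y] by simp
    define v where "v = ln (f y)"
    have v: "exp v = f y" using fy by (simp add: v_def)
    have vM: "v \<le> M" using bd[of y] v by (metis exp_le_cancel_iff)
    show ?thesis
    proof (cases "norm (x - y) < \<eta> * r")
      case True
      let ?x = "z + (1 - \<eta>) *\<^sub>R (x - z)"
      have "y + \<eta> *\<^sub>R (z - y) - ?x = (1 - \<eta>) *\<^sub>R (y - x)" by (simp add: algebra_simps)
      then have "norm (y + \<eta> *\<^sub>R (z - y) - ?x) = (1 - \<eta>) * norm (x - y)"
        using eta by (simp add: norm_minus_commute)
      also have "\<dots> \<le> 1 * norm (x - y)" using eta by (intro mult_right_mono) auto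
      finally have w: "?x \<in> ball (y + \<eta> *\<^sub>R (z - y)) (\<eta> * r)" using True by (simp add: dist_norm)
      have "exp ((1 - \<eta>) * v - \<eta> * K) \<le> f ?x"
        by (rule log_concave_density_cone_ball[OF f ball _ _ _ w]) (use v eta in auto)
      moreover have "v - \<eta> * (M + K) \<le> (1 - \<eta>) * v - \<eta> * K"
        using mult_left_mono[OF vM, of \<eta>] eta by (simp add: algebra_simps)
      ultimately have "exp (v - \<eta> * (M + K)) \<le> f (z + (1 - \<eta>) *\<^sub>R (x - z))"
        by (meson exp_le_cancel_iff order_trans)
      then have "exp (\<eta> * (M + K)) * exp (v - \<eta> * (M + K)) \<le> ?A" by (intro mult_left_mono) auto
      then have "f y \<le> ?A" by (simp add: exp_add[symmetric] v)
      moreover have "f y * exp (- L * norm (x - y)) \<le> f y * 1"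
        using nn L by (intro mult_left_mono) auto
      ultimately show ?thesis using AB by linarith
    next
      case False
      have "norm (x - z) \<le> norm (x - y) + norm (y - z)"
        using norm_triangle_ineq[of "x - y" "y - z"] by simp
      then have "a * norm (x - z) \<le> a * norm (x - y) + a * norm (y - z)"
        using L by (metis distrib_left less_imp_le mult_left_mono)
      moreover have "(L - a) * (\<eta> * r) \<le> (L - a) * norm (x - y)"
        using False L by (intro mult_left_mono) auto
      ultimately have e: "- a * norm (y - z) + b - L * norm (x - y) \<le> b - (L - a) * (\<eta> * r) - a * norm (x - z)"
        by (simp add: algebra_simps)
      have "f y * exp (- L * norm (x - y)) \<le> exp (- a * norm (y - z) + b) * exp (- L * norm (x - y))"
        using tail by (intro mult_right_mono) auto
      also have "\<dots> = exp (- a * norm (y - z) + b - L * norm (x - y))" by (simp add: exp_add[symmetric])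
      also have "\<dots> \<le> exp (b - (L - a) * (\<eta> * r) - a * norm (x - z))" using e by (subst exp_le_cancel_iff)
      also have "\<dots> = ?B" by (simp add: exp_add[symmetric])
      finally show ?thesis using AB by linarith
    qed
  qed
qed simp

lemma sup_conv_integral_class:
  fixes z :: "'a::euclidean_space"
  assumes r: "0 < r" and MK: "0 \<le> M" "0 \<le> K" and e: "0 < e"
  obtains L where "0 < L"
    "\<And>f. log_concave_density f \<Longrightarrow> (\<And>x. f x \<le> exp M) \<Longrightarrow> (\<And>y. y \<in> ball z r \<Longrightarrow> exp (- K) \<le> f y) \<Longrightarrow>
      (\<integral>\<^sup>+x. ennreal (sup_conv L f x) \<partial>lebesgue) \<le> ennreal (1 + e)"
proof -
  obtain a b where ab: "0 < a" "\<And>f (z::'a::euclidean_space) x. log_concave_density f \<Longrightarrow> (\<And>x. f x \<le> exp M) \<Longrightarrow>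
      (\<And>y. y \<in> ball z r \<Longrightarrow> exp (- K) \<le> f y) \<Longrightarrow> f x \<le> exp (- a * norm (x - z) + b)"
    by (rule log_concave_density_class_tail[OF r MK]) blast
  \<comment> \<open>\<eta> is fixed before L. The dilated term has mass exp (\<eta> (M + K)) / (1 -
    \<eta>)^d, close to 1 for small \<eta>; afterwards L is taken large enough for the error term,
    whose exponent contains (L - a) \<eta> r.\<close>
  have "((\<lambda>\<eta>. exp (\<eta> * (M + K)) * (1 / (1 - \<eta>) ^ DIM('a))) \<longlongrightarrow> exp (0 * (M + K)) * (1 / (1 - 0) ^ DIM('a))) (at_right 0)"
    by (intro tendsto_intros) auto
  then have "\<forall>\<^sub>F \<eta> in at_right 0. exp (\<eta> * (M + K)) * (1 / (1 - \<eta>) ^ DIM('a)) < 1 + e / 2"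
    using e by (intro order_tendstoD(2)) auto
  moreover have "\<forall>\<^sub>F \<eta>::real in at_right 0. 0 < \<eta> \<and> \<eta> < 1"
    by (rule eventually_at_rightI[of 0 1]) auto
  ultimately have "\<forall>\<^sub>F \<eta> in at_right 0. exp (\<eta> * (M + K)) * (1 / (1 - \<eta>) ^ DIM('a)) < 1 + e / 2 \<and> 0 < \<eta> \<and> \<eta> < 1"
    by eventually_elim auto
  then obtain \<eta> where eta: "exp (\<eta> * (M + K)) * (1 / (1 - \<eta>) ^ DIM('a)) < 1 + e / 2" "0 < \<eta>" "\<eta> < 1"
    using eventually_happens trivial_limit_at_right_real by blast
  define I where "I = (LINT x|lebesgue. exp (- a * norm (x - z)))"
  have I: "(\<integral>\<^sup>+x. ennreal (exp (- a * norm (x - z))) \<partial>lebesgue) = ennreal I" "0 \<le> I"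
    unfolding I_def using integrable_exp_norm[OF ab(1), of z] by (auto intro!: nn_integral_eq_integral)
  have "((\<lambda>L. exp (b - (L - a) * (\<eta> * r)) * I) \<longlongrightarrow> 0 * I) at_top"
  proof (intro tendsto_mult tendsto_const filterlim_compose[OF exp_at_bot])
    have "filterlim (\<lambda>L. - (- (b + a * (\<eta> * r)) + (\<eta> * r) * L)) at_bot at_top"
      unfolding filterlim_uminus_at_top[symmetric]
      by (intro filterlim_tendsto_add_at_top[OF tendsto_const]
          filterlim_tendsto_pos_mult_at_top[OF tendsto_const] filterlim_ident) (use eta r in auto)
    then show "filterlim (\<lambda>L. b - (L - a) * (\<eta> * r)) at_bot at_top" by (simp add: algebra_simps)
  qed
  then have "\<forall>\<^sub>F L in at_top. exp (b - (L - a) * (\<eta> * r)) * I < e / 2 \<and> a \<le> L"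
    using e by (intro eventually_conj order_tendstoD(2) eventually_ge_at_top) auto
  then obtain L where L: "exp (b - (L - a) * (\<eta> * r)) * I < e / 2" "a \<le> L"
    using eventually_happens trivial_limit_at_top_linorder by blast
  show ?thesis
  proof (rule that[of L])
    show "0 < L" using L ab by simp
    fix f :: "'a \<Rightarrow> real"
    assume f: "log_concave_density f" and bd: "\<And>x. f x \<le> exp M"
      and ball: "\<And>y. y \<in> ball z r \<Longrightarrow> exp (- K) \<le> f y"
    note f' = prob_densityD[OF log_concave_densityD(1)[OF f]]
    note dil = nn_integral_lebesgue_dilation[OF f'(1), of "1 - \<eta>" z]
    have [measurable]: "(\<lambda>x. f (z + (1 - \<eta>) *\<^sub>R (x - z))) \<in> borel_measurable lebesgue"
      using dil(2) eta by simp
    have [measurable]: "(\<lambda>x. exp (- a * norm (x - z))) \<in> borel_measurable lebesgue"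
      using integrable_exp_norm[OF ab(1), of z] by simp
    have "(\<integral>\<^sup>+x. ennreal (sup_conv L f x) \<partial>lebesgue) \<le>
      (\<integral>\<^sup>+x. ennreal (exp (\<eta> * (M + K))) * ennreal (f (z + (1 - \<eta>) *\<^sub>R (x - z))) +
         ennreal (exp (b - (L - a) * (\<eta> * r))) * ennreal (exp (- a * norm (x - z))) \<partial>lebesgue)"
    proof (rule nn_integral_mono)
      fix x
      have "sup_conv L f x \<le> exp (\<eta> * (M + K)) * f (z + (1 - \<eta>) *\<^sub>R (x - z)) +
          exp (b - (L - a) * (\<eta> * r)) * exp (- a * norm (x - z))"
        by (rule sup_conv_le_dilation[OF f bd ball ab(2)[OF f bd ball] eta(2,3) r ab(1) L(2)])
      then show "ennreal (sup_conv L f x) \<le> ennreal (exp (\<eta> * (M + K))) * ennreal (f (z + (1 - \<eta>) *\<^sub>R (x - z))) +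
         ennreal (exp (b - (L - a) * (\<eta> * r))) * ennreal (exp (- a * norm (x - z)))"
        using f'(2) by (simp add: ennreal_mult[symmetric] ennreal_plus[symmetric] ennreal_leI del: ennreal_plus)
    qed
    also have "\<dots> = ennreal (exp (\<eta> * (M + K))) * (\<integral>\<^sup>+x. ennreal (f (z + (1 - \<eta>) *\<^sub>R (x - z))) \<partial>lebesgue) +
        ennreal (exp (b - (L - a) * (\<eta> * r))) * (\<integral>\<^sup>+x. ennreal (exp (- a * norm (x - z))) \<partial>lebesgue)"
    proof (subst nn_integral_add)
      show "(\<lambda>x. ennreal (exp (\<eta> * (M + K))) * ennreal (f (z + (1 - \<eta>) *\<^sub>R (x - z)))) \<in> borel_measurable lebesgue"
        "(\<lambda>x. ennreal (exp (b - (L - a) * (\<eta> * r))) * ennreal (exp (- a * norm (x - z)))) \<in> borel_measurable lebesgue"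
        by measurable
    qed (subst (1 2) nn_integral_cmult, measurable)
    also have "\<dots> = ennreal (exp (\<eta> * (M + K))) * ennreal (1 / (1 - \<eta>) ^ DIM('a)) +
        ennreal (exp (b - (L - a) * (\<eta> * r))) * ennreal I"
      using dil(1) eta f'(5) I by simp
    also have "\<dots> = ennreal (exp (\<eta> * (M + K)) * (1 / (1 - \<eta>) ^ DIM('a)) + exp (b - (L - a) * (\<eta> * r)) * I)"
      using eta I by (simp add: ennreal_mult[symmetric] ennreal_plus[symmetric] del: ennreal_plus)
    also have "\<dots> \<le> ennreal (1 + e)" using eta L by (intro ennreal_leI) linarith
    finally show "(\<integral>\<^sup>+x. ennreal (sup_conv L f x) \<partial>lebesgue) \<le> ennreal (1 + e)" .
  qed
qed

text \<open>Dividing by the integral I returns to the class of densities and lowers the logarithm by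
  ln I \<le> ln c only. Lipschitz continuity of the logarithm supplies the measurability.\<close>

lemma sup_conv_density:
  fixes f :: "'a::euclidean_space \<Rightarrow> real"
  assumes f: "log_concave_density f" and bd: "\<And>x. f x \<le> B" and L: "0 < L"
    and fin: "(\<integral>\<^sup>+x. ennreal (sup_conv L f x) \<partial>lebesgue) \<le> ennreal c"
  obtains I where "0 < I" "I \<le> c" "log_concave_density (\<lambda>x. sup_conv L f x / I)"
    "\<And>x. 0 < sup_conv L f x" "\<And>x y. \<bar>ln (sup_conv L f x) - ln (sup_conv L f y)\<bar> \<le> L * norm (x - y)"
proof -
  note f' = prob_densityD[OF log_concave_densityD(1)[OF f]]
  have L0: "0 \<le> L" using L by simp
  obtain w where w: "0 < f w"
  proof -
    obtain z r K where "0 < r" "\<And>y. y \<in> ball z r \<Longrightarrow> exp (- K) \<le> f y"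
      by (rule log_concave_density_ball[OF f]) blast
    then have "exp (- K) \<le> f z" by simp
    then show ?thesis by (meson exp_gt_zero less_le_trans that)
  qed
  have pos: "0 < sup_conv L f x" for x by (rule sup_conv_pos[where f = f and B = B and L = L, OF f'(2) bd L0 w])
  have lip: "\<bar>ln (sup_conv L f x) - ln (sup_conv L f y)\<bar> \<le> L * norm (x - y)" for x y
    by (rule lipschitz_ln_sup_conv[where f = f and B = B and L = L, OF f'(2) bd L0 w])
  have "L-lipschitz_on UNIV (\<lambda>x. ln (sup_conv L f x))"
    by (rule lipschitz_onI) (use lip L in \<open>auto simp: dist_norm\<close>)
  then have "continuous_on UNIV (\<lambda>x. exp (ln (sup_conv L f x)))"
    by (intro continuous_intros lipschitz_on_continuous_on)
  then have cont: "continuous_on UNIV (sup_conv L f)" using pos by simp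
  have "sup_conv L f \<in> borel_measurable borel" by (rule borel_measurable_continuous_onI[OF cont])
  then have meas: "sup_conv L f \<in> borel_measurable lebesgue" by (simp add: measurable_completion)
  have int: "integrable lebesgue (sup_conv L f)"
    by (rule integrableI_nonneg) (use meas pos le_less_trans[OF fin ennreal_less_top] in \<open>auto intro: less_imp_le\<close>)
  define I where "I = integral\<^sup>L lebesgue (sup_conv L f)"
  have nI: "(\<integral>\<^sup>+x. ennreal (sup_conv L f x) \<partial>lebesgue) = ennreal I"
    unfolding I_def by (rule nn_integral_eq_integral[OF int]) (use pos in \<open>auto intro: less_imp_le\<close>)
  have "1 \<le> I"
    unfolding I_def f'(4)[symmetric]
    by (rule integral_mono[OF f'(3) int]) (rule sup_conv_ge[where f = f and B = B and L = L, OF f'(2) bd L0])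
  then have I: "0 < I" by simp
  have c: "I \<le> c" using fin I unfolding nI by (subst (asm) ennreal_le_iff2) auto
  have "log_concave_density (\<lambda>x. sup_conv L f x / I)"
    unfolding I_def
    by (rule log_concave_density_normalise[OF log_concave_fun_sup_conv[where f = f and B = B and L = L, OF f'(2) bd L0 log_concave_densityD(2)[OF f]]])
      (use pos int I in \<open>auto simp: I_def intro: less_imp_le\<close>)
  from that[OF I c this pos lip] show ?thesis .
qed

section \<open>From convergence in mean to weighted convergence\<close>

lemma tendsto_ennreal_0I:
  fixes W :: "'b \<Rightarrow> ennreal"
  assumes "\<And>e. 0 < e \<Longrightarrow> \<forall>\<^sub>F n in F. W n \<le> ennreal e"
  shows "(W \<longlongrightarrow> 0) F"
proof (rule order_tendstoI)
  fix y :: ennreal assume y: "0 < y"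
  obtain e' where e': "0 < e'" "e' < y" using dense[OF y] by blast
  define e where "e = enn2real e'"
  have "ennreal e = e'" using e' by (cases e') (auto simp: e_def)
  then have e: "0 < e" "ennreal e < y" using e' by (auto simp flip: ennreal_less_zero_iff)
  show "\<forall>\<^sub>F n in F. W n < y"
    using assms[OF e(1)] by eventually_elim (use e in auto)
qed simp

lemma exp_uminus_mult_small:
  fixes c :: real
  assumes "0 < \<gamma>" "0 < e"
  obtains R where "0 < R" "exp (- \<gamma> * R + b) * c \<le> e"
proof -
  have "((\<lambda>R. exp b * c * exp (- (\<gamma> * R))) \<longlongrightarrow> exp b * c * 0) at_top"
    by (intro tendsto_intros filterlim_compose[OF exp_at_bot] filterlim_compose[OF filterlim_uminus_at_bot_at_top]
          filterlim_tendsto_pos_mult_at_top[OF tendsto_const assms(1)] filterlim_ident)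
  then have "\<forall>\<^sub>F R in at_top. exp b * c * exp (- (\<gamma> * R)) < e \<and> 0 < R"
    using assms by (intro eventually_conj order_tendstoD(2) eventually_gt_at_top) auto
  then obtain R where "exp b * c * exp (- (\<gamma> * R)) < e" "0 < R"
    using eventually_happens trivial_limit_at_top_linorder by blast
  moreover have "exp (- \<gamma> * R + b) * c = exp b * c * exp (- (\<gamma> * R))" unfolding exp_add by simp
  ultimately show ?thesis by (intro that[of R]) linarith+
qed

text \<open>Moving from \<open>p\<close> by s along the normal of a hyperplane that separates
  \<open>p\<close> from \<open>C\<close> leaves a ball of radius s beyond the hyperplane. Convexity
  thus turns one missed point into a missed ball.\<close>

lemma convex_disjoint_ball:
  fixes p :: "'a::euclidean_space"
  assumes C: "convex C" "p \<notin> C" and s: "0 \<le> s"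
  obtains y where "dist p y = s" "ball y s \<inter> C = {}"
proof -
  obtain a b where ab: "a \<noteq> 0" "\<forall>x\<in>C. a \<bullet> x \<le> b" "b \<le> a \<bullet> p"
  proof (cases "C = {}")
    case True
    obtain a :: 'a where "a \<in> Basis" using nonempty_Basis by blast
    then show ?thesis using True by (intro that[of a "a \<bullet> p"]) auto
  next
    case False
    then show ?thesis using separating_hyperplane_sets[of C "{p}"] C that by auto
  qed
  define y where "y = p + (s / norm a) *\<^sub>R a"
  have na: "0 < norm a" using ab by simp
  have "norm (y - p) = s" using na s by (simp add: y_def)
  then have "dist p y = s" by (simp add: dist_norm norm_minus_commute)
  moreover have "ball y s \<inter> C = {}"
  proof (rule ccontr)
    assume "ball y s \<inter> C \<noteq> {}"
    then obtain x where x: "dist y x < s" "x \<in> C" by auto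
    have "a \<bullet> (y - x) \<le> norm a * norm (y - x)" by (rule norm_cauchy_schwarz)
    also have "\<dots> < norm a * s" using x na by (intro mult_strict_left_mono) (auto simp: dist_norm)
    finally have "a \<bullet> y - norm a * s < a \<bullet> x" by (simp add: inner_diff_right)
    moreover have "a \<bullet> y = a \<bullet> p + norm a * s"
      using na by (simp add: y_def inner_add_right power2_norm_eq_inner[symmetric] power2_eq_square)
    ultimately show False using ab x by force
  qed
  ultimately show ?thesis by (rule that)
qed

text \<open>This is the situation for one fixed outcome of the sample. The class bounds are asked
  for large n because the estimators satisfy them only from some sample size on.\<close>

locale log_concave_L1_limit =
  fixes f :: "nat \<Rightarrow> 'a::euclidean_space \<Rightarrow> real" and g :: "'a \<Rightarrow> real" and z r M K
  assumes cls: "\<forall>\<^sub>F n in sequentially. log_concave_density (f n) \<and> (\<forall>y. f n y \<le> exp M) \<and> (\<forall>y\<in>ball z r. exp (- K) \<le> f n y)"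
    and g: "prob_density g" and r: "0 < r" and MK: "0 \<le> M" "0 \<le> K"
    and L1: "(\<lambda>n. LINT y|lebesgue. \<bar>f n y - g y\<bar>) \<longlonglongrightarrow> 0"
begin

text \<open>The volume of a ball does not depend on its centre, so one bound on the L1 distance
  serves all centres \<open>w\<close> at once.\<close>

lemma eventually_close_in_balls:
  assumes "0 < \<delta>" "0 < s"
  shows "\<forall>\<^sub>F n in sequentially. \<forall>w. \<exists>y\<in>ball w s. \<bar>f n y - g y\<bar> < \<delta>"
proof -
  let ?c = "\<delta> * (unit_ball_vol DIM('a) * s ^ DIM('a))"
  have "0 < ?c" using assms by simp
  then have "\<forall>\<^sub>F n in sequentially. (LINT y|lebesgue. \<bar>f n y - g y\<bar>) < ?c"
    by (rule order_tendstoD(2)[OF L1])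
  with cls show ?thesis
  proof eventually_elim
    case (elim n)
    show ?case
    proof (rule ccontr)
      assume "\<not> (\<forall>w. \<exists>y\<in>ball w s. \<bar>f n y - g y\<bar> < \<delta>)"
      then obtain w where "\<forall>y\<in>ball w s. \<delta> \<le> \<bar>f n y - g y\<bar>" by (auto simp: not_less)
      then have w: "\<And>y. y \<in> ball w s \<Longrightarrow> \<delta> \<le> \<bar>f n y - g y\<bar>" by blast
      have "?c \<le> (LINT y|lebesgue. \<bar>f n y - g y\<bar>)"
        by (rule L1_dist_ge_ball[OF _ prob_densityD(3)[OF g] _ w])
          (use elim assms prob_densityD(3)[OF log_concave_densityD(1)] in auto)
      with elim show False by simp
    qed
  qed
qed

text \<open>If f n is large at a point \<open>x\<close> at distance R from \<open>z\<close>, then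
  around the midpoint of \<open>x\<close> and \<open>z\<close> it is at least about the square root
  of that value. There \<open>g\<close> obeys a bound with the matching exponent - a0 R / 2, because
  the distance is halved as well. So the rate a0 survives and only constants are lost; a large R
  absorbs them at the price of a1 < a0.\<close>

lemma uniform_tail:
  assumes gb: "\<And>x. g x \<le> exp (- a0 * norm x + b0)" and a: "0 < a1" "a1 < a0"
  obtains b where "\<forall>\<^sub>F n in sequentially. \<forall>x. f n x \<le> exp (- a1 * norm x + b)"
proof -
  \<comment> \<open>\<beta> accounts for norm y \<ge> R / 2 - r / 2 - norm z on the midpoint ball,
    so that g \<le> \<delta> there. C makes the cone bound for f n equal to 2 \<delta>, incompatible
    with a distance below \<delta>. R makes - a0 R + C \<le> - K - a1 R, the input of the radial
    decay.\<close>
  define \<beta> where "\<beta> = a0 * (norm z + r / 2) + b0"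
  define C where "C = K + 2 * (ln 2 + \<beta>)"
  define R where "R = max 1 ((C + K) / (a0 - a1))"
  have R: "0 < R" "(C + K) / (a0 - a1) \<le> R" by (auto simp: R_def)
  then have CR: "- a0 * R + C + K \<le> - a1 * R" using a by (simp add: field_simps)
  define \<delta> where "\<delta> = exp (- a0 * R / 2 + \<beta>)"
  define b where "b = M + a1 * R + a1 * norm z"
  have "\<forall>\<^sub>F n in sequentially. \<forall>w. \<exists>y\<in>ball w (r / 2). \<bar>f n y - g y\<bar> < \<delta>"
    by (rule eventually_close_in_balls) (use r in \<open>auto simp: \<delta>_def\<close>)
  with cls have "\<forall>\<^sub>F n in sequentially. \<forall>x. f n x \<le> exp (- a1 * norm x + b)"
  proof eventually_elim
    case (elim n)
    then have f: "log_concave_density (f n)" and bd: "\<And>y. f n y \<le> exp M" and ball: "\<And>y. y \<in> ball z r \<Longrightarrow> exp (- K) \<le> f n y"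
      by auto
    have sphere: "f n x < exp (- a0 * R + C)" if x: "norm (x - z) = R" for x
    proof (rule ccontr)
      assume "\<not> f n x < exp (- a0 * R + C)"
      then have v: "exp (- a0 * R + C) \<le> f n x" by simp
      let ?w = "x + (1 / 2) *\<^sub>R (z - x)"
      obtain y where y: "y \<in> ball ?w (r / 2)" "\<bar>f n y - g y\<bar> < \<delta>" using elim by blast
      have "exp ((1 - 1 / 2) * (- a0 * R + C) - (1 / 2) * K) \<le> f n y"
        by (rule log_concave_density_cone_ball[OF f ball v]) (use y in auto)
      also have "(1 - 1 / 2) * (- a0 * R + C) - (1 / 2) * K = ln 2 + (- a0 * R / 2 + \<beta>)"
        by (simp add: C_def field_simps)
      finally have fy: "2 * \<delta> \<le> f n y" by (simp add: \<delta>_def exp_add)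
      have "y - z = (1 / 2) *\<^sub>R (x - z) - (?w - y)" by (simp add: algebra_simps scaleR_left_distrib[symmetric])
      then have "norm (y - z) \<ge> norm ((1 / 2) *\<^sub>R (x - z)) - norm (?w - y)" by (simp only: norm_triangle_ineq2)
      moreover have "norm (?w - y) < r / 2" using y(1) by (simp add: dist_norm)
      ultimately have "norm (y - z) \<ge> R / 2 - r / 2" using x by simp
      then have "norm y \<ge> R / 2 - r / 2 - norm z" using norm_triangle_ineq4[of y z] by linarith
      then have "a0 * norm y \<ge> a0 * (R / 2 - r / 2 - norm z)" using a by (intro mult_left_mono) auto
      then have "exp (- a0 * norm y + b0) \<le> \<delta>" by (simp add: \<delta>_def \<beta>_def algebra_simps)
      with gb[of y] fy y(2) show False by linarith
    qed
    show ?case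
    proof
      fix x
      have t: "a1 * norm x \<le> a1 * norm (x - z) + a1 * norm z"
        using a(1) norm_triangle_ineq[of "x - z" z] by (metis diff_add_cancel distrib_left less_imp_le mult_left_mono)
      show "f n x \<le> exp (- a1 * norm x + b)"
      proof (cases "norm (x - z) < R")
        case True
        then have "a1 * norm (x - z) \<le> a1 * R" using a by simp
        then have "exp M \<le> exp (- a1 * norm x + b)" using t by (simp add: b_def)
        with bd[of x] show ?thesis by linarith
      next
        case False
        have "f n x \<le> exp (- K - (a1 * R) * norm (x - z) / R)"
          by (rule log_concave_density_radial_decay[OF f ball R(1)])
            (use False r order.strict_trans2[OF sphere] CR in auto)
        also have "\<dots> = exp (- K - a1 * norm (x - z))" using R by simp
        also have "\<dots> \<le> exp (- a1 * norm x + b)"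
        proof -
          have "0 \<le> a1 * R" using a R by simp
          then show ?thesis unfolding b_def exp_le_cancel_iff using t MK by linarith
        qed
        finally show ?thesis .
      qed
    qed
  qed
  then show ?thesis by (rule that)
qed

lemma tail_both:
  assumes gb: "\<And>x. g x \<le> exp (- a0 * norm x + b0)" and a: "0 < a0" "a < a0"
  obtains \<gamma> b where "0 < \<gamma>" "\<forall>\<^sub>F n in sequentially. \<forall>x. exp (a * norm x) * \<bar>f n x - g x\<bar> \<le> exp (- 2 * \<gamma> * norm x + b)"
proof -
  \<comment> \<open>\<open>a\<close> may be negative, whereas \<open>uniform_tail\<close> asks for a
    positive rate.\<close>
  obtain a1 where a1: "max a 0 < a1" "a1 < a0" using dense[of "max a 0" a0] a by auto
  have a1': "0 < a1" using a1 by simp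
  obtain b where b: "\<forall>\<^sub>F n in sequentially. \<forall>x. f n x \<le> exp (- a1 * norm x + b)"
    by (rule uniform_tail[OF gb a1' a1(2)])
  show ?thesis
  \<comment> \<open>The surplus a1 - a is halved: in the weighted integral one half makes the region
    outside a large ball negligible and the other remains as an integrable weight.\<close>
  proof (rule that[of "(a1 - a) / 2" "max b b0"])
    show "0 < (a1 - a) / 2" using a1 by simp
    show "\<forall>\<^sub>F n in sequentially. \<forall>x. exp (a * norm x) * \<bar>f n x - g x\<bar> \<le> exp (- 2 * ((a1 - a) / 2) * norm x + max b b0)"
      using b cls
    proof eventually_elim
      case (elim n)
      show ?case
      proof
        fix x :: 'a
        have "a1 * norm x \<le> a0 * norm x" using a1 by (intro mult_right_mono) auto
        then have "exp (- a0 * norm x + b0) \<le> exp (- a1 * norm x + max b b0)" by simp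
        then have g1: "g x \<le> exp (- a1 * norm x + max b b0)" using gb[of x] by linarith
        have "exp (- a1 * norm x + b) \<le> exp (- a1 * norm x + max b b0)" by simp
        then have f1: "f n x \<le> exp (- a1 * norm x + max b b0)" using elim(1) order_trans by blast
        have "0 \<le> f n x" "0 \<le> g x"
          using elim prob_densityD(2)[OF g] prob_densityD(2)[OF log_concave_densityD(1)[of "f n"]] by auto
        then have "\<bar>f n x - g x\<bar> \<le> exp (- a1 * norm x + max b b0)" using f1 g1 by linarith
        then have "exp (a * norm x) * \<bar>f n x - g x\<bar> \<le> exp (a * norm x) * exp (- a1 * norm x + max b b0)"
          by (intro mult_left_mono) auto
        also have "\<dots> = exp (- 2 * ((a1 - a) / 2) * norm x + max b b0)"
        proof -
          have "- 2 * ((a1 - a) / 2) = a - a1" by simp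
          then show ?thesis unfolding exp_add[symmetric] by (simp only:) (simp add: algebra_simps)
        qed
        finally show "exp (a * norm x) * \<bar>f n x - g x\<bar> \<le> exp (- 2 * ((a1 - a) / 2) * norm x + max b b0)" .
      qed
    qed
  qed
qed

lemma weighted_L1:
  assumes gb: "\<And>x. g x \<le> exp (- a0 * norm x + b0)" and a: "0 < a0" "a < a0"
  shows "(\<lambda>n. \<integral>\<^sup>+x. ennreal (exp (a * norm x) * \<bar>f n x - g x\<bar>) \<partial>lebesgue) \<longlonglongrightarrow> 0"
proof (rule tendsto_ennreal_0I)
  fix e :: real assume e: "0 < e"
  obtain \<gamma> b where \<gamma>: "0 < \<gamma>" and tail: "\<forall>\<^sub>F n in sequentially. \<forall>x. exp (a * norm x) * \<bar>f n x - g x\<bar> \<le> exp (- 2 * \<gamma> * norm x + b)"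
    by (rule tail_both[OF gb a])
  define I where "I = (LINT x|lebesgue. exp (- \<gamma> * norm (x - (0::'a))))"
  obtain R where R: "0 < R" "exp (- \<gamma> * R + b) * I \<le> e / 2"
    by (rule exp_uminus_mult_small[OF \<gamma>, of "e / 2"]) (use e in auto)
  have "(\<lambda>n. exp (\<bar>a\<bar> * R) * (LINT y|lebesgue. \<bar>f n y - g y\<bar>)) \<longlonglongrightarrow> exp (\<bar>a\<bar> * R) * 0"
    by (intro tendsto_intros L1)
  then have "\<forall>\<^sub>F n in sequentially. exp (\<bar>a\<bar> * R) * (LINT y|lebesgue. \<bar>f n y - g y\<bar>) < e / 2"
    by (rule order_tendstoD(2)) (use e in simp)
  with tail cls show "\<forall>\<^sub>F n in sequentially. (\<integral>\<^sup>+x. ennreal (exp (a * norm x) * \<bar>f n x - g x\<bar>) \<partial>lebesgue) \<le> ennreal e"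
  proof eventually_elim
    case (elim n)
    have fi: "integrable lebesgue (f n)" using elim prob_densityD(3)[OF log_concave_densityD(1)[of "f n"]] by blast
    \<comment> \<open>The first summand is the bound for norm x \<le> R, the second the one outside,
      where exp (- 2 \<gamma> norm x) \<le> exp (- \<gamma> R) exp (- \<gamma> norm x).\<close>
    let ?B = "\<lambda>x. exp (\<bar>a\<bar> * R) * \<bar>f n x - g x\<bar> + exp (- \<gamma> * R + b) * exp (- \<gamma> * norm (x - 0))"
    have Bi: "integrable lebesgue ?B"
      using fi prob_densityD(3)[OF g] integrable_exp_norm[OF \<gamma>, of "0::'a"] by auto
    have "exp (a * norm x) * \<bar>f n x - g x\<bar> \<le> ?B x" for x
    proof (cases "norm x \<le> R")
      case True
      have "a * norm x \<le> \<bar>a\<bar> * norm x" by (intro mult_right_mono) auto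
      also have "\<dots> \<le> \<bar>a\<bar> * R" using True by (intro mult_left_mono) auto
      finally have "exp (a * norm x) * \<bar>f n x - g x\<bar> \<le> exp (\<bar>a\<bar> * R) * \<bar>f n x - g x\<bar>"
        by (intro mult_right_mono) auto
      moreover have "0 \<le> exp (- \<gamma> * R + b) * exp (- \<gamma> * norm (x - 0))" by simp
      ultimately show ?thesis by linarith
    next
      case False
      then have "\<gamma> * R \<le> \<gamma> * norm x" using \<gamma> by simp
      then have "exp (- 2 * \<gamma> * norm x + b) \<le> exp (- \<gamma> * R + b + (- \<gamma> * norm (x - 0)))" by simp
      also have "\<dots> = exp (- \<gamma> * R + b) * exp (- \<gamma> * norm (x - 0))" by (rule exp_add)
      finally have "exp (a * norm x) * \<bar>f n x - g x\<bar> \<le> exp (- \<gamma> * R + b) * exp (- \<gamma> * norm (x - 0))"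
        using elim(1) order_trans by blast
      moreover have "0 \<le> exp (\<bar>a\<bar> * R) * \<bar>f n x - g x\<bar>" by simp
      ultimately show ?thesis by linarith
    qed
    then have "(\<integral>\<^sup>+x. ennreal (exp (a * norm x) * \<bar>f n x - g x\<bar>) \<partial>lebesgue) \<le> (\<integral>\<^sup>+x. ennreal (?B x) \<partial>lebesgue)"
      by (intro nn_integral_mono ennreal_leI)
    also have "\<dots> = ennreal (integral\<^sup>L lebesgue ?B)"
      by (rule nn_integral_eq_integral[OF Bi]) simp
    also have "integral\<^sup>L lebesgue ?B = exp (\<bar>a\<bar> * R) * (LINT y|lebesgue. \<bar>f n y - g y\<bar>) + exp (- \<gamma> * R + b) * I"
      unfolding I_def using fi prob_densityD(3)[OF g] integrable_exp_norm[OF \<gamma>, of "0::'a"]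
      by (subst Bochner_Integration.integral_add) auto
    also have "ennreal \<dots> \<le> ennreal e" using R elim by (intro ennreal_leI) linarith
    finally show ?case .
  qed
qed

text \<open>Upper bound: if f n x > g x + e, a cone ball near \<open>x\<close> on which f n stays
  above g x + 2 e / 3 contains a point where f n and \<open>g\<close> differ by less than e / 3,
  against the uniform continuity of \<open>g\<close>. Lower bound: if f n x < g x - e, the convex
  set where f n \<ge> g x - e omits \<open>x\<close> and hence a whole ball touching
  \<open>x\<close>, in which the same comparison is made.\<close>

lemma local_uniform:
  assumes cont: "continuous_on UNIV g" and e: "0 < e"
  shows "\<forall>\<^sub>F n in sequentially. \<forall>x\<in>cball 0 R. \<bar>f n x - g x\<bar> \<le> e"
proof -
  have "uniformly_continuous_on (cball 0 (R + 1)) g"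
    by (rule compact_uniformly_continuous[OF continuous_on_subset[OF cont]]) auto
  then obtain \<tau>0 where \<tau>0: "0 < \<tau>0" "\<And>x y. x \<in> cball 0 (R + 1) \<Longrightarrow> y \<in> cball 0 (R + 1) \<Longrightarrow> dist y x < \<tau>0 \<Longrightarrow> dist (g y) (g x) < e / 3"
    unfolding uniformly_continuous_on_def using e by (metis zero_less_divide_iff zero_less_numeral)
  define \<tau> where "\<tau> = min \<tau>0 1"
  have \<tau>: "0 < \<tau>" using \<tau>0 by (simp add: \<tau>_def)
  have uc: "\<bar>g y - g x\<bar> < e / 3" if "x \<in> cball 0 R" "norm (y - x) < \<tau>" for x y
  proof -
    have "norm y \<le> norm x + norm (y - x)" using norm_triangle_ineq[of x "y - x"] by simp
    then show ?thesis using that \<tau>0(2)[of x y] by (auto simp: \<tau>_def dist_norm)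
  qed
  \<comment> \<open>The three bounds give \<eta> \<le> 1, place the cone ball within \<tau> of every
    \<open>x\<close> in the ball of radius R, and limit the loss exp M \<eta> (M + K) in f n to e /
    3.\<close>
  define \<eta> where "\<eta> = min (1 / 2) (min (\<tau> / (2 * (\<bar>R\<bar> + norm z + r))) (e / (3 * exp M * (M + K + 1))))"
  have "0 < \<bar>R\<bar> + norm z + r" using r by (smt (verit) norm_ge_zero)
  then have \<eta>: "0 < \<eta>" "\<eta> \<le> 1" "\<eta> * (\<bar>R\<bar> + norm z + r) < \<tau>"
  proof -
    assume p: "0 < \<bar>R\<bar> + norm z + r"
    have "0 < \<tau> / (2 * (\<bar>R\<bar> + norm z + r))" "0 < e / (3 * exp M * (M + K + 1))" "0 < (1 / 2 :: real)"
      using p \<tau> e MK by (intro divide_pos_pos mult_pos_pos; simp)+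
    then show "0 < \<eta>" unfolding \<eta>_def min_less_iff_conj by blast
    show "\<eta> \<le> 1" by (simp add: \<eta>_def min_le_iff_disj)
    have "\<eta> * (\<bar>R\<bar> + norm z + r) \<le> (\<tau> / (2 * (\<bar>R\<bar> + norm z + r))) * (\<bar>R\<bar> + norm z + r)"
      using p by (intro mult_right_mono) (auto simp: \<eta>_def)
    also have "\<dots> = \<tau> / 2"
    proof -
      have "\<tau> / (2 * c) * c = \<tau> / 2" if "0 < c" for c using that by simp
      then show ?thesis using p by blast
    qed
    also have "\<dots> < \<tau>" using \<tau> by simp
    finally show "\<eta> * (\<bar>R\<bar> + norm z + r) < \<tau>" .
  qed
  have \<eta>2: "exp M * (\<eta> * (M + K)) \<le> e / 3"
  proof -
    have h: "\<eta> \<le> e / (3 * exp M * (M + K + 1))"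
      unfolding \<eta>_def by (meson min.cobounded2 order_trans)
    have "exp M * (\<eta> * (M + K)) \<le> exp M * (e / (3 * exp M * (M + K + 1)) * (M + K + 1))"
      using MK e h by (intro mult_left_mono mult_mono) auto
    also have "\<dots> = e / 3"
    proof -
      have "exp M * (e / (3 * exp M * c) * c) = e / 3" if "0 < c" for c using that by simp
      then show ?thesis using MK by simp
    qed
    finally show ?thesis .
  qed
  have "\<forall>\<^sub>F n in sequentially. \<forall>w. \<exists>y\<in>ball w (\<eta> * r). \<bar>f n y - g y\<bar> < e / 3"
    by (rule eventually_close_in_balls) (use \<eta> r e in auto)
  moreover have "\<forall>\<^sub>F n in sequentially. \<forall>w. \<exists>y\<in>ball w (\<tau> / 2). \<bar>f n y - g y\<bar> < e / 3"
    by (rule eventually_close_in_balls) (use \<tau> e in auto)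
  ultimately show ?thesis using cls
  proof eventually_elim
    case (elim n)
    then have f: "log_concave_density (f n)" and bd: "\<And>y. f n y \<le> exp M" and ball: "\<And>y. y \<in> ball z r \<Longrightarrow> exp (- K) \<le> f n y"
      by auto
    note nn = prob_densityD(2)[OF log_concave_densityD(1)[OF f]]
    have g0: "0 \<le> g y" for y by (rule prob_densityD(2)[OF g])
    show ?case
    proof
      fix x :: 'a assume x: "x \<in> cball 0 R"
      have upper: "f n x \<le> g x + e"
      proof (rule ccontr)
        assume "\<not> f n x \<le> g x + e"
        then have big: "g x + e < f n x" by simp
        then have pos: "0 < f n x" using g0[of x] e by linarith
        define v where "v = ln (f n x)"
        have v: "exp v = f n x" using pos by (simp add: v_def)
        have vM: "v \<le> M" using bd[of x] v by (metis exp_le_cancel_iff)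
        obtain y where y: "y \<in> ball (x + \<eta> *\<^sub>R (z - x)) (\<eta> * r)" "\<bar>f n y - g y\<bar> < e / 3" using elim by blast
        have "exp ((1 - \<eta>) * v - \<eta> * K) \<le> f n y"
          by (rule log_concave_density_cone_ball[OF f ball _ \<eta>(1,2) y(1)]) (simp_all add: v)
        moreover have "v - \<eta> * (M + K) \<le> (1 - \<eta>) * v - \<eta> * K"
          using mult_left_mono[OF vM, of \<eta>] \<eta> by (simp add: algebra_simps)
        ultimately have "exp (v - \<eta> * (M + K)) \<le> f n y" by (meson exp_le_cancel_iff order_trans)
        moreover have "exp v * (1 - \<eta> * (M + K)) \<le> exp v * exp (- (\<eta> * (M + K)))"
          using exp_ge_add_one_self[of "- (\<eta> * (M + K))"] by (intro mult_left_mono) auto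
        moreover have "exp v * exp (- (\<eta> * (M + K))) = exp (v - \<eta> * (M + K))" by (simp add: exp_add[symmetric])
        moreover have "exp v * (\<eta> * (M + K)) \<le> exp M * (\<eta> * (M + K))"
          using vM \<eta> MK by (intro mult_right_mono) auto
        ultimately have fy: "f n x - e / 3 \<le> f n y" using \<eta>2 v by (simp add: algebra_simps)
        have "norm (y - x) \<le> norm (y - (x + \<eta> *\<^sub>R (z - x))) + norm (\<eta> *\<^sub>R (z - x))"
          using norm_triangle_ineq[of "y - (x + \<eta> *\<^sub>R (z - x))" "\<eta> *\<^sub>R (z - x)"] by simp
        also have "\<dots> < \<eta> * r + \<eta> * (norm z + norm x)"
        proof (rule add_less_le_mono)
          show "norm (y - (x + \<eta> *\<^sub>R (z - x))) < \<eta> * r" using y(1) by (simp add: dist_norm norm_minus_commute)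
          show "norm (\<eta> *\<^sub>R (z - x)) \<le> \<eta> * (norm z + norm x)"
            using \<eta> norm_triangle_ineq4[of z x] by (simp add: mult_left_mono)
        qed
        also have "\<dots> \<le> \<eta> * (\<bar>R\<bar> + norm z + r)" using x \<eta> by (simp add: algebra_simps)
        finally have "\<bar>g y - g x\<bar> < e / 3" using \<eta>(3) by (intro uc[OF x]) linarith
        with fy big y(2) show False by linarith
      qed
      have lower: "g x - e \<le> f n x"
      proof (rule ccontr)
        assume "\<not> g x - e \<le> f n x"
        then have small: "f n x < g x - e" by simp
        then have c: "0 < g x - e" using nn[of x] by linarith
        have cv: "convex {y. g x - e \<le> f n y}" by (rule convex_superlevel[OF log_concave_densityD(2)[OF f] c])
        obtain w where w: "dist x w = \<tau> / 2" "ball w (\<tau> / 2) \<inter> {y. g x - e \<le> f n y} = {}"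
          by (rule convex_disjoint_ball[OF cv, of x "\<tau> / 2"]) (use small \<tau> in auto)
        obtain y where y: "y \<in> ball w (\<tau> / 2)" "\<bar>f n y - g y\<bar> < e / 3" using elim by blast
        have "f n y < g x - e" using w(2) y(1) by force
        moreover have "dist x y < \<tau>" using dist_triangle[of x y w] w(1) y(1) by simp
        then have "\<bar>g y - g x\<bar> < e / 3" by (intro uc[OF x]) (simp add: dist_norm norm_minus_commute)
        ultimately show False using y(2) e by linarith
      qed
      from upper lower show "\<bar>f n x - g x\<bar> \<le> e" by linarith
    qed
  qed
qed

lemma weighted_sup:
  assumes gb: "\<And>x. g x \<le> exp (- a0 * norm x + b0)" and a: "0 < a0" "a < a0" and cont: "continuous_on UNIV g"
  shows "(\<lambda>n. SUP x. ennreal (exp (a * norm x) * \<bar>f n x - g x\<bar>)) \<longlonglongrightarrow> 0"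
proof (rule tendsto_ennreal_0I)
  fix e :: real assume e: "0 < e"
  obtain \<gamma> b where \<gamma>: "0 < \<gamma>" and tail: "\<forall>\<^sub>F n in sequentially. \<forall>x. exp (a * norm x) * \<bar>f n x - g x\<bar> \<le> exp (- 2 * \<gamma> * norm x + b)"
    by (rule tail_both[OF gb a])
  obtain R where R: "0 < R" "exp (- \<gamma> * R + b) * 1 \<le> e"
    by (rule exp_uminus_mult_small[OF \<gamma> e])
  have "\<forall>\<^sub>F n in sequentially. \<forall>x\<in>cball 0 R. \<bar>f n x - g x\<bar> \<le> e / exp (\<bar>a\<bar> * R)"
    by (rule local_uniform[OF cont]) (use e in auto)
  with tail show "\<forall>\<^sub>F n in sequentially. (SUP x. ennreal (exp (a * norm x) * \<bar>f n x - g x\<bar>)) \<le> ennreal e"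
  proof eventually_elim
    case (elim n)
    show ?case
    proof (rule SUP_least, rule ennreal_leI)
      fix x
      show "exp (a * norm x) * \<bar>f n x - g x\<bar> \<le> e"
      proof (cases "norm x \<le> R")
        case True
        have "a * norm x \<le> \<bar>a\<bar> * norm x" by (intro mult_right_mono) auto
        also have "\<dots> \<le> \<bar>a\<bar> * R" using True by (intro mult_left_mono) auto
        finally have "exp (a * norm x) * \<bar>f n x - g x\<bar> \<le> exp (\<bar>a\<bar> * R) * (e / exp (\<bar>a\<bar> * R))"
          using elim(2) True by (intro mult_mono) auto
        then show ?thesis by simp
      next
        case False
        then have "\<gamma> * R \<le> \<gamma> * norm x" "0 \<le> \<gamma> * norm x" using \<gamma> by simp_all
        then have "exp (- 2 * \<gamma> * norm x + b) \<le> exp (- \<gamma> * R + b)" by simp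
        with elim(1) R show ?thesis by (smt (verit))
      qed
    qed
  qed
qed


end

section \<open>Kullback--Leibler projection\<close>

lemma borel_measurable_norm_lebesgue[measurable]:
  "(\<lambda>x::'a::euclidean_space. norm x) \<in> borel_measurable lebesgue"
  by (rule measurable_completion) simp

lemma mult_ln_divide_le:
  fixes u v :: real
  assumes "0 < u" "0 < v"
  shows "u * (ln v - ln u) \<le> v"
proof -
  have "ln (v / u) \<le> v / u" using ln_le_minus_one[of "v / u"] assms by simp
  then have "u * ln (v / u) \<le> u * (v / u)" using assms by (intro mult_left_mono) auto
  then show ?thesis using assms by (simp add: ln_div)
qed

text \<open>With p = sqrt f and q = sqrt g, the difference f - g factors as (p - q) (p + q), and (p
  - q)^2 integrates to 2 - 2 \<rho>. A pointwise weighted inequality between arithmetic and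
  geometric mean replaces Cauchy-Schwarz; its parameter \<delta> is fixed only at the points of
  use.\<close>

lemma hellinger_affinity:
  fixes f g :: "'a::euclidean_space \<Rightarrow> real"
  assumes f: "prob_density f" and g: "prob_density g"
  defines "\<rho> \<equiv> (LINT x|lebesgue. sqrt (f x * g x))"
  shows "integrable lebesgue (\<lambda>x. sqrt (f x * g x))" "0 \<le> \<rho>" "\<rho> \<le> 1"
    "0 < \<delta> \<Longrightarrow> (LINT x|lebesgue. \<bar>f x - g x\<bar>) \<le> (1 - \<rho>) / \<delta> + 2 * \<delta>"
proof -
  note f' = prob_densityD[OF f] and g' = prob_densityD[OF g]
  have [measurable]: "f \<in> borel_measurable lebesgue" "g \<in> borel_measurable lebesgue" using f' g' by auto
  show i: "integrable lebesgue (\<lambda>x. sqrt (f x * g x))"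
  proof (rule Bochner_Integration.integrable_bound)
    show "integrable lebesgue (\<lambda>x. (f x + g x) / 2)" using f' g' by auto
    show "AE x in lebesgue. norm (sqrt (f x * g x)) \<le> norm ((f x + g x) / 2)"
      using f'(2) g'(2) arith_geo_mean_sqrt by (intro AE_I2) simp
  qed measurable
  show "0 \<le> \<rho>" unfolding \<rho>_def using f'(2) g'(2) by (intro integral_nonneg_AE) auto
  have "\<rho> \<le> (LINT x|lebesgue. (f x + g x) / 2)"
    unfolding \<rho>_def using f' g' i arith_geo_mean_sqrt by (intro integral_mono) auto
  also have "\<dots> = 1" using f' g' by simp
  finally show "\<rho> \<le> 1" .
  assume d: "0 < \<delta>"
  have "(LINT x|lebesgue. \<bar>f x - g x\<bar>) \<le> (LINT x|lebesgue. (f x + g x - 2 * sqrt (f x * g x)) / (2 * \<delta>) + \<delta> * (f x + g x))"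
  proof (rule integral_mono)
    show "integrable lebesgue (\<lambda>x. \<bar>f x - g x\<bar>)" using f' g' by auto
    show "integrable lebesgue (\<lambda>x. (f x + g x - 2 * sqrt (f x * g x)) / (2 * \<delta>) + \<delta> * (f x + g x))"
      using f' g' i by auto
    fix x
    define p q where "p = sqrt (f x)" and "q = sqrt (g x)"
    have pq: "f x = p\<^sup>2" "g x = q\<^sup>2" "sqrt (f x * g x) = p * q"
      using f'(2)[of x] g'(2)[of x] by (simp_all add: p_def q_def real_sqrt_mult)
    have "\<bar>f x - g x\<bar> = \<bar>p - q\<bar> * \<bar>p + q\<bar>" by (simp add: pq power2_eq_square abs_mult[symmetric] algebra_simps)
    also have "\<dots> \<le> (p - q)\<^sup>2 / (2 * \<delta>) + \<delta> * (p + q)\<^sup>2 / 2"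
    proof -
      have "a * b \<le> a\<^sup>2 / (2 * \<delta>) + \<delta> * b\<^sup>2 / 2" for a b
      proof -
        have "0 \<le> (a - \<delta> * b)\<^sup>2 / (2 * \<delta>)" using d by simp
        also have "\<dots> = a\<^sup>2 / (2 * \<delta>) + \<delta> * b\<^sup>2 / 2 - a * b"
          using d by (simp add: power2_eq_square field_simps)
        finally show ?thesis by simp
      qed
      from this[of "\<bar>p - q\<bar>" "\<bar>p + q\<bar>"] show ?thesis by simp
    qed
    also have "\<delta> * (p + q)\<^sup>2 / 2 \<le> \<delta> * (p\<^sup>2 + q\<^sup>2)"
    proof -
      have "(p + q)\<^sup>2 \<le> 2 * (p\<^sup>2 + q\<^sup>2)" using zero_le_power2[of "p - q"] by (simp add: power2_eq_square algebra_simps)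
      then have "\<delta> * (p + q)\<^sup>2 \<le> \<delta> * (2 * (p\<^sup>2 + q\<^sup>2))" using d by (intro mult_left_mono) auto
      then show ?thesis by (simp add: algebra_simps)
    qed
    finally show "\<bar>f x - g x\<bar> \<le> (f x + g x - 2 * sqrt (f x * g x)) / (2 * \<delta>) + \<delta> * (f x + g x)"
      unfolding pq(3) by (simp add: pq(1,2) power2_diff mult.assoc)
  qed
  also have "\<dots> = (2 - 2 * \<rho>) / (2 * \<delta>) + \<delta> * 2"
    using f' g' i by (simp add: \<rho>_def)
  finally show "(LINT x|lebesgue. \<bar>f x - g x\<bar>) \<le> (1 - \<rho>) / \<delta> + 2 * \<delta>"
    using d by (simp add: field_simps)
qed

lemma log_concave_density_sqrt_mult:
  fixes f g :: "'a::euclidean_space \<Rightarrow> real"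
  assumes f: "log_concave_density f" and g: "log_concave_density g"
  defines "\<rho> \<equiv> (LINT x|lebesgue. sqrt (f x * g x))"
  assumes pos: "0 < \<rho>"
  shows "log_concave_density (\<lambda>x. sqrt (f x * g x) / \<rho>)"
  using pos unfolding \<rho>_def
  by (intro log_concave_density_normalise log_concave_fun_sqrt_mult hellinger_affinity(1))
    (auto simp: log_concave_densityD[OF f] log_concave_densityD[OF g] prob_densityD(2))

section \<open>The law with density \<open>f0\<close> and its likelihood functional\<close>

locale kl_projection =
  fixes f0 :: "'a::euclidean_space \<Rightarrow> real"
  assumes f0: "prob_density f0"
    and moment: "(\<integral>\<^sup>+x. ennreal (norm x * f0 x) \<partial>lebesgue) < \<infinity>"
    and entropy: "(\<integral>\<^sup>+x. ennreal (f0 x * log_plus (f0 x)) \<partial>lebesgue) < \<infinity>"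
    and support: "interior (density_support f0) \<noteq> {}"
begin

definition Q :: "'a measure" where "Q = density lebesgue (\<lambda>x. ennreal (f0 x))"

lemma sets_Q[simp, measurable_cong]: "sets Q = sets lebesgue" and space_Q[simp]: "space Q = UNIV"
  by (simp_all add: Q_def)

lemma f0_measurable[measurable]: "f0 \<in> borel_measurable lebesgue"
  and f0_nonneg: "0 \<le> f0 x"
  using prob_densityD[OF f0] by auto

lemma emeasure_Q: "A \<in> sets lebesgue \<Longrightarrow> emeasure Q A = (\<integral>\<^sup>+x\<in>A. ennreal (f0 x) \<partial>lebesgue)"
  by (simp add: Q_def emeasure_density)

lemma prob_space_Q: "prob_space Q"
  by (rule prob_spaceI) (use prob_densityD(5)[OF f0] in \<open>simp add: emeasure_Q\<close>)

sublocale Q: prob_space Q by (rule prob_space_Q)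

lemma AE_Q: "(AE x in Q. P x) \<longleftrightarrow> (AE x in lebesgue. 0 < f0 x \<longrightarrow> P x)"
  unfolding Q_def by (subst AE_density) auto

lemma AE_Q_I: "AE x in lebesgue. P x \<Longrightarrow> AE x in Q. P x"
  unfolding AE_Q by (auto elim: eventually_mono)

lemma integrable_Q: "h \<in> borel_measurable lebesgue \<Longrightarrow> integrable Q h \<longleftrightarrow> integrable lebesgue (\<lambda>x. f0 x * (h x::real))"
  unfolding Q_def by (subst integrable_density) (auto simp: f0_nonneg)

lemma integral_Q: "h \<in> borel_measurable lebesgue \<Longrightarrow> integral\<^sup>L Q h = (LINT x|lebesgue. f0 x * (h x::real))"
  unfolding Q_def by (subst integral_density) (auto simp: f0_nonneg)

lemma integrable_norm_Q: "integrable Q (\<lambda>x. norm x)"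
proof -
  have "integrable lebesgue (\<lambda>x. f0 x * norm x)"
    by (rule integrableI_nonneg) (use moment f0_nonneg in \<open>auto simp: mult.commute\<close>)
  then show ?thesis by (subst integrable_Q) auto
qed

text \<open>The positive part is the entropy hypothesis. For the negative part, u (ln v - ln u)
  \<le> v with v = exp (- norm x) gives - f0 ln f0 \<le> exp (- norm x) + f0 norm x, which is
  integrable by the moment hypothesis.\<close>

lemma integrable_ln_f0: "integrable Q (\<lambda>x. ln (f0 x))"
proof (subst integrable_Q)
  have lp: "integrable lebesgue (\<lambda>x. f0 x * log_plus (f0 x))"
  proof (rule integrableI_nonneg)
    show "(\<lambda>x. f0 x * log_plus (f0 x)) \<in> borel_measurable lebesgue"
      unfolding log_plus_def by measurable
    show "AE x in lebesgue. 0 \<le> f0 x * log_plus (f0 x)"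
      using f0_nonneg by (auto simp: log_plus_def)
  qed (use entropy in auto)
  show "integrable lebesgue (\<lambda>x. f0 x * ln (f0 x))"
  proof (rule Bochner_Integration.integrable_bound)
    have "integrable lebesgue (\<lambda>x. f0 x * norm x)"
      using integrable_norm_Q by (subst (asm) integrable_Q) auto
    moreover have "integrable lebesgue (\<lambda>x::'a. exp (- 1 * norm (x - 0)))"
      by (rule integrable_exp_norm) simp
    \<comment> \<open>The factor 2 comes from \<bar>t\<bar> = 2 max t 0 - t.\<close>
    ultimately show "integrable lebesgue (\<lambda>x. 2 * (f0 x * log_plus (f0 x)) + exp (- norm x) + f0 x * norm x)"
      using lp by simp
    show "AE x in lebesgue. norm (f0 x * ln (f0 x)) \<le> norm (2 * (f0 x * log_plus (f0 x)) + exp (- norm x) + f0 x * norm x)"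
    proof (rule AE_I2)
      fix x
      show "norm (f0 x * ln (f0 x)) \<le> norm (2 * (f0 x * log_plus (f0 x)) + exp (- norm x) + f0 x * norm x)"
      proof (cases "f0 x = 0")
        case False
        then have pos: "0 < f0 x" using f0_nonneg[of x] by simp
        have "f0 x * (ln (exp (- norm x)) - ln (f0 x)) \<le> exp (- norm x)"
          by (rule mult_ln_divide_le[OF pos]) simp
        then have a: "- (f0 x * ln (f0 x)) \<le> exp (- norm x) + f0 x * norm x" by (simp add: algebra_simps)
        have b: "f0 x * log_plus (f0 x) \<ge> 0" "f0 x * log_plus (f0 x) \<ge> f0 x * ln (f0 x)"
          using pos by (auto simp: log_plus_def)
        have c: "0 \<le> f0 x * norm x" using pos by simp
        have "\<bar>f0 x * ln (f0 x)\<bar> \<le> 2 * (f0 x * log_plus (f0 x)) + exp (- norm x) + f0 x * norm x"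
          using a b c exp_ge_zero[of "- norm x"] by linarith
        then show ?thesis by simp
      qed simp
    qed
  qed measurable
qed measurable

text \<open>Among densities, these are the ones with \<open>kl_div f0 g < \<infinity>\<close>.
  Positivity is stated separately because the real logarithm has ln 0 = 0, so that integrability
  alone would not detect zeros.\<close>

definition admissible :: "('a \<Rightarrow> real) \<Rightarrow> bool" where
  "admissible g \<longleftrightarrow> prob_density g \<and> (AE x in Q. 0 < g x) \<and> integrable Q (\<lambda>x. ln (g x))"

definition loglik :: "('a \<Rightarrow> real) \<Rightarrow> real" where
  "loglik g = (LINT x|Q. ln (g x))"

lemma nn_integral_kl_integrand:
  fixes g :: "'a \<Rightarrow> real"
  defines "h \<equiv> (\<lambda>x. f0 x * (ln (f0 x) - ln (g x)))"
  assumes pos: "AE x in Q. 0 < g x"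
  shows "(\<integral>\<^sup>+x. e2ennreal (kl_integrand (f0 x) (g x)) \<partial>lebesgue) = (\<integral>\<^sup>+x. ennreal (h x) \<partial>lebesgue)"
    and "(\<integral>\<^sup>+x. e2ennreal (- kl_integrand (f0 x) (g x)) \<partial>lebesgue) = (\<integral>\<^sup>+x. ennreal (- h x) \<partial>lebesgue)"
proof -
  have "AE x in lebesgue. kl_integrand (f0 x) (g x) = ereal (h x)"
    using pos unfolding AE_Q
  proof eventually_elim
    case (elim x)
    then show ?case using f0_nonneg[of x] by (auto simp: kl_integrand_def h_def ln_div less_le)
  qed
  then show "(\<integral>\<^sup>+x. e2ennreal (kl_integrand (f0 x) (g x)) \<partial>lebesgue) = (\<integral>\<^sup>+x. ennreal (h x) \<partial>lebesgue)"
    "(\<integral>\<^sup>+x. e2ennreal (- kl_integrand (f0 x) (g x)) \<partial>lebesgue) = (\<integral>\<^sup>+x. ennreal (- h x) \<partial>lebesgue)"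
    by (intro nn_integral_cong_AE; auto elim!: eventually_mono simp: e2ennreal_ereal)+
qed

lemma kl_div_admissible:
  assumes "admissible g"
  shows "kl_div f0 g = ereal (loglik f0 - loglik g)"
proof -
  have g: "prob_density g" and pos: "AE x in Q. 0 < g x" and int: "integrable Q (\<lambda>x. ln (g x))"
    using assms by (auto simp: admissible_def)
  note [measurable] = prob_densityD(1)[OF g]
  define h where "h = (\<lambda>x. f0 x * (ln (f0 x) - ln (g x)))"
  have ih: "integrable lebesgue h"
  proof -
    have "integrable Q (\<lambda>x. ln (f0 x) - ln (g x))" using int integrable_ln_f0 by auto
    then show ?thesis unfolding h_def by (subst (asm) integrable_Q) auto
  qed
  note eq = nn_integral_kl_integrand[OF pos]
  have "(\<integral>\<^sup>+x. ennreal (h x) \<partial>lebesgue) < \<infinity>" "(\<integral>\<^sup>+x. ennreal (- h x) \<partial>lebesgue) < \<infinity>"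
    using ih by (auto simp: real_integrable_def top.not_eq_extremum)
  moreover from this have "enn2ereal (\<integral>\<^sup>+x. ennreal (h x) \<partial>lebesgue) - enn2ereal (\<integral>\<^sup>+x. ennreal (- h x) \<partial>lebesgue) = ereal (integral\<^sup>L lebesgue h)"
    unfolding real_lebesgue_integral_def[OF ih]
    by (cases "\<integral>\<^sup>+x. ennreal (h x) \<partial>lebesgue"; cases "\<integral>\<^sup>+x. ennreal (- h x) \<partial>lebesgue") (auto simp: enn2ereal_ennreal)
  ultimately have "kl_div f0 g = ereal (integral\<^sup>L lebesgue h)" by (simp add: kl_div_def eq h_def)
  also have "integral\<^sup>L lebesgue h = (LINT x|Q. ln (f0 x) - ln (g x))"
    unfolding h_def by (subst integral_Q) auto
  also have "\<dots> = loglik f0 - loglik g"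
    unfolding loglik_def using int integrable_ln_f0 by simp
  finally show ?thesis .
qed

text \<open>The negative part of the integrand is at most \<open>g\<close>, so its integral never
  exceeds 1 and cannot compensate an infinite positive part. The positive part is therefore
  integrable, hence almost everywhere finite, which forces g > 0 almost everywhere on the set where
  f0 > 0.\<close>

lemma kl_div_finite_admissible:
  assumes g: "prob_density g" and fin: "kl_div f0 g < \<infinity>"
  shows "admissible g"
proof -
  note [measurable] = prob_densityD(1)[OF g]
  have nn: "0 \<le> g x" for x using prob_densityD(2)[OF g] .
  define h where "h = (\<lambda>x. f0 x * (ln (f0 x) - ln (g x)))"
  have hm[measurable]: "h \<in> borel_measurable lebesgue" unfolding h_def by measurable
  define Ip where "Ip = (\<integral>\<^sup>+x. e2ennreal (kl_integrand (f0 x) (g x)) \<partial>lebesgue)"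
  define In where "In = (\<integral>\<^sup>+x. e2ennreal (- kl_integrand (f0 x) (g x)) \<partial>lebesgue)"
  have mp: "(\<lambda>x. e2ennreal (kl_integrand (f0 x) (g x))) \<in> borel_measurable lebesgue"
    unfolding kl_integrand_def by measurable
  have "In \<le> (\<integral>\<^sup>+x. ennreal (g x) \<partial>lebesgue)"
    unfolding In_def
  proof (rule nn_integral_mono)
    fix x
    show "e2ennreal (- kl_integrand (f0 x) (g x)) \<le> ennreal (g x)"
    proof (cases "f0 x = 0 \<or> g x = 0")
      case True
      then show ?thesis by (auto simp: kl_integrand_def e2ennreal_neg)
    next
      case False
      then have pos: "0 < f0 x" "0 < g x" using nn[of x] f0_nonneg[of x] by auto
      then have "- kl_integrand (f0 x) (g x) = ereal (f0 x * (ln (g x) - ln (f0 x)))"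
        by (simp add: kl_integrand_def ln_div algebra_simps)
      then show ?thesis using mult_ln_divide_le[OF pos] by (simp add: e2ennreal_ereal ennreal_leI)
    qed
  qed
  also have "\<dots> = 1" by (rule prob_densityD(5)[OF g])
  finally have In: "In \<le> 1" .
  have Ip: "Ip \<noteq> \<top>"
  proof
    assume "Ip = \<top>"
    moreover obtain i where "In = ennreal i" "0 \<le> i" using In by (cases In) (auto simp: top_unique)
    ultimately have "kl_div f0 g = \<infinity>"
      unfolding kl_div_def Ip_def[symmetric] In_def[symmetric] by (simp add: enn2ereal_ennreal)
    with fin show False by simp
  qed
  have "AE x in lebesgue. e2ennreal (kl_integrand (f0 x) (g x)) \<noteq> \<infinity>"
    by (rule nn_integral_noteq_infinite[OF mp]) (use Ip in \<open>simp add: Ip_def\<close>)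
  then have gpos: "AE x in lebesgue. 0 < f0 x \<longrightarrow> 0 < g x"
  proof eventually_elim
    case (elim x)
    then show ?case using nn[of x] by (cases "g x = 0") (auto simp: kl_integrand_def split: if_splits)
  qed
  note eq = nn_integral_kl_integrand[OF gpos[folded AE_Q], folded Ip_def In_def]
  have "integrable lebesgue h"
    unfolding real_integrable_def using eq Ip In hm by (auto simp: top_unique h_def)
  then have "integrable Q (\<lambda>x. ln (f0 x) - ln (g x))"
    unfolding h_def by (subst integrable_Q) auto
  from Bochner_Integration.integrable_diff[OF integrable_ln_f0 this]
  have "integrable Q (\<lambda>x. ln (g x))" by simp
  then show ?thesis using g gpos by (simp add: admissible_def AE_Q)
qed

text \<open>The pointwise bound u (ln v - ln u) \<le> v yields the constant 1 directly; the purpose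
  is a finite supremum of the log-likelihood.\<close>

lemma loglik_le:
  assumes "admissible g"
  shows "loglik g \<le> loglik f0 + 1"
proof -
  have g: "prob_density g" and pos: "AE x in Q. 0 < g x" and int: "integrable Q (\<lambda>x. ln (g x))"
    using assms by (auto simp: admissible_def)
  note [measurable] = prob_densityD(1)[OF g]
  have iQ: "integrable Q (\<lambda>x. ln (g x) - ln (f0 x))" using int integrable_ln_f0 by auto
  have "loglik g - loglik f0 = (LINT x|Q. ln (g x) - ln (f0 x))"
    unfolding loglik_def using int integrable_ln_f0 by simp
  also have "\<dots> = (LINT x|lebesgue. f0 x * (ln (g x) - ln (f0 x)))" by (subst integral_Q) auto
  also have "\<dots> \<le> (LINT x|lebesgue. g x)"
  proof (rule integral_mono_AE)
    show "integrable lebesgue (\<lambda>x. f0 x * (ln (g x) - ln (f0 x)))"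
      using iQ by (subst (asm) integrable_Q) auto
    show "integrable lebesgue (\<lambda>x. g x)" using prob_densityD(3)[OF g] by simp
    show "AE x in lebesgue. f0 x * (ln (g x) - ln (f0 x)) \<le> g x"
      using pos unfolding AE_Q
    proof eventually_elim
      case (elim x)
      then show ?case using mult_ln_divide_le[of "f0 x" "g x"] f0_nonneg[of x] prob_densityD(2)[OF g, of x]
        by (cases "f0 x = 0") auto
    qed
  qed
  also have "\<dots> = 1" using prob_densityD(4)[OF g] by simp
  finally show ?thesis by simp
qed

lemma integrable_Q_lipschitz:
  fixes h :: "'a \<Rightarrow> real"
  assumes lip: "\<And>x y. \<bar>h x - h y\<bar> \<le> L * norm (x - y)" and meas: "h \<in> borel_measurable lebesgue"
  shows "integrable Q h"
proof (rule Bochner_Integration.integrable_bound)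
  show "integrable Q (\<lambda>x. \<bar>h 0\<bar> + L * norm x)" using integrable_norm_Q by auto
  show "AE x in Q. norm (h x) \<le> norm (\<bar>h 0\<bar> + L * norm x)"
    by (rule AE_I2) (use lip[of _ 0] in \<open>smt (verit) diff_zero real_norm_def\<close>)
qed (use meas in simp)

lemma admissible_lipschitz:
  assumes "prob_density g" "\<And>x. 0 < g x" "\<And>x y. \<bar>ln (g x) - ln (g y)\<bar> \<le> L * norm (x - y)"
  shows "admissible g"
  unfolding admissible_def
  using assms integrable_Q_lipschitz[OF assms(3)] prob_densityD(1)[OF assms(1)] by auto

lemma ex_admissible: "\<exists>g. log_concave_density g \<and> admissible g"
proof -
  define I where "I = (LINT x|lebesgue. exp (- norm (x::'a)))"
  \<comment> \<open>The logarithm of this density is 1-Lipschitz, so the first moment of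
    \<open>f0\<close> makes its likelihood finite.\<close>
  define g where "g = (\<lambda>x::'a. exp (- norm x) / I)"
  have i: "integrable lebesgue (\<lambda>x::'a. exp (- norm x))" using integrable_exp_norm[of 1 "0::'a"] by simp
  have "0 < exp (- 1) * (unit_ball_vol DIM('a) * 1 ^ DIM('a))" by simp
  also have "\<dots> \<le> (LINT x|lebesgue. \<bar>exp (- norm (x::'a)) - 0\<bar>)"
    by (rule L1_dist_ge_ball[OF i, where w = 0]) auto
  finally have I: "0 < I" by (simp add: I_def)
  have "log_concave_fun (\<lambda>x::'a. exp (- norm x))"
  proof (subst log_concave_fun_iff, simp, intro allI ballI)
    fix x y :: 'a and t :: real assume t: "t \<in> {0<..<1}"
    have "norm ((1 - t) *\<^sub>R x + t *\<^sub>R y) \<le> (1 - t) * norm x + t * norm y"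
      using t by (intro order_trans[OF norm_triangle_ineq]) auto
    then show "exp (- norm x) powr (1 - t) * exp (- norm y) powr t \<le> exp (- norm ((1 - t) *\<^sub>R x + t *\<^sub>R y))"
      by (simp add: powr_def exp_add[symmetric])
  qed
  then have lc: "log_concave_density g"
    unfolding g_def I_def by (rule log_concave_density_normalise) (use i I in \<open>auto simp: I_def\<close>)
  note pd = log_concave_densityD(1)[OF lc]
  have "admissible g"
  proof (rule admissible_lipschitz[OF pd, of 1])
    show "0 < g x" for x using I by (simp add: g_def)
    show "\<bar>ln (g x) - ln (g y)\<bar> \<le> 1 * norm (x - y)" for x y
      using I norm_triangle_ineq3[of x y] by (simp add: g_def ln_div)
  qed
  with lc show ?thesis by blast
qed

text \<open>As \<open>loglik f0\<close> is finite, the divergence of an admissible density is a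
  constant minus \<open>loglik\<close>, and all other densities have infinite divergence. The
  existence of one admissible competitor forces a minimiser to be admissible.\<close>

lemma kl_minimiser_iff:
  "kl_minimiser f0 f \<longleftrightarrow> log_concave_density f \<and> admissible f \<and>
    (\<forall>g. log_concave_density g \<and> admissible g \<longrightarrow> loglik g \<le> loglik f)"
proof
  assume m: "kl_minimiser f0 f"
  obtain g where g: "log_concave_density g" "admissible g" using ex_admissible by blast
  have "kl_div f0 f \<le> kl_div f0 g" using m g by (auto simp: kl_minimiser_def)
  then have "kl_div f0 f < \<infinity>" using kl_div_admissible[OF g(2)] by auto
  then have a: "admissible f"
    using m kl_div_finite_admissible by (auto simp: kl_minimiser_def log_concave_density_def)
  then show "log_concave_density f \<and> admissible f \<and>
    (\<forall>g. log_concave_density g \<and> admissible g \<longrightarrow> loglik g \<le> loglik f)"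
    using m kl_div_admissible by (auto simp: kl_minimiser_def)
next
  assume *: "log_concave_density f \<and> admissible f \<and>
    (\<forall>g. log_concave_density g \<and> admissible g \<longrightarrow> loglik g \<le> loglik f)"
  have "kl_div f0 f \<le> kl_div f0 g" if g: "log_concave_density g" for g
  proof (cases "kl_div f0 g < \<infinity>")
    case True
    then have "admissible g" using kl_div_finite_admissible g by (auto simp: log_concave_density_def)
    then show ?thesis using * g kl_div_admissible by auto
  next
    case False then show ?thesis by auto
  qed
  then show "kl_minimiser f0 f" using * by (simp add: kl_minimiser_def)
qed

end

text \<open>A point of \<open>ball z (r / 2)\<close> missed by \<open>C\<close> yields, by
  separation, a missed ball of radius r / 4 whose centre is still in \<open>cball z r\<close>. Each
  such ball contains the ball of radius r / 8 about some point of a finite net, so finitely many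
  test balls decide.\<close>

lemma ball_subset_convex_hitting:
  fixes z :: "'a::euclidean_space"
  assumes r: "0 < r"
  obtains X where "finite X" "X \<subseteq> cball z r"
    "\<And>C. convex C \<Longrightarrow> \<not> ball z (r / 2) \<subseteq> C \<Longrightarrow> \<exists>x\<in>X. ball x (r / 8) \<inter> C = {}"
proof -
  obtain X where X: "X \<subseteq> cball z r" "finite X" "cball z r \<subseteq> (\<Union>x\<in>X. ball x (r / 8))"
    using compactE_image[OF compact_cball[of z r], of "cball z r" "\<lambda>x. ball x (r / 8)"] r
    by (metis (no_types, lifting) UN_I centre_in_ball open_ball subsetI zero_less_divide_iff zero_less_numeral)
  show ?thesis
  proof (rule that[OF X(2,1)])
    fix C :: "'a set" assume C: "convex C" "\<not> ball z (r / 2) \<subseteq> C"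
    then obtain p where p: "p \<in> ball z (r / 2)" "p \<notin> C" by blast
    obtain y where y': "dist p y = r / 4" "ball y (r / 4) \<inter> C = {}"
      by (rule convex_disjoint_ball[OF C(1) p(2), of "r / 4"]) (use r in auto)
    then have y: "y \<in> cball z r" "ball y (r / 4) \<inter> C = {}"
      using p r dist_triangle[of z y p] by (auto simp: dist_commute)
    then obtain x where x: "x \<in> X" "dist x y < r / 8" using X(3) by auto
    have "ball x (r / 8) \<subseteq> ball y (r / 4)"
    proof
      fix w assume "w \<in> ball x (r / 8)"
      then show "w \<in> ball y (r / 4)" using x dist_triangle[of y w x] by (simp add: dist_commute)
    qed
    then show "\<exists>x\<in>X. ball x (r / 8) \<inter> C = {}" using x y by blast
  qed
qed

text \<open>Averaged over \<open>Q\<close> or over a sample, this bound turns the mass of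
  \<open>B\<close> into the premise of \<open>log_concave_density_class_bounds\<close>.\<close>

lemma ln_le_of_level_miss:
  fixes f :: "'a::euclidean_space \<Rightarrow> real"
  assumes "\<And>x. f x \<le> exp M" "B \<inter> {y. exp q \<le> f y} = {}" "0 < f y"
  shows "ln (f y) \<le> M - (M - q) * indicator B y"
proof (cases "y \<in> B")
  case True
  then have "f y \<le> exp q" using assms(2) by force
  then show ?thesis using True assms(3) ln_mono[of "f y" "exp q"] by simp
next
  case False
  then show ?thesis using assms(1)[of y] assms(3) ln_mono[of "f y" "exp M"] by simp
qed

context kl_projection
begin

text \<open>The \<open>LEAST\<close> in \<open>density_support\<close> is informative only once a
  least closed set of full mass is exhibited. By Lindelof the union of all open null sets is a
  countable union of such sets, hence null, and its complement is the set sought.\<close>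

lemma density_support_open:
  assumes x: "x \<in> density_support f0" and U: "open U" "x \<in> U"
  shows "0 < measure Q U"
proof -
  define \<N> where "\<N> = {U::'a set. open U \<and> emeasure Q U = 0}"
  obtain \<N>' where \<N>': "\<N>' \<subseteq> \<N>" "countable \<N>'" "\<Union>\<N>' = \<Union>\<N>"
    using Lindelof[of \<N>] by (auto simp: \<N>_def)
  have "(\<Union>U\<in>\<N>'. U) \<in> null_sets Q"
    by (rule null_sets_UN') (use \<N>' in \<open>auto simp: \<N>_def null_sets_def\<close>)
  then have null: "emeasure Q (\<Union>\<N>) = 0" using \<N>'(3) by (simp add: null_sets_def)
  have opn: "open (\<Union>\<N>)" by (auto simp: \<N>_def)
  have 1: "emeasure Q F = 1 \<longleftrightarrow> emeasure Q (- F) = 0" if "closed F" for F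
  proof -
    have F: "F \<in> sets Q" using that by auto
    have "measure Q (- F) = 1 - measure Q F"
      using Q.prob_compl[OF F] by (simp add: Compl_eq_Diff_UNIV)
    then show ?thesis by (simp add: Q.emeasure_eq_measure)
  qed
  have iff: "(closed E \<and> (\<integral>\<^sup>+x\<in>E. ennreal (f0 x) \<partial>lebesgue) = 1) \<longleftrightarrow> (closed E \<and> emeasure Q (- E) = 0)" for E
    using 1[of E] emeasure_Q[of E] by (metis borel_closed sets_completionI_sets sets_lborel)
  have "density_support f0 = - \<Union>\<N>"
    unfolding density_support_def iff
  proof (rule Least_equality)
    show "closed (- \<Union>\<N>) \<and> emeasure Q (- (- (\<Union>\<N>))) = 0" using opn null by (simp add: closed_def)
    fix F assume "closed F \<and> emeasure Q (- F) = 0"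
    then have "- F \<in> \<N>" by (simp add: \<N>_def closed_def)
    then show "- \<Union>\<N> \<le> F" by blast
  qed
  with x U have "emeasure Q U \<noteq> 0" by (auto simp: \<N>_def)
  then show ?thesis by (simp add: Q.emeasure_eq_measure less_le)
qed

lemma support_constants:
  obtains z r X \<epsilon> c where "0 < r" "0 < \<epsilon>" "finite X" "0 < c" "c \<le> 1"
    "\<And>x. x \<in> X \<Longrightarrow> c < measure Q (ball x \<epsilon>)" "0 < measure Q (ball z r)"
    "\<And>C. convex C \<Longrightarrow> \<not> ball z r \<subseteq> C \<Longrightarrow> \<exists>x\<in>X. ball x \<epsilon> \<inter> C = {}"
proof -
  obtain z where "z \<in> interior (density_support f0)" using support by blast
  then obtain r where r: "0 < r" "cball z r \<subseteq> density_support f0" by (meson mem_interior_cball)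
  obtain X where X: "finite X" "X \<subseteq> cball z r"
    "\<And>C. convex C \<Longrightarrow> \<not> ball z (r / 2) \<subseteq> C \<Longrightarrow> \<exists>x\<in>X. ball x (r / 8) \<inter> C = {}"
    by (rule ball_subset_convex_hitting[OF r(1), of z]) blast
  have pos: "0 < measure Q (ball x e)" if "x \<in> cball z r" "0 < e" for x e
    by (rule density_support_open[of x]) (use that r in auto)
  \<comment> \<open>Halving makes \<open>c\<close> strictly smaller than every mass, so that sample
    frequencies exceed it from some n on; inserting 1 gives \<open>c \<le> 1\<close> and a
    well-defined minimum for empty \<open>X\<close>.\<close>
  define c where "c = Min (insert 1 ((\<lambda>x. measure Q (ball x (r / 8)) / 2) ` X))"
  have c: "0 < c" unfolding c_def using X pos r by (subst Min_gr_iff) auto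
  have c1: "c \<le> 1" unfolding c_def using X by (intro Min_le) auto
  have cX: "c < measure Q (ball x (r / 8))" if "x \<in> X" for x
  proof -
    have "c \<le> measure Q (ball x (r / 8)) / 2" unfolding c_def using X that by (intro Min_le) auto
    moreover have "0 < measure Q (ball x (r / 8))" using that X r by (intro pos) auto
    ultimately show ?thesis by linarith
  qed
  show ?thesis
    by (rule that[of "r / 2" "r / 8" X c z]) (use r X c c1 cX pos[of z "r / 2"] in auto)
qed

lemma loglik_class_bounds:
  obtains z r M K where "0 < r" "0 \<le> M" "0 \<le> K"
    "\<And>f. log_concave_density f \<Longrightarrow> admissible f \<Longrightarrow> l \<le> loglik f \<Longrightarrow>
      (\<forall>x. f x \<le> exp M) \<and> (\<forall>y\<in>ball z r. exp (- K) \<le> f y)"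
proof -
  obtain z r X \<epsilon> c where s: "0 < r" "0 < \<epsilon>" "finite X" "0 < c" "c \<le> 1"
    "\<And>x. x \<in> X \<Longrightarrow> c < measure Q (ball x \<epsilon>)" "0 < measure Q (ball z r)"
    "\<And>C. convex C \<Longrightarrow> \<not> ball z r \<subseteq> C \<Longrightarrow> \<exists>x\<in>X. ball x \<epsilon> \<inter> C = {}"
    by (rule support_constants) blast
  obtain M K where MK: "0 \<le> M" "0 \<le> K"
    "\<And>f (z::'a). log_concave_density f \<Longrightarrow>
      (\<And>M q. q \<le> M \<Longrightarrow> (\<And>x. f x \<le> exp M) \<Longrightarrow> \<not> ball z r \<subseteq> {y. exp q \<le> f y} \<Longrightarrow> l \<le> M - (M - q) * c) \<Longrightarrow>
      (\<forall>x. f x \<le> exp M) \<and> (\<forall>y\<in>ball z r. exp (- K) \<le> f y)"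
    by (rule log_concave_density_class_bounds[OF s(4,5,1)]) blast
  show ?thesis
  proof (rule that[OF s(1) MK(1,2)])
    fix f assume f: "log_concave_density f" and adm: "admissible f" and l: "l \<le> loglik f"
    show "(\<forall>x. f x \<le> exp M) \<and> (\<forall>y\<in>ball z r. exp (- K) \<le> f y)"
    proof (rule MK(3)[OF f])
      fix M q assume q: "q \<le> M" and bd: "\<And>x. f x \<le> exp M" and n: "\<not> ball z r \<subseteq> {y. exp q \<le> f y}"
      obtain x where x: "x \<in> X" "ball x \<epsilon> \<inter> {y. exp q \<le> f y} = {}"
        using s(8)[OF convex_superlevel[OF log_concave_densityD(2)[OF f]] n] by auto
      have ind: "integrable Q (\<lambda>y. M - (M - q) * indicator (ball x \<epsilon>) y)"
        by (intro Bochner_Integration.integrable_diff integrable_mult_right integrable_real_indicator) (auto simp: Q.emeasure_eq_measure)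
      have "loglik f \<le> (LINT y|Q. M - (M - q) * indicator (ball x \<epsilon>) y)"
        unfolding loglik_def
      proof (rule integral_mono_AE[OF _ ind])
        show "integrable Q (\<lambda>x. ln (f x))" using adm by (simp add: admissible_def)
        have "AE y in Q. 0 < f y" using adm by (simp add: admissible_def)
        then show "AE y in Q. ln (f y) \<le> M - (M - q) * indicator (ball x \<epsilon>) y"
          by eventually_elim (rule ln_le_of_level_miss[OF bd x(2)])
      qed
      also have "\<dots> = M - (M - q) * measure Q (ball x \<epsilon>)"
        by (subst Bochner_Integration.integral_diff) (auto simp: Q.emeasure_eq_measure Q.prob_space[simplified])
      also have "\<dots> \<le> M - (M - q) * c"
        using q s(6)[OF x(1)] by (auto intro!: mult_left_mono)
      finally show "l \<le> M - (M - q) * c" using l by simp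
    qed
  qed
qed

section \<open>Geometric means of near-maximisers and uniqueness\<close>

lemma affinity_pos:
  assumes f: "prob_density f" and g: "prob_density g" and A: "A \<in> sets lebesgue" "0 < measure Q A"
    and pos: "AE x in Q. x \<in> A \<longrightarrow> 0 < f x \<and> 0 < g x"
  shows "0 < (LINT x|lebesgue. sqrt (f x * g x))"
proof (rule ccontr)
  note h = hellinger_affinity[OF f g]
  assume "\<not> 0 < (LINT x|lebesgue. sqrt (f x * g x))"
  then have "(LINT x|lebesgue. sqrt (f x * g x)) = 0" using h(2) by simp
  then have "AE x in lebesgue. sqrt (f x * g x) = 0"
    using prob_densityD(2)[OF f] prob_densityD(2)[OF g] by (subst (asm) integral_nonneg_eq_0_iff_AE[OF h(1)]) auto
  then have "AE x in Q. sqrt (f x * g x) = 0" by (rule AE_Q_I)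
  with pos have "AE x in Q. x \<notin> A" by eventually_elim auto
  then have "A \<in> null_sets Q" using A by (subst AE_iff_null_sets) auto
  with A(2) show False by (simp add: null_sets_def Q.emeasure_eq_measure)
qed

lemma admissible_sqrt_mult:
  assumes f: "log_concave_density f" "admissible f" and g: "log_concave_density g" "admissible g"
  defines "\<rho> \<equiv> (LINT x|lebesgue. sqrt (f x * g x))"
  shows "0 < \<rho>" "log_concave_density (\<lambda>x. sqrt (f x * g x) / \<rho>)" "admissible (\<lambda>x. sqrt (f x * g x) / \<rho>)"
    "loglik (\<lambda>x. sqrt (f x * g x) / \<rho>) = (loglik f + loglik g) / 2 - ln \<rho>"
proof -
  note fp = log_concave_densityD(1)[OF f(1)] and gp = log_concave_densityD(1)[OF g(1)]
  have pos: "AE x in Q. 0 < f x" "AE x in Q. 0 < g x"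
    and int: "integrable Q (\<lambda>x. ln (f x))" "integrable Q (\<lambda>x. ln (g x))"
    using f(2) g(2) by (auto simp: admissible_def)
  show \<rho>: "0 < \<rho>"
    unfolding \<rho>_def
  proof (rule affinity_pos[OF fp gp, of UNIV])
    show "0 < measure Q UNIV" using Q.prob_space by simp
    show "AE x in Q. x \<in> UNIV \<longrightarrow> 0 < f x \<and> 0 < g x" using pos by eventually_elim auto
  qed auto
  show lc: "log_concave_density (\<lambda>x. sqrt (f x * g x) / \<rho>)"
    using log_concave_density_sqrt_mult[OF f(1) g(1)] \<rho> by (simp add: \<rho>_def)
  have eq: "AE x in Q. ln (sqrt (f x * g x) / \<rho>) = (ln (f x) + ln (g x)) / 2 - ln \<rho>"
    using pos by eventually_elim (use \<rho> in \<open>simp add: ln_div ln_sqrt ln_mult\<close>)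
  have m: "(\<lambda>x. sqrt (f x * g x) / \<rho>) \<in> borel_measurable lebesgue"
    using prob_densityD(1)[OF log_concave_densityD(1)[OF lc]] .
  have m1: "(\<lambda>x. ln (sqrt (f x * g x) / \<rho>)) \<in> borel_measurable Q"
    using borel_measurable_ln[OF m] by simp
  have i: "integrable Q (\<lambda>x. (ln (f x) + ln (g x)) / 2 - ln \<rho>)" using int by auto
  have i': "integrable Q (\<lambda>x. ln (sqrt (f x * g x) / \<rho>))"
    using i integrable_cong_AE[OF m1 borel_measurable_integrable[OF i] eq] by simp
  show "admissible (\<lambda>x. sqrt (f x * g x) / \<rho>)"
    unfolding admissible_def
  proof (intro conjI i' log_concave_densityD(1)[OF lc])
    show "AE x in Q. 0 < sqrt (f x * g x) / \<rho>" using pos by eventually_elim (use \<rho> in simp)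
  qed
  have "loglik (\<lambda>x. sqrt (f x * g x) / \<rho>) = (LINT x|Q. (ln (f x) + ln (g x)) / 2 - ln \<rho>)"
    unfolding loglik_def by (rule integral_cong_AE[OF m1 borel_measurable_integrable[OF i] eq])
  also have "\<dots> = (loglik f + loglik g) / 2 - ln \<rho>"
    unfolding loglik_def using int Q.prob_space by simp
  finally show "loglik (\<lambda>x. sqrt (f x * g x) / \<rho>) = (loglik f + loglik g) / 2 - ln \<rho>" .
qed

text \<open>The normalised geometric mean has likelihood at least s - e - ln \<rho> and at most s,
  so 1 - \<rho> \<le> - ln \<rho> \<le> e. A choice of \<delta> of order sqrt e makes the distance
  of order sqrt e.\<close>

lemma L1_dist_near_maximisers:
  assumes f: "log_concave_density f" "admissible f" and g: "log_concave_density g" "admissible g"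
    and s: "\<And>h. log_concave_density h \<Longrightarrow> admissible h \<Longrightarrow> loglik h \<le> s"
    and near: "s - e \<le> loglik f" "s - e \<le> loglik g" and d: "0 < \<delta>"
  shows "(LINT x|lebesgue. \<bar>f x - g x\<bar>) \<le> e / \<delta> + 2 * \<delta>"
proof -
  define \<rho> where "\<rho> = (LINT x|lebesgue. sqrt (f x * g x))"
  note m = admissible_sqrt_mult[OF f g, folded \<rho>_def]
  note h = hellinger_affinity(4)[OF log_concave_densityD(1)[OF f(1)] log_concave_densityD(1)[OF g(1)] d, folded \<rho>_def]
  have "(loglik f + loglik g) / 2 - ln \<rho> \<le> s" using s[OF m(2,3)] m(4) by simp
  then have "- e \<le> ln \<rho>" using near by (simp add: field_simps)
  then have "1 - \<rho> \<le> e" using ln_le_minus_one[OF m(1)] by linarith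
  then have "(1 - \<rho>) / \<delta> \<le> e / \<delta>" using d by (intro divide_right_mono) auto
  with h show ?thesis by linarith
qed

lemma kl_minimiser_unique:
  assumes f: "kl_minimiser f0 f" and g: "kl_minimiser f0 g"
  shows "AE x in lebesgue. f x = g x"
proof -
  have f': "log_concave_density f" "admissible f" "\<And>h. log_concave_density h \<Longrightarrow> admissible h \<Longrightarrow> loglik h \<le> loglik f"
    and g': "log_concave_density g" "admissible g" "\<And>h. log_concave_density h \<Longrightarrow> admissible h \<Longrightarrow> loglik h \<le> loglik g"
    using f g by (auto simp: kl_minimiser_iff)
  \<comment> \<open>Two maximisers are near-maximisers with e = 0, so only the term with the free
    parameter remains.\<close>
  have le: "(LINT x|lebesgue. \<bar>f x - g x\<bar>) \<le> 0 / (\<delta> / 2) + 2 * (\<delta> / 2)" if "0 < \<delta>" for \<delta>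
    by (rule L1_dist_near_maximisers[OF f'(1,2) g'(1,2) f'(3)]) (use that g'(3)[OF f'(1,2)] f'(3)[OF g'(1,2)] in auto)
  have "(LINT x|lebesgue. \<bar>f x - g x\<bar>) \<le> 0" by (rule field_le_epsilon) (use le in force)
  moreover have "0 \<le> (LINT x|lebesgue. \<bar>f x - g x\<bar>)" by simp
  ultimately have z: "(LINT x|lebesgue. \<bar>f x - g x\<bar>) = 0" by simp
  have i: "integrable lebesgue (\<lambda>x. \<bar>f x - g x\<bar>)"
    using prob_densityD(3)[OF log_concave_densityD(1)[OF f'(1)]] prob_densityD(3)[OF log_concave_densityD(1)[OF g'(1)]] by auto
  have "AE x in lebesgue. \<bar>f x - g x\<bar> = 0"
    using z by (subst (asm) integral_nonneg_eq_0_iff_AE[OF i]) auto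
  then show ?thesis by eventually_elim simp
qed

end

section \<open>Existence of the minimiser and consistency of the estimator\<close>

definition sample_mean :: "nat \<Rightarrow> (nat \<Rightarrow> 'a) \<Rightarrow> ('a \<Rightarrow> real) \<Rightarrow> real" where
  "sample_mean n x h = (\<Sum>i<n. h (x i)) / real n"

lemma sample_mean_mono: "(\<And>i. i < n \<Longrightarrow> g (x i) \<le> h (x i)) \<Longrightarrow> sample_mean n x g \<le> sample_mean n x h"
  unfolding sample_mean_def by (intro divide_right_mono sum_mono) auto

lemma avg_log_lik_pos:
  assumes "\<And>i. i < n \<Longrightarrow> 0 < f (x i)"
  shows "avg_log_lik n x f = ereal (sample_mean n x (\<lambda>y. ln (f y)))"
proof -
  have "(\<Sum>i<n. elog (f (x i))) = (\<Sum>i<n. ereal (ln (f (x i))))"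
    by (intro sum.cong refl) (use assms in \<open>auto simp: elog_def dest!: leD\<close>)
  then show ?thesis by (simp add: avg_log_lik_def sample_mean_def)
qed

lemma avg_log_lik_finite_pos:
  assumes n: "0 < n" and fin: "avg_log_lik n x f \<noteq> - \<infinity>" and i: "i < n"
  shows "0 < f (x i)"
proof (rule ccontr)
  assume "\<not> 0 < f (x i)"
  then have "elog (f (x i)) = - \<infinity>" by (simp add: elog_def)
  \<comment> \<open>In \<open>ereal\<close> the sum of \<infinity> and -\<infinity> is \<infinity>;
    a single -\<infinity> decides the sum here because the other summands never add up to
    \<infinity>.\<close>
  moreover have "(\<Sum>j\<in>{..<n} - {i}. elog (f (x j))) \<noteq> \<infinity>"
    by (subst sum_Pinfty) (auto simp: elog_def)
  ultimately have "(\<Sum>i<n. elog (f (x i))) = - \<infinity>"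
    using i by (subst sum.remove[of _ i]) auto
  then show False using fin n by (simp add: avg_log_lik_def)
qed

text \<open>A competitor that is positive at the sample has finite likelihood; so has the maximiser,
  which must then be positive there too. This permits real sample means in place of
  \<open>ereal\<close> sums.\<close>

lemma mle_sample_mean:
  assumes mle: "is_log_concave_mle n x fh" and n: "0 < n"
    and g: "log_concave_density g" "\<And>i. i < n \<Longrightarrow> 0 < g (x i)"
  shows "log_concave_density fh" "i < n \<Longrightarrow> 0 < fh (x i)"
    "sample_mean n x (\<lambda>y. ln (g y)) \<le> sample_mean n x (\<lambda>y. ln (fh y))"
proof -
  show "log_concave_density fh" using mle by (simp add: is_log_concave_mle_def)
  have le: "avg_log_lik n x g \<le> avg_log_lik n x fh" using mle g by (simp add: is_log_concave_mle_def)
  then have "ereal (sample_mean n x (\<lambda>y. ln (g y))) \<le> avg_log_lik n x fh"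
    using avg_log_lik_pos[of n g x, OF g(2)] by simp
  then have "avg_log_lik n x fh \<noteq> - \<infinity>" by auto
  then have pos: "\<And>i. i < n \<Longrightarrow> 0 < fh (x i)" using avg_log_lik_finite_pos[OF n] by blast
  then show "i < n \<Longrightarrow> 0 < fh (x i)" .
  show "sample_mean n x (\<lambda>y. ln (g y)) \<le> sample_mean n x (\<lambda>y. ln (fh y))"
    using le avg_log_lik_pos[of n g x, OF g(2)] avg_log_lik_pos[of n fh x, OF pos] by simp
qed

text \<open>The normalised geometric mean of \<open>fh\<close> and \<open>g\<close> is itself a
  competitor of the estimator. Its likelihood, the average of the two minus ln \<rho>, cannot exceed
  that of \<open>fh\<close>, so the affinity is controlled by how far the likelihood of
  \<open>fh\<close> exceeds that of \<open>g\<close>.\<close>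

lemma mle_affinity:
  assumes mle: "is_log_concave_mle n x fh" and n: "0 < n"
    and g: "log_concave_density g" "\<And>i. i < n \<Longrightarrow> 0 < g (x i)"
    and \<rho>: "0 < \<rho>" "\<rho> = (LINT x|lebesgue. sqrt (fh x * g x))"
  shows "- ln \<rho> \<le> (sample_mean n x (\<lambda>y. ln (fh y)) - sample_mean n x (\<lambda>y. ln (g y))) / 2"
proof -
  have f: "log_concave_density fh" and fpos: "\<And>i. i < n \<Longrightarrow> 0 < fh (x i)"
    using mle_sample_mean(1,2)[OF mle n g] by blast+
  define h where "h = (\<lambda>y. sqrt (fh y * g y) / \<rho>)"
  have h: "log_concave_density h" unfolding h_def \<rho>(2)
    by (rule log_concave_density_sqrt_mult[OF f g(1) \<rho>(1)[unfolded \<rho>(2)]])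
  have hpos: "0 < h (x i)" if "i < n" for i
    unfolding h_def using fpos[OF that] g(2)[OF that] \<rho>(1) by simp
  have ln_eq: "ln (sqrt (a * b) / \<rho>) = (ln a + ln b) / 2 - ln \<rho>" if "0 < a" "0 < b" for a b
    using that \<rho>(1) by (simp add: ln_div ln_sqrt ln_mult)
  have "sample_mean n x (\<lambda>y. ln (h y)) = (\<Sum>i<n. (ln (fh (x i)) + ln (g (x i))) / 2 - ln \<rho>) / n"
    unfolding sample_mean_def h_def
    by (intro arg_cong2[where f = "(/)"] sum.cong refl ln_eq) (use fpos g(2) in auto)
  also have "\<dots> = (sample_mean n x (\<lambda>y. ln (fh y)) + sample_mean n x (\<lambda>y. ln (g y))) / 2 - ln \<rho>"
    using n by (simp add: sample_mean_def sum_subtractf sum.distrib sum_divide_distrib[symmetric] field_simps)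
  finally have eq: "sample_mean n x (\<lambda>y. ln (h y)) = \<dots>" .
  have "sample_mean n x (\<lambda>y. ln (h y)) \<le> sample_mean n x (\<lambda>y. ln (fh y))"
    using mle_sample_mean(3)[OF mle n h hpos] by blast
  moreover have "- l \<le> (A - B) / 2" if "S = (A + B) / 2 - l" "S \<le> A" for S A B l :: real
    using that by (simp add: field_simps)
  ultimately show ?thesis using eq by blast
qed

context kl_projection
begin

text \<open>Fatou is applied to the nonnegative functions M - ln (f k). The finite bound also yields
  admissibility: where the limit vanishes these functions tend to \<infinity>, which can happen only
  on a null set of \<open>Q\<close>.\<close>

lemma loglik_ge_of_tendsto:
  assumes f: "\<And>k. admissible (f k)" "\<And>k x. f k x \<le> exp M"
    and lim: "(\<lambda>k. loglik (f k)) \<longlonglongrightarrow> s"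
    and g: "prob_density g" "AE x in Q. (\<lambda>k. f k x) \<longlonglongrightarrow> g x"
  shows "admissible g" "s \<le> loglik g"
proof -
  note [measurable] = prob_densityD(1)[OF g(1)]
  have fpd: "prob_density (f k)" and fpos: "AE x in Q. 0 < f k x" and fint: "integrable Q (\<lambda>x. ln (f k x))" for k
    using f(1)[of k] by (auto simp: admissible_def)
  note [measurable] = prob_densityD(1)[OF fpd]
  define w where "w = (\<lambda>k x. ennreal (M - ln (f k x)))"
  have wm[measurable]: "w k \<in> borel_measurable Q" for k unfolding w_def by measurable
  have wint: "(\<integral>\<^sup>+x. w k x \<partial>Q) = ennreal (M - loglik (f k))" for k
  proof -
    have "(\<integral>\<^sup>+x. w k x \<partial>Q) = ennreal (LINT x|Q. M - ln (f k x))"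
      unfolding w_def
    proof (rule nn_integral_eq_integral)
      show "integrable Q (\<lambda>x. M - ln (f k x))" using fint by auto
      show "AE x in Q. 0 \<le> M - ln (f k x)"
        using fpos[of k] by eventually_elim (use f(2) ln_mono[of _ "exp M"] in force)
    qed
    also have "(LINT x|Q. M - ln (f k x)) = M - loglik (f k)"
      unfolding loglik_def using fint[of k] Q.prob_space by simp
    finally show ?thesis .
  qed
  have "(\<integral>\<^sup>+x. liminf (\<lambda>k. w k x) \<partial>Q) \<le> liminf (\<lambda>k. \<integral>\<^sup>+x. w k x \<partial>Q)"
    by (rule nn_integral_liminf) measurable
  also have "\<dots> = ennreal (M - s)"
    unfolding wint by (intro lim_imp_Liminf tendsto_ennrealI tendsto_intros lim) simp
  finally have le: "(\<integral>\<^sup>+x. liminf (\<lambda>k. w k x) \<partial>Q) \<le> ennreal (M - s)" .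
  then have "(\<integral>\<^sup>+x. liminf (\<lambda>k. w k x) \<partial>Q) \<noteq> \<infinity>" by (auto simp: top_unique)
  then have fin: "AE x in Q. liminf (\<lambda>k. w k x) \<noteq> \<infinity>"
    by (intro nn_integral_noteq_infinite) measurable
  have allpos: "AE x in Q. \<forall>k. 0 < f k x" unfolding AE_all_countable using fpos by blast
  have gpos: "AE x in Q. 0 < g x \<and> liminf (\<lambda>k. w k x) = ennreal (M - ln (g x))"
    using fin allpos g(2)
  proof eventually_elim
    case (elim x)
    have "0 < g x"
    proof (rule ccontr)
      assume "\<not> 0 < g x"
      then have "g x = 0" using prob_densityD(2)[OF g(1), of x] by simp
      then have "filterlim (\<lambda>k. f k x) (at_right 0) sequentially"
        using elim by (intro tendsto_imp_filterlim_at_right) auto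
      then have "filterlim (\<lambda>k. ln (f k x)) at_bot sequentially"
        by (rule filterlim_compose[OF ln_at_0])
      then have "filterlim (\<lambda>k. M + - ln (f k x)) at_top sequentially"
        by (intro filterlim_tendsto_add_at_top[OF tendsto_const]) (simp add: filterlim_uminus_at_bot[symmetric])
      then have "(\<lambda>k. w k x) \<longlonglongrightarrow> \<top>"
        unfolding w_def by (intro ennreal_tendsto_top_eq_at_top[THEN iffD2]) simp
      then have "liminf (\<lambda>k. w k x) = \<top>" by (intro lim_imp_Liminf) auto
      with elim show False by simp
    qed
    moreover from this have "(\<lambda>k. w k x) \<longlonglongrightarrow> ennreal (M - ln (g x))"
      unfolding w_def using elim by (intro tendsto_ennrealI tendsto_intros) auto
    then have "liminf (\<lambda>k. w k x) = ennreal (M - ln (g x))" by (intro lim_imp_Liminf) auto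
    ultimately show ?case by blast
  qed
  have gM: "AE x in Q. 0 \<le> M - ln (g x)"
    using g(2) gpos
  proof eventually_elim
    case (elim x)
    then have "g x \<le> exp M" using f(2) by (intro LIMSEQ_le_const2[OF elim(1)]) auto
    then show ?case using elim ln_mono[of "g x" "exp M"] by simp
  qed
  have le': "(\<integral>\<^sup>+x. ennreal (M - ln (g x)) \<partial>Q) \<le> ennreal (M - s)"
    using le nn_integral_cong_AE[of "\<lambda>x. liminf (\<lambda>k. w k x)" "\<lambda>x. ennreal (M - ln (g x))" Q] gpos by auto
  have int: "integrable Q (\<lambda>x. M - ln (g x))"
    by (rule integrableI_nonneg) (use gM le_less_trans[OF le' ennreal_less_top] in auto)
  then have "integrable Q (\<lambda>x. M - (M - ln (g x)))" by (rule Bochner_Integration.integrable_diff[rotated]) simp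
  then have intg: "integrable Q (\<lambda>x. ln (g x))" by simp
  with gpos g(1) show "admissible g" by (auto simp: admissible_def)
  have "ennreal (LINT x|Q. M - ln (g x)) \<le> ennreal (M - s)"
    using le' nn_integral_eq_integral[OF int gM] by simp
  moreover have "(LINT x|Q. M - ln (g x)) = M - loglik g"
    unfolding loglik_def using intg Q.prob_space by simp
  moreover have "0 \<le> M - s"
  proof -
    have "loglik (f k) \<le> (LINT x|Q. M)" for k
      unfolding loglik_def
    proof (rule integral_mono_AE[OF fint])
      show "AE x in Q. ln (f k x) \<le> M"
        using fpos[of k] by eventually_elim (use f(2) ln_mono[of _ "exp M"] in force)
    qed simp
    then have "loglik (f k) \<le> M" for k using Q.prob_space by simp
    then show ?thesis using LIMSEQ_le_const2[OF lim, of M] by auto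
  qed
  ultimately show "s \<le> loglik g" by (simp add: ennreal_le_iff)
qed

lemma kl_minimiser_exists: "\<exists>f. kl_minimiser f0 f"
proof -
  define S where "S = {loglik g | g. log_concave_density g \<and> admissible g}"
  have S: "bdd_above S" "S \<noteq> {}"
    unfolding S_def using loglik_le ex_admissible by (auto intro!: bdd_aboveI[of _ "loglik f0 + 1"])
  define s where "s = Sup S"
  have s: "loglik h \<le> s" if "log_concave_density h" "admissible h" for h
    unfolding s_def by (rule cSup_upper[OF _ S(1)]) (use that in \<open>auto simp: S_def\<close>)
  have "\<exists>g. log_concave_density g \<and> admissible g \<and> s - (1 / 4) ^ k < loglik g" for k :: nat
  proof -
    have "s - (1 / 4) ^ k < Sup S" by (simp add: s_def)
    then show ?thesis using less_cSup_iff[OF S(2,1)] by (auto simp: S_def)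
  qed
  then obtain f where f: "\<And>k. log_concave_density (f k)" "\<And>k. admissible (f k)" "\<And>k::nat. s - (1 / 4) ^ k < loglik (f k)"
    by metis
  note fd = prob_densityD[OF log_concave_densityD(1)[OF f(1)]]
  have [measurable]: "f k \<in> borel_measurable lebesgue" for k by (rule fd(1))
  \<comment> \<open>With e = (1/4)^k and \<delta> = (1/2)^k both terms of the L1 bound are
    geometric, so successive distances are summable and the sequence converges almost everywhere
    without passing to a subsequence.\<close>
  have D: "(LINT x|lebesgue. \<bar>f k x - f (Suc k) x\<bar>) \<le> 3 * (1 / 2) ^ k" for k
  proof -
    have "(1 / 4 :: real) ^ Suc k \<le> (1 / 4) ^ k" by simp
    then have "s - (1 / 4) ^ k \<le> loglik (f (Suc k))" using f(3)[of "Suc k"] by linarith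
    then have "(LINT x|lebesgue. \<bar>f k x - f (Suc k) x\<bar>) \<le> (1 / 4) ^ k / (1 / 2) ^ k + 2 * (1 / 2) ^ k"
      using f(3)[of k]
      by (intro L1_dist_near_maximisers[OF f(1,2) f(1,2) s]) auto
    also have "(1 / 4 :: real) ^ k / (1 / 2) ^ k = (1 / 2) ^ k" by (simp add: power_divide[symmetric])
    finally show ?thesis by simp
  qed
  have "(\<integral>\<^sup>+x. (\<Sum>k. ennreal \<bar>f k x - f (Suc k) x\<bar>) \<partial>lebesgue) = (\<Sum>k. \<integral>\<^sup>+x. ennreal \<bar>f k x - f (Suc k) x\<bar> \<partial>lebesgue)"
    by (rule nn_integral_suminf) measurable
  also have "\<dots> \<le> (\<Sum>k. ennreal (3 * (1 / 2) ^ k))"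
  proof (rule suminf_le)
    show "(\<integral>\<^sup>+x. ennreal \<bar>f k x - f (Suc k) x\<bar> \<partial>lebesgue) \<le> ennreal (3 * (1 / 2) ^ k)" for k
      using D[of k] fd(3) by (subst nn_integral_eq_integral) (auto intro!: ennreal_leI)
  qed auto
  also have "\<dots> = ennreal (\<Sum>k. 3 * (1 / 2) ^ k)"
    by (rule suminf_ennreal_eq[OF _ summable_sums]) (auto intro!: summable_mult summable_geometric)
  also have "\<dots> < \<infinity>" by simp
  finally have fin: "(\<integral>\<^sup>+x. (\<Sum>k. ennreal \<bar>f k x - f (Suc k) x\<bar>) \<partial>lebesgue) \<noteq> \<infinity>" by simp
  have "AE x in lebesgue. (\<Sum>k. ennreal \<bar>f k x - f (Suc k) x\<bar>) \<noteq> \<infinity>"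
    by (rule nn_integral_noteq_infinite[OF _ fin]) measurable
  then have conv: "AE x in lebesgue. convergent (\<lambda>k. f k x)"
  proof eventually_elim
    case (elim x)
    then have "summable (\<lambda>k. \<bar>f k x - f (Suc k) x\<bar>)" by (intro summable_suminf_not_top) auto
    then have "summable (\<lambda>k. f k x - f (Suc k) x)" by (rule summable_rabs_cancel)
    then have "convergent (\<lambda>n. \<Sum>k<n. f k x - f (Suc k) x)" by (simp add: summable_iff_convergent)
    then have "convergent (\<lambda>n. f 0 x - f n x)" using sum_lessThan_telescope'[of "\<lambda>k. f k x"] by simp
    then obtain c where "(\<lambda>n. f 0 x - f n x) \<longlonglongrightarrow> c" by (auto simp: convergent_def)
    then have "(\<lambda>n. f 0 x - (f 0 x - f n x)) \<longlonglongrightarrow> f 0 x - c" by (intro tendsto_intros)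
    then show ?case by (auto simp: convergent_def)
  qed
  obtain z r M K where MK: "0 < r" "0 \<le> M" "0 \<le> K"
    "\<And>f. log_concave_density f \<Longrightarrow> admissible f \<Longrightarrow> s - 1 \<le> loglik f \<Longrightarrow>
      (\<forall>x. f x \<le> exp M) \<and> (\<forall>y\<in>ball z r. exp (- K) \<le> f y)"
    by (rule loglik_class_bounds[of "s - 1"]) blast
  \<comment> \<open>Since (1/4)^k \<le> 1, every member of the sequence lies in the class of level s
    - 1; one exponential bound then dominates them all, and no mass is lost in the limit.\<close>
  have "s - 1 \<le> loglik (f k)" for k
    using f(3)[of k] power_le_one[of "1/4::real" k] by simp
  then have bd: "f k x \<le> exp M" and ball: "y \<in> ball z r \<Longrightarrow> exp (- K) \<le> f k y" for k x y
    using MK(4)[OF f(1,2), of k] by auto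
  obtain a b where ab: "0 < a" "\<And>f (z::'a) x. log_concave_density f \<Longrightarrow> (\<And>x. f x \<le> exp M) \<Longrightarrow>
      (\<And>y. y \<in> ball z r \<Longrightarrow> exp (- K) \<le> f y) \<Longrightarrow> f x \<le> exp (- a * norm (x - z) + b)"
    by (rule log_concave_density_class_tail[OF MK(1-3)]) blast
  have tail: "f k x \<le> exp (- a * norm (x - z) + b)" for k x
    by (rule ab(2)[OF f(1) bd ball])
  define g where "g = (\<lambda>x. enn2real (liminf (\<lambda>k. ennreal (f k x))))"
  have gm[measurable]: "g \<in> borel_measurable lebesgue" unfolding g_def by measurable
  have glim: "AE x in lebesgue. (\<lambda>k. f k x) \<longlonglongrightarrow> g x"
    using conv
  proof eventually_elim
    case (elim x)
    then obtain c where c: "(\<lambda>k. f k x) \<longlonglongrightarrow> c" by (auto simp: convergent_def)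
    then have "0 \<le> c" by (rule LIMSEQ_le_const) (use fd(2) in auto)
    have "(\<lambda>k. ennreal (f k x)) \<longlonglongrightarrow> ennreal c" using c by (rule tendsto_ennrealI)
    then have "liminf (\<lambda>k. ennreal (f k x)) = ennreal c" by (intro lim_imp_Liminf) auto
    then have "g x = c" using \<open>0 \<le> c\<close> by (simp add: g_def)
    with c show ?case by simp
  qed
  have dom: "integrable lebesgue (\<lambda>x. exp b * exp (- a * norm (x - z)))"
    using integrable_exp_norm[OF ab(1)] by auto
  have domle: "AE x in lebesgue. norm (f k x) \<le> exp b * exp (- a * norm (x - z))" for k
    using tail[of k] fd(2)[of k] by (intro AE_I2) (simp add: exp_add[symmetric] add.commute)
  have gi: "integrable lebesgue g"
    by (rule integrable_dominated_convergence[OF gm _ dom glim domle]) measurable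
  have "(\<lambda>k. integral\<^sup>L lebesgue (f k)) \<longlonglongrightarrow> integral\<^sup>L lebesgue g"
    by (rule integral_dominated_convergence[OF gm _ dom glim domle]) measurable
  then have "integral\<^sup>L lebesgue g = 1" using fd(4) by (simp add: LIMSEQ_const_iff)
  moreover have "(\<integral>\<^sup>+x. ennreal (g x) \<partial>lebesgue) = ennreal (integral\<^sup>L lebesgue g)"
    by (rule nn_integral_eq_integral[OF gi]) (simp add: g_def)
  ultimately have gpd: "prob_density g" using gm by (simp add: prob_density_def g_def)
  have glc: "log_concave_fun g"
    unfolding g_def by (rule log_concave_fun_liminf[OF log_concave_densityD(2)[OF f(1)] fd(2) bd])
  have lim: "(\<lambda>k. loglik (f k)) \<longlonglongrightarrow> s"
  proof (rule tendsto_sandwich)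
    show "\<forall>\<^sub>F k in sequentially. s - (1 / 4) ^ k \<le> loglik (f k)" by (intro always_eventually allI less_imp_le f(3))
    show "\<forall>\<^sub>F k in sequentially. loglik (f k) \<le> s" by (intro always_eventually allI s f(1,2))
    have "(\<lambda>k. s - (1 / 4) ^ k) \<longlonglongrightarrow> s - 0" by (intro tendsto_intros LIMSEQ_realpow_zero) auto
    then show "(\<lambda>k. s - (1 / 4) ^ k) \<longlonglongrightarrow> s" by simp
  qed simp
  note gopt = loglik_ge_of_tendsto[OF f(2) bd lim gpd AE_Q_I[OF glim]]
  have "loglik h \<le> loglik g" if "log_concave_density h" "admissible h" for h
    using s[OF that] gopt(2) by linarith
  then have "kl_minimiser f0 g"
    using gopt(1) gpd glc by (auto simp: kl_minimiser_iff log_concave_density_def)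
  then show ?thesis by blast
qed

text \<open>Simple functions \<open>p k\<close> approximate the identity. For Lipschitz
  \<open>g\<close>, the composition of \<open>g\<close> with \<open>p k\<close> is a finite
  combination of indicators and differs from \<open>g\<close> by at most L times \<open>w k\<close>,
  whose mean under \<open>Q\<close> tends to 0. The indicators and the \<open>w k\<close> are
  countably many and do not depend on g, L, z or B, which allows a single null set later.\<close>

lemma lipschitz_uniform_lln:
  obtains \<H> :: "('a \<Rightarrow> real) set" where "countable \<H>"
    "\<And>h. h \<in> \<H> \<Longrightarrow> h \<in> borel_measurable lebesgue \<and> integrable Q h"
    "\<And>x z L B e. (\<And>h. h \<in> \<H> \<Longrightarrow> (\<lambda>n. sample_mean n x h) \<longlonglongrightarrow> integral\<^sup>L Q h) \<Longrightarrow> 0 \<le> L \<Longrightarrow> 0 < e \<Longrightarrow>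
      \<forall>\<^sub>F n in sequentially. \<forall>g. (\<forall>y w. \<bar>g y - g w\<bar> \<le> L * norm (y - w)) \<longrightarrow> \<bar>g z\<bar> \<le> B \<longrightarrow>
        \<bar>sample_mean n x g - integral\<^sup>L Q g\<bar> \<le> e"
proof -
  obtain p where p: "\<And>k::nat. simple_function (borel :: 'a measure) (p k)"
    "\<And>y. (\<lambda>k. p k y) \<longlonglongrightarrow> y" "\<And>k y. norm (p k y) \<le> 2 * norm y"
    using borel_measurable_implies_sequence_metric[of "\<lambda>y::'a. y" borel 0] by auto
  have pm: "p k \<in> borel_measurable borel" for k
    using p(1)[of k] by (rule borel_measurable_simple_function)
  have fin: "finite (range (p k))" for k using simple_functionD(1)[OF p(1)[of k]] by simp
  define w where "w = (\<lambda>k y. norm (y - p k y))"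
  define ind where "ind = (\<lambda>k v. indicator (p k -` {v}) :: 'a \<Rightarrow> real)"
  define \<H> where "\<H> = range w \<union> (\<Union>k. ind k ` range (p k))"
  have "countable (ind k ` range (p k))" for k using fin by (simp add: countable_finite)
  then have count: "countable \<H>" unfolding \<H>_def by (intro countable_Un countable_UN) auto
  have wm: "w k \<in> borel_measurable lebesgue" for k
    unfolding w_def by (rule measurable_completion) (use pm[of k] in measurable)
  have w3: "norm (w k y) \<le> 3 * norm y" for k y
    using norm_triangle_ineq4[of y "p k y"] p(3)[of k y] by (simp add: w_def)
  have iw3: "integrable Q (\<lambda>y. 3 * norm y)" using integrable_norm_Q by simp
  have wi: "integrable Q (w k)" for k
    by (rule Bochner_Integration.integrable_bound[OF iw3]) (use wm w3 in auto)
  have sets: "p k -` {v} \<in> sets lebesgue" for k v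
    using measurable_sets_borel[OF pm[of k], of "{v}"] by auto
  have im: "ind k v \<in> borel_measurable lebesgue" for k v
    unfolding ind_def using sets by auto
  have ii: "integrable Q (ind k v)" for k v
    unfolding ind_def by (rule integrable_real_indicator) (use sets in \<open>auto simp: Q.emeasure_eq_measure\<close>)
  show ?thesis
  proof (rule that[OF count])
    show "h \<in> borel_measurable lebesgue \<and> integrable Q h" if "h \<in> \<H>" for h
      using that wm wi im ii by (auto simp: \<H>_def)
    fix x :: "nat \<Rightarrow> 'a" and z :: 'a and L B e :: real
    assume lln: "\<And>h. h \<in> \<H> \<Longrightarrow> (\<lambda>n. sample_mean n x h) \<longlonglongrightarrow> integral\<^sup>L Q h" and L: "0 \<le> L" and e: "0 < e"
    have "(\<lambda>k. integral\<^sup>L Q (w k)) \<longlonglongrightarrow> (LINT y|Q. 0)"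
    proof (rule integral_dominated_convergence[OF _ _ iw3])
      show "AE y in Q. (\<lambda>k. w k y) \<longlonglongrightarrow> 0"
      proof (rule AE_I2)
        fix y
        have "(\<lambda>k. norm (y - p k y)) \<longlonglongrightarrow> norm (y - y)" by (intro tendsto_intros p(2))
        then show "(\<lambda>k. w k y) \<longlonglongrightarrow> 0" by (simp add: w_def)
      qed
    qed (use wm w3 in auto)
    then have "(\<lambda>k. L * integral\<^sup>L Q (w k)) \<longlonglongrightarrow> L * 0" by (intro tendsto_intros) simp
    then have "\<forall>\<^sub>F k in sequentially. L * integral\<^sup>L Q (w k) < e / 4"
      using e by (intro order_tendstoD(2)) auto
    then obtain k where k: "L * integral\<^sup>L Q (w k) < e / 4"
      using eventually_happens trivial_limit_sequentially by blast
    define V where "V = range (p k)"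
    have V: "finite V" unfolding V_def by (rule fin)
    \<comment> \<open>G bounds every \<open>g\<close> of the class on the finite set
      \<open>V\<close>, through its value at \<open>z\<close> and the Lipschitz condition; hence the
      errors of the indicator frequencies enter uniformly in \<open>g\<close>.\<close>
    define G where "G = B + L * (\<Sum>v\<in>V. norm (v - z))"
    define D where "D = (\<lambda>n. \<Sum>v\<in>V. \<bar>sample_mean n x (ind k v) - integral\<^sup>L Q (ind k v)\<bar>)"
    have "(\<lambda>n. L * sample_mean n x (w k)) \<longlonglongrightarrow> L * integral\<^sup>L Q (w k)"
      by (intro tendsto_intros lln) (auto simp: \<H>_def)
    then have ev1: "\<forall>\<^sub>F n in sequentially. L * sample_mean n x (w k) < e / 4"
      using k by (rule order_tendstoD(2))
    have "(\<lambda>n. G * D n) \<longlonglongrightarrow> G * (\<Sum>v\<in>V. \<bar>integral\<^sup>L Q (ind k v) - integral\<^sup>L Q (ind k v)\<bar>)"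
      unfolding D_def by (intro tendsto_intros lln) (auto simp: \<H>_def V_def)
    then have ev2: "\<forall>\<^sub>F n in sequentially. G * D n < e / 4"
      using e by (intro order_tendstoD(2)) auto
    show "\<forall>\<^sub>F n in sequentially. \<forall>g. (\<forall>y w. \<bar>g y - g w\<bar> \<le> L * norm (y - w)) \<longrightarrow> \<bar>g z\<bar> \<le> B \<longrightarrow>
        \<bar>sample_mean n x g - integral\<^sup>L Q g\<bar> \<le> e"
      using ev1 ev2
    proof eventually_elim
      case (elim n)
      show ?case
      proof (intro allI impI)
        fix g :: "'a \<Rightarrow> real"
        assume lip: "\<forall>y w. \<bar>g y - g w\<bar> \<le> L * norm (y - w)" and gz: "\<bar>g z\<bar> \<le> B"
        have "L-lipschitz_on UNIV g" by (rule lipschitz_onI) (use lip L in \<open>auto simp: dist_norm\<close>)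
        then have "continuous_on UNIV g" by (rule lipschitz_on_continuous_on)
        then have gm: "g \<in> borel_measurable lebesgue"
          by (intro measurable_completion) (simp add: borel_measurable_continuous_onI)
        have gi: "integrable Q g" by (rule integrable_Q_lipschitz[OF _ gm]) (use lip in auto)
        have gp: "g (p k y) = (\<Sum>v\<in>V. g v * ind k v y)" for y
        proof -
          have "(\<Sum>v\<in>V. g v * ind k v y) = (\<Sum>v\<in>{p k y}. g v * ind k v y)"
            by (rule sum.mono_neutral_right[OF V]) (auto simp: V_def ind_def)
          then show ?thesis by (simp add: ind_def)
        qed
        have gpi: "integrable Q (\<lambda>y. g (p k y))" unfolding gp using ii by auto
        have near: "\<bar>g y - g (p k y)\<bar> \<le> L * w k y" for y using lip by (simp add: w_def)
        have GV: "\<bar>g v\<bar> \<le> G" if "v \<in> V" for v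
        proof -
          have "\<bar>g v\<bar> \<le> \<bar>g z\<bar> + \<bar>g v - g z\<bar>" by linarith
          also have "\<dots> \<le> B + L * norm (v - z)" using gz lip by (intro add_mono) auto
          also have "\<dots> \<le> G" unfolding G_def using L V that by (intro add_mono mult_left_mono member_le_sum) auto
          finally show ?thesis .
        qed
        have "\<bar>sample_mean n x g - sample_mean n x (\<lambda>y. g (p k y))\<bar> = \<bar>\<Sum>i<n. g (x i) - g (p k (x i))\<bar> / n"
          by (simp add: sample_mean_def sum_subtractf diff_divide_distrib[symmetric] abs_divide)
        also have "\<dots> \<le> (\<Sum>i<n. L * w k (x i)) / n"
          by (intro divide_right_mono order_trans[OF sum_abs] sum_mono near) auto
        also have "\<dots> = L * sample_mean n x (w k)" by (simp add: sample_mean_def sum_distrib_left)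
        finally have a1: "\<bar>sample_mean n x g - sample_mean n x (\<lambda>y. g (p k y))\<bar> < e / 4" using elim by linarith
        have "\<bar>integral\<^sup>L Q g - (LINT y|Q. g (p k y))\<bar> = \<bar>LINT y|Q. g y - g (p k y)\<bar>"
          using gi gpi by simp
        also have "\<dots> \<le> (LINT y|Q. \<bar>g y - g (p k y)\<bar>)" by (rule integral_abs_bound)
        also have "\<dots> \<le> (LINT y|Q. L * w k y)"
          using gi gpi wi near by (intro integral_mono) auto
        also have "\<dots> = L * integral\<^sup>L Q (w k)" by simp
        finally have a2: "\<bar>integral\<^sup>L Q g - (LINT y|Q. g (p k y))\<bar> < e / 4" using k by linarith
        have "sample_mean n x (\<lambda>y. g (p k y)) = (\<Sum>v\<in>V. g v * sample_mean n x (ind k v))"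
          unfolding sample_mean_def gp by (subst sum.swap) (simp add: sum_distrib_left sum_divide_distrib)
        moreover have "(LINT y|Q. g (p k y)) = (\<Sum>v\<in>V. g v * integral\<^sup>L Q (ind k v))"
          unfolding gp using ii by (subst Bochner_Integration.integral_sum) auto
        ultimately have "\<bar>sample_mean n x (\<lambda>y. g (p k y)) - (LINT y|Q. g (p k y))\<bar> =
            \<bar>\<Sum>v\<in>V. g v * (sample_mean n x (ind k v) - integral\<^sup>L Q (ind k v))\<bar>"
          by (simp add: sum_subtractf right_diff_distrib)
        also have "\<dots> \<le> (\<Sum>v\<in>V. G * \<bar>sample_mean n x (ind k v) - integral\<^sup>L Q (ind k v)\<bar>)"
          by (intro order_trans[OF sum_abs] sum_mono) (auto simp: abs_mult intro!: mult_right_mono GV)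
        also have "\<dots> = G * D n" by (simp add: D_def sum_distrib_left)
        finally have "\<bar>sample_mean n x (\<lambda>y. g (p k y)) - (LINT y|Q. g (p k y))\<bar> < e / 4" using elim by linarith
        with a1 a2 show "\<bar>sample_mean n x g - integral\<^sup>L Q g\<bar> \<le> e" by linarith
      qed
    qed
  qed
qed


text \<open>Analysis is separated from probability by arguing along any sequence \<open>x\<close>
  for which the averages of a countable family converge. The family contains ln fs, the Lipschitz
  test functions, and the indicators of the test balls that give the class bounds.\<close>

lemma mle_L1_convergence:
  assumes fs: "kl_minimiser f0 fs"
  obtains \<H> z r M K where "countable \<H>"
    "\<And>h. h \<in> \<H> \<Longrightarrow> h \<in> borel_measurable lebesgue \<and> integrable Q h"
    "\<And>x fh N. (\<And>h. h \<in> \<H> \<Longrightarrow> (\<lambda>n. sample_mean n x h) \<longlonglongrightarrow> integral\<^sup>L Q h) \<Longrightarrow>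
      (\<And>i. 0 < fs (x i)) \<Longrightarrow> (\<And>n. N \<le> n \<Longrightarrow> is_log_concave_mle n x (fh n)) \<Longrightarrow>
      log_concave_L1_limit fh fs z r M K"
proof -
  have lc: "log_concave_density fs" and adm: "admissible fs"
    and max: "\<And>h. log_concave_density h \<Longrightarrow> admissible h \<Longrightarrow> loglik h \<le> loglik fs"
    using fs by (auto simp: kl_minimiser_iff)
  note fspd = log_concave_densityD(1)[OF lc]
  obtain z r X \<epsilon> c where s: "0 < r" "0 < \<epsilon>" "finite X" "0 < c" "c \<le> 1"
    "\<And>x. x \<in> X \<Longrightarrow> c < measure Q (ball x \<epsilon>)" "0 < measure Q (ball z r)"
    "\<And>C. convex C \<Longrightarrow> \<not> ball z r \<subseteq> C \<Longrightarrow> \<exists>x\<in>X. ball x \<epsilon> \<inter> C = {}"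
    by (rule support_constants) blast
  obtain M K where MK: "0 \<le> M" "0 \<le> K"
    "\<And>f (z::'a). log_concave_density f \<Longrightarrow>
      (\<And>M q. q \<le> M \<Longrightarrow> (\<And>x. f x \<le> exp M) \<Longrightarrow> \<not> ball z r \<subseteq> {y. exp q \<le> f y} \<Longrightarrow> loglik fs - 1 \<le> M - (M - q) * c) \<Longrightarrow>
      (\<forall>x. f x \<le> exp M) \<and> (\<forall>y\<in>ball z r. exp (- K) \<le> f y)"
    by (rule log_concave_density_class_bounds[OF s(4,5,1)]) blast
  obtain \<H>1 :: "('a \<Rightarrow> real) set" where H1: "countable \<H>1"
    "\<And>h. h \<in> \<H>1 \<Longrightarrow> h \<in> borel_measurable lebesgue \<and> integrable Q h"
    "\<And>x z L B e. (\<And>h. h \<in> \<H>1 \<Longrightarrow> (\<lambda>n. sample_mean n x h) \<longlonglongrightarrow> integral\<^sup>L Q h) \<Longrightarrow> 0 \<le> L \<Longrightarrow> 0 < e \<Longrightarrow>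
      \<forall>\<^sub>F n in sequentially. \<forall>g. (\<forall>y w. \<bar>g y - g w\<bar> \<le> L * norm (y - w)) \<longrightarrow> \<bar>g z\<bar> \<le> B \<longrightarrow>
        \<bar>sample_mean n x g - integral\<^sup>L Q g\<bar> \<le> e"
    by (rule lipschitz_uniform_lln) blast
  define \<H> where "\<H> = insert (\<lambda>y. ln (fs y)) (\<H>1 \<union> (\<lambda>v. indicator (ball v \<epsilon>)) ` X)"
  show ?thesis
  proof (rule that[of \<H> z r M K])
    show "countable \<H>" unfolding \<H>_def using H1(1) s(3) by (simp add: countable_finite)
    show "h \<in> borel_measurable lebesgue \<and> integrable Q h" if "h \<in> \<H>" for h
      using that H1(2) adm prob_densityD(1)[OF fspd]
      by (auto simp: \<H>_def admissible_def Q.emeasure_eq_measure intro!: integrable_real_indicator borel_measurable_indicator)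
    fix x :: "nat \<Rightarrow> 'a" and fh N
    assume lln: "\<And>h. h \<in> \<H> \<Longrightarrow> (\<lambda>n. sample_mean n x h) \<longlonglongrightarrow> integral\<^sup>L Q h"
      and xpos: "\<And>i. 0 < fs (x i)" and mle: "\<And>n. N \<le> n \<Longrightarrow> is_log_concave_mle n x (fh n)"
    have lln_fs: "(\<lambda>n. sample_mean n x (\<lambda>y. ln (fs y))) \<longlonglongrightarrow> loglik fs"
      unfolding loglik_def by (rule lln) (simp add: \<H>_def)
    have evN: "\<forall>\<^sub>F n in sequentially. N \<le> n \<and> 0 < n"
      by (intro eventually_conj eventually_ge_at_top eventually_gt_at_top)
    have evball: "\<forall>\<^sub>F n in sequentially. \<forall>v\<in>X. c < sample_mean n x (indicator (ball v \<epsilon>))"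
    proof (rule eventually_ball_finite[OF s(3)], rule ballI)
      fix v assume v: "v \<in> X"
      have "(\<lambda>n. sample_mean n x (indicator (ball v \<epsilon>))) \<longlonglongrightarrow> integral\<^sup>L Q (indicator (ball v \<epsilon>))"
        using v by (intro lln) (simp add: \<H>_def)
      then show "\<forall>\<^sub>F n in sequentially. c < sample_mean n x (indicator (ball v \<epsilon>))"
        by (rule order_tendstoD(1)) (use s(6)[OF v] in simp)
    qed
    have "\<forall>\<^sub>F n in sequentially. loglik fs - 1 < sample_mean n x (\<lambda>y. ln (fs y))"
      by (rule order_tendstoD(1)[OF lln_fs]) simp
    with evball evN have cls: "\<forall>\<^sub>F n in sequentially. log_concave_density (fh n) \<and>
      (\<forall>y. fh n y \<le> exp M) \<and> (\<forall>y\<in>ball z r. exp (- K) \<le> fh n y)"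
    proof eventually_elim
      case (elim n)
      note m = mle_sample_mean[OF mle _ lc xpos, of n]
      have f: "log_concave_density (fh n)" using m(1) elim by simp
      have "(\<forall>y. fh n y \<le> exp M) \<and> (\<forall>y\<in>ball z r. exp (- K) \<le> fh n y)"
      proof (rule MK(3)[OF f])
        fix M q assume q: "q \<le> M" and bd: "\<And>y. fh n y \<le> exp M" and nb: "\<not> ball z r \<subseteq> {y. exp q \<le> fh n y}"
        obtain v where v: "v \<in> X" "ball v \<epsilon> \<inter> {y. exp q \<le> fh n y} = {}"
          using s(8)[OF convex_superlevel[OF log_concave_densityD(2)[OF f]] nb] by auto
        have "loglik fs - 1 \<le> sample_mean n x (\<lambda>y. ln (fh n y))" using elim m(3) by linarith
        also have "\<dots> \<le> sample_mean n x (\<lambda>y. M - (M - q) * indicator (ball v \<epsilon>) y)"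
          by (rule sample_mean_mono, rule ln_le_of_level_miss[OF bd v(2)]) (use m(2) elim in auto)
        also have "\<dots> = M - (M - q) * sample_mean n x (indicator (ball v \<epsilon>))"
          using elim by (simp add: sample_mean_def sum_subtractf sum_distrib_left[symmetric] diff_divide_distrib)
        also have "\<dots> \<le> M - (M - q) * c"
          using q elim v by (intro diff_left_mono mult_left_mono) (auto intro: less_imp_le)
        finally show "loglik fs - 1 \<le> M - (M - q) * c" .
      qed
      with f show ?case by blast
    qed
    \<comment> \<open>Half of e pays for the uniform law of large numbers, the other half for ln I
      \<le> e / 2, the cost of normalising the sup-convolution. The normalised function is an
      admissible competitor of \<open>fs\<close>, so its likelihood under \<open>Q\<close> is at
      most \<open>loglik fs\<close>.\<close>
    have up: "\<forall>\<^sub>F n in sequentially. sample_mean n x (\<lambda>y. ln (fh n y)) \<le> loglik fs + e" if e: "0 < e" for e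
    proof -
      have e2: "0 < e / 2" using e by simp
      obtain L where L: "0 < L" "\<And>f. log_concave_density f \<Longrightarrow> (\<And>x. f x \<le> exp M) \<Longrightarrow> (\<And>y. y \<in> ball z r \<Longrightarrow> exp (- K) \<le> f y) \<Longrightarrow>
        (\<integral>\<^sup>+x. ennreal (sup_conv L f x) \<partial>lebesgue) \<le> ennreal (1 + e / 2)"
        by (rule sup_conv_integral_class[OF s(1) MK(1,2) e2]) blast
      have "\<forall>\<^sub>F n in sequentially. \<forall>g. (\<forall>y w. \<bar>g y - g w\<bar> \<le> L * norm (y - w)) \<longrightarrow> \<bar>g z\<bar> \<le> M + K \<longrightarrow>
        \<bar>sample_mean n x g - integral\<^sup>L Q g\<bar> \<le> e / 2"
        by (rule H1(3)) (use L e lln in \<open>auto simp: \<H>_def\<close>)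
      with cls evN show ?thesis
      proof eventually_elim
        case (elim n)
        have f: "log_concave_density (fh n)" and bd: "\<And>y. fh n y \<le> exp M" and ball: "\<And>y. y \<in> ball z r \<Longrightarrow> exp (- K) \<le> fh n y"
          using elim by auto
        note fn = prob_densityD(2)[OF log_concave_densityD(1)[OF f]]
        have finL: "(\<integral>\<^sup>+x. ennreal (sup_conv L (fh n) x) \<partial>lebesgue) \<le> ennreal (1 + e / 2)"
          by (rule L(2)[OF f bd ball])
        obtain I where I: "0 < I" "I \<le> 1 + e / 2" "log_concave_density (\<lambda>x. sup_conv L (fh n) x / I)"
          "\<And>x. 0 < sup_conv L (fh n) x" "\<And>x y. \<bar>ln (sup_conv L (fh n) x) - ln (sup_conv L (fh n) y)\<bar> \<le> L * norm (x - y)"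
          by (rule sup_conv_density[OF f bd L(1) finL]) (rule that)
        let ?g = "\<lambda>y. ln (sup_conv L (fh n) y)"
        have ge: "fh n y \<le> sup_conv L (fh n) y" for y
          by (rule sup_conv_ge[where B = "exp M"]) (use fn bd L in auto)
        have le: "sup_conv L (fh n) y \<le> exp M" for y
          by (rule sup_conv_le) (use fn bd L in auto)
        have "exp (- K) \<le> sup_conv L (fh n) z" using ball[of z] ge[of z] s(1) by simp
        then have "- K \<le> ?g z" using I(4) by (simp add: ln_ge_iff)
        moreover have "?g z \<le> M" using ln_mono[OF le I(4), of z] by simp
        ultimately have gz: "\<bar>?g z\<bar> \<le> M + K" using MK by simp
        have meas: "?g \<in> borel_measurable lebesgue"
        proof -
          have "(\<lambda>x. ln (sup_conv L (fh n) x / I * I)) \<in> borel_measurable lebesgue"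
            using prob_densityD(1)[OF log_concave_densityD(1)[OF I(3)]] by measurable
          then show ?thesis using I(1) by simp
        qed
        have ne: "sup_conv L (fh n) y \<noteq> 0" for y using I(4)[of y] by simp
        have gi: "integrable Q ?g" by (rule integrable_Q_lipschitz[OF I(5) meas])
        have "admissible (\<lambda>x. sup_conv L (fh n) x / I)"
          by (rule admissible_lipschitz[OF log_concave_densityD(1)[OF I(3)]]) (use I ne in \<open>auto simp: ln_div\<close>)
        from max[OF I(3) this] have "(LINT y|Q. ?g y - ln I) \<le> loglik fs"
          using I(1) ne by (simp add: loglik_def[of "\<lambda>x. sup_conv L (fh n) x / I"] ln_div)
        then have "integral\<^sup>L Q ?g \<le> loglik fs + ln I" using gi Q.prob_space by simp
        moreover have "ln I \<le> e / 2" using ln_le_minus_one[OF I(1)] I(2) by linarith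
        moreover have "\<bar>sample_mean n x ?g - integral\<^sup>L Q ?g\<bar> \<le> e / 2" by (rule elim(3)[rule_format, of ?g, OF I(5) gz])
        moreover have "sample_mean n x (\<lambda>y. ln (fh n y)) \<le> sample_mean n x ?g"
          by (rule sample_mean_mono) (use ge mle_sample_mean(2)[OF mle _ lc xpos, of n] elim in \<open>auto intro!: ln_mono\<close>)
        ultimately show ?case by linarith
      qed
    qed
    have "(\<lambda>n. LINT y|lebesgue. \<bar>fh n y - fs y\<bar>) \<longlonglongrightarrow> 0"
    proof (rule tendstoI)
      fix \<eta> :: real assume \<eta>: "0 < \<eta>"
      \<comment> \<open>With \<delta> = \<eta> / 4 this gives e / \<delta> + 2 \<delta> = \<eta> / 4
        + \<eta> / 2 < \<eta>.\<close>
      define e where "e = \<eta>\<^sup>2 / 16"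
      have e: "0 < e" using \<eta> by (simp add: e_def)
      have "\<forall>\<^sub>F n in sequentially. loglik fs - e < sample_mean n x (\<lambda>y. ln (fs y))"
        by (rule order_tendstoD(1)[OF lln_fs]) (use e in simp)
      with up[OF e] cls evN show "\<forall>\<^sub>F n in sequentially. dist (LINT y|lebesgue. \<bar>fh n y - fs y\<bar>) 0 < \<eta>"
      proof eventually_elim
        case (elim n)
        have f: "log_concave_density (fh n)" and ball: "\<And>y. y \<in> ball z r \<Longrightarrow> exp (- K) \<le> fh n y"
          using elim by auto
        note fpd = log_concave_densityD(1)[OF f]
        define \<rho> where "\<rho> = (LINT x|lebesgue. sqrt (fh n x * fs x))"
        have \<rho>: "0 < \<rho>"
          unfolding \<rho>_def
        proof (rule affinity_pos[OF fpd fspd _ s(7)])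
          have "AE y in Q. 0 < fs y" using adm by (simp add: admissible_def)
          then show "AE y in Q. y \<in> ball z r \<longrightarrow> 0 < fh n y \<and> 0 < fs y"
          proof eventually_elim
            case (elim y)
            then show ?case using ball[of y] by (meson exp_gt_zero less_le_trans)
          qed
        qed auto
        have "- ln \<rho> \<le> (sample_mean n x (\<lambda>y. ln (fh n y)) - sample_mean n x (\<lambda>y. ln (fs y))) / 2"
          by (rule mle_affinity[OF mle _ lc xpos \<rho> \<rho>_def]) (use elim in auto)
        moreover have "- l \<le> e" if "- l \<le> (A - B) / 2" "A \<le> c + e" "c - e < B" for A B c l :: real
          using that by (simp add: field_simps)
        ultimately have "- ln \<rho> \<le> e" using elim by blast
        then have "1 - \<rho> \<le> e" using ln_le_minus_one[OF \<rho>] by linarith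
        then have "(1 - \<rho>) / (\<eta> / 4) \<le> e / (\<eta> / 4)" using \<eta> by (intro divide_right_mono) auto
        moreover have "e / (\<eta> / 4) = \<eta> / 4" using \<eta> by (simp add: e_def power2_eq_square)
        moreover have "(LINT x|lebesgue. \<bar>fh n x - fs x\<bar>) \<le> (1 - \<rho>) / (\<eta> / 4) + 2 * (\<eta> / 4)"
          using hellinger_affinity(4)[OF fpd fspd, of "\<eta> / 4"] \<eta> by (simp add: \<rho>_def)
        moreover have "0 \<le> (LINT x|lebesgue. \<bar>fh n x - fs x\<bar>)" by simp
        ultimately have "(LINT x|lebesgue. \<bar>fh n x - fs x\<bar>) < \<eta>" using \<eta> by linarith
        then show ?case by simp
      qed
    qed
    with cls show "log_concave_L1_limit fh fs z r M K"
      using s(1) MK(1,2) fspd by unfold_locales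
  qed
qed

section \<open>Transfer from the law \<open>Q\<close> to the random sample\<close>

lemma measurable_ident_Q: "(\<lambda>x. x) \<in> borel_measurable Q"
proof -
  have "(\<lambda>x. x) \<in> borel_measurable (lebesgue :: 'a measure)" by (rule measurable_completion) simp
  then show ?thesis by (simp add: measurable_cong_sets[OF sets_Q refl])
qed

lemma has_density_distr:
  assumes "has_density N X f0"
  shows "distr N borel X = distr Q borel (\<lambda>x. x)"
proof (rule measure_eqI)
  fix A assume "A \<in> sets (distr N borel X)"
  then have A: "A \<in> sets borel" by simp
  then have "emeasure (distr N borel X) A = emeasure Q A"
    using assms by (simp add: has_density_def emeasure_Q)
  also have "\<dots> = emeasure (distr Q borel (\<lambda>x. x)) A"
    using A by (subst emeasure_distr[OF measurable_ident_Q]) auto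
  finally show "emeasure (distr N borel X) A = emeasure (distr Q borel (\<lambda>x. x)) A" .
qed simp

text \<open>\<open>has_density\<close> gives information on Borel sets only, while an exceptional
  set of \<open>Q\<close> is merely Lebesgue measurable. It is therefore covered by a Borel set: the
  level set at 1 of a Borel version of its indicator, together with a Borel null set that contains
  the points where the two differ.\<close>

lemma has_density_AE:
  assumes X: "has_density N X f0" and P: "AE x in Q. P x"
  shows "AE \<omega> in N. P (X \<omega>)"
proof -
  have Xm: "X \<in> borel_measurable N" using X by (simp add: has_density_def)
  obtain A where A: "{x \<in> space Q. \<not> P x} \<subseteq> A" "A \<in> null_sets Q"
    using P by (auto simp: eventually_ae_filter)
  have "(indicator A :: 'a \<Rightarrow> real) \<in> borel_measurable lebesgue"
    using A(2) by (intro borel_measurable_indicator) (auto simp: null_sets_def)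
  then obtain u where u: "u \<in> borel_measurable lborel" "AE x in lborel. (indicator A x :: real) = u x"
    using completion_ex_borel_measurable_real[of "indicator A :: 'a \<Rightarrow> real" lborel] by auto
  obtain B0 where B0: "{x \<in> space lborel. indicator A x \<noteq> u x} \<subseteq> B0" "B0 \<in> null_sets lborel"
    using u(2) by (auto simp: eventually_ae_filter)
  define B where "B = {x. u x = 1} \<union> B0"
  have Bb: "B \<in> sets borel"
  proof -
    have "{x. u x = 1} = u -` {1}" by auto
    also have "\<dots> \<in> sets borel" using measurable_sets[OF u(1), of "{1}"] by simp
    finally show ?thesis using B0(2) by (auto simp: B_def null_sets_def)
  qed
  have AB: "A \<subseteq> B"
  proof
    fix x assume "x \<in> A"
    then have "indicator A x = (1 :: real)" by simp
    then show "x \<in> B" using B0(1) by (cases "u x = 1") (auto simp: B_def)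
  qed
  have "B0 \<in> null_sets lebesgue" using B0(2) by (rule null_sets_completionI)
  then have "AE x in Q. x \<notin> B0" by (intro AE_Q_I AE_not_in)
  moreover have "AE x in Q. x \<notin> A" using A(2) by (rule AE_not_in)
  moreover have "AE x in Q. indicator A x = u x"
    using u(2) by (intro AE_Q_I AE_completion)
  ultimately have "AE x in Q. x \<notin> B" by eventually_elim (auto simp: B_def)
  then have "B \<in> null_sets Q" using Bb by (subst AE_iff_null_sets) auto
  then have "emeasure (distr Q borel (\<lambda>x. x)) B = 0"
    using Bb by (subst emeasure_distr[OF measurable_ident_Q]) (auto simp: null_sets_def)
  then have "B \<in> null_sets (distr N borel X)"
    using Bb by (simp add: has_density_distr[OF X] null_sets_def)
  then have "AE x in distr N borel X. x \<notin> B" by (rule AE_not_in)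
  then have "AE \<omega> in N. X \<omega> \<notin> B" by (rule AE_distrD[OF Xm])
  then show ?thesis by eventually_elim (use A(1) AB in auto)
qed

text \<open>The composition of a Lebesgue measurable \<open>h\<close> with a Borel random vector can
  fail to be measurable, so the strong law is applied to a Borel version \<open>h'\<close>; the two
  agree at all sample points almost surely.\<close>

lemma AE_sample_mean_tendsto:
  fixes X :: "nat \<Rightarrow> 'w \<Rightarrow> 'a"
  assumes N: "prob_space N" and indep: "prob_space.indep_vars N (\<lambda>_. borel) X UNIV"
    and X: "\<And>i. has_density N (X i) f0"
    and h: "h \<in> borel_measurable lebesgue" "integrable Q h"
  shows "AE \<omega> in N. (\<lambda>n. sample_mean n (\<lambda>i. X i \<omega>) h) \<longlonglongrightarrow> integral\<^sup>L Q h"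
proof -
  interpret N: prob_space N by (rule N)
  obtain h' where h': "h' \<in> borel_measurable lborel" "AE x in lborel. h x = h' x"
    using completion_ex_borel_measurable_real[OF h(1)] by blast
  have h'b: "h' \<in> borel_measurable borel" using h'(1) by simp
  have h'Q: "h' \<in> borel_measurable Q"
    using measurable_compose[OF measurable_ident_Q h'b] .
  have eqQ: "AE x in Q. h x = h' x" using h'(2) by (intro AE_Q_I AE_completion)
  have hQ: "h \<in> borel_measurable Q" using h(2) by simp
  have ih': "integrable Q h'" using h(2) integrable_cong_AE[OF hQ h'Q eqQ] by simp
  have Xm: "X i \<in> borel_measurable N" for i using X[of i] by (simp add: has_density_def)
  have "AE \<omega> in N. (\<lambda>n. (\<Sum>i<n. h' (X i \<omega>)) / real n) \<longlonglongrightarrow> N.expectation (\<lambda>\<omega>. h' (X 0 \<omega>))"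
  proof (rule N.strong_law_of_large_numbers)
    show "N.indep_vars (\<lambda>_. borel) (\<lambda>i \<omega>. h' (X i \<omega>)) UNIV"
      by (rule N.indep_vars_compose2[OF indep]) (rule h'b)
    have "distr N borel (\<lambda>\<omega>. h' (X i \<omega>)) = distr (distr Q borel (\<lambda>x. x)) borel h'" for i
      unfolding has_density_distr[OF X, symmetric, of i] using h'b Xm
      by (subst distr_distr) (auto simp: comp_def)
    then show "distr N borel (\<lambda>\<omega>. h' (X i \<omega>)) = distr N borel (\<lambda>\<omega>. h' (X 0 \<omega>))" for i by simp
    have "integrable (distr N borel (X 0)) h'"
      unfolding has_density_distr[OF X] using ih' integrable_distr_eq[OF measurable_ident_Q h'b] by simp
    then show "integrable N (\<lambda>\<omega>. h' (X 0 \<omega>))" using integrable_distr_eq[OF Xm h'b] by simp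
  qed
  moreover have "N.expectation (\<lambda>\<omega>. h' (X 0 \<omega>)) = integral\<^sup>L Q h"
  proof -
    have "N.expectation (\<lambda>\<omega>. h' (X 0 \<omega>)) = integral\<^sup>L (distr N borel (X 0)) h'"
      using integral_distr[OF Xm h'b] by simp
    also have "\<dots> = integral\<^sup>L Q h'"
      unfolding has_density_distr[OF X] using integral_distr[OF measurable_ident_Q h'b] by simp
    also have "\<dots> = integral\<^sup>L Q h" using integral_cong_AE[OF hQ h'Q eqQ] by simp
    finally show ?thesis .
  qed
  moreover have "AE \<omega> in N. \<forall>i. h (X i \<omega>) = h' (X i \<omega>)"
    unfolding AE_all_countable by (intro allI has_density_AE[OF X eqQ])
  ultimately show ?thesis
    by (auto simp: sample_mean_def elim: eventually_elim2)
qed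

text \<open>Countably many test functions and sample sizes leave one null set. The constants come
  from \<open>f0\<close> and \<open>fs\<close> alone and so stand outside the almost sure
  statement.\<close>

lemma mle_AE_limit:
  fixes X :: "nat \<Rightarrow> 'w \<Rightarrow> 'a"
  assumes fs: "kl_minimiser f0 fs"
    and N: "prob_space N" and indep: "prob_space.indep_vars N (\<lambda>_. borel) X UNIV"
    and X: "\<And>i. has_density N (X i) f0"
    and mle: "\<And>n. m \<le> n \<Longrightarrow> AE \<omega> in N. is_log_concave_mle n (\<lambda>i. X i \<omega>) (fhat n \<omega>)"
  obtains z r M K where "AE \<omega> in N. log_concave_L1_limit (\<lambda>n. fhat n \<omega>) fs z r M K"
proof -
  obtain \<H> z r M K where H: "countable \<H>"
    "\<And>h. h \<in> \<H> \<Longrightarrow> h \<in> borel_measurable lebesgue \<and> integrable Q h"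
    "\<And>x fh N. (\<And>h. h \<in> \<H> \<Longrightarrow> (\<lambda>n. sample_mean n x h) \<longlonglongrightarrow> integral\<^sup>L Q h) \<Longrightarrow>
      (\<And>i. 0 < fs (x i)) \<Longrightarrow> (\<And>n. N \<le> n \<Longrightarrow> is_log_concave_mle n x (fh n)) \<Longrightarrow>
      log_concave_L1_limit fh fs z r M K"
  proof (rule mle_L1_convergence[OF fs], goal_cases)
    case (1 \<H> z r M K)
    show thesis by (rule 1(1)[of \<H> z r M K]) (fact 1)+
  qed
  have adm: "admissible fs" using fs by (simp add: kl_minimiser_iff)
  have "AE \<omega> in N. \<forall>h\<in>\<H>. (\<lambda>n. sample_mean n (\<lambda>i. X i \<omega>) h) \<longlonglongrightarrow> integral\<^sup>L Q h"
    using H(2) AE_sample_mean_tendsto[OF N indep X] by (subst AE_ball_countable[OF H(1)]) blast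
  moreover have "AE \<omega> in N. \<forall>i. 0 < fs (X i \<omega>)"
    unfolding AE_all_countable using has_density_AE[OF X] adm by (auto simp: admissible_def)
  moreover have "AE \<omega> in N. \<forall>n. m \<le> n \<longrightarrow> is_log_concave_mle n (\<lambda>i. X i \<omega>) (fhat n \<omega>)"
    unfolding AE_all_countable using mle by auto
  ultimately have "AE \<omega> in N. log_concave_L1_limit (\<lambda>n. fhat n \<omega>) fs z r M K"
  proof eventually_elim
    case (elim \<omega>)
    show ?case by (rule H(3)[of "\<lambda>i. X i \<omega>" m]) (use elim in auto)
  qed
  then show ?thesis by (rule that)
qed

end

theorem theorem4:
  fixes f0 :: "real ^ 'n \<Rightarrow> real"
  assumes "prob_density f0"
    and "(\<integral>\<^sup>+x. ennreal (norm x * f0 x) \<partial>lebesgue) < \<infinity>"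
    and "(\<integral>\<^sup>+x. ennreal (f0 x * log_plus (f0 x)) \<partial>lebesgue) < \<infinity>"
    and "interior (density_support f0) \<noteq> {}"
  shows
    "(\<exists>fstar. kl_minimiser f0 fstar) \<and>
     (\<forall>f g. kl_minimiser f0 f \<and> kl_minimiser f0 g \<longrightarrow> (AE x in lebesgue. f x = g x)) \<and>
     (\<forall>fstar. kl_minimiser f0 fstar \<longrightarrow>
        (\<exists>a0 > 0. \<exists>b0. \<forall>x. fstar x \<le> exp (- a0 * norm x + b0)) \<and>
        (\<forall>(M :: 'w measure) (X :: nat \<Rightarrow> 'w \<Rightarrow> real ^ 'n)
            (fhat :: nat \<Rightarrow> 'w \<Rightarrow> real ^ 'n \<Rightarrow> real).
           prob_space M \<and>
           prob_space.indep_vars M (\<lambda>_. borel) X UNIV \<and>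
           (\<forall>i. has_density M (X i) f0) \<and>
           (\<forall>n \<ge> CARD('n) + 1.
              AE \<omega> in M. is_log_concave_mle n (\<lambda>i. X i \<omega>) (fhat n \<omega>)) \<longrightarrow>
           (\<forall>a0 b0 a. a0 > 0 \<and> (\<forall>x. fstar x \<le> exp (- a0 * norm x + b0)) \<and> a < a0 \<longrightarrow>
              (AE \<omega> in M.
                 (\<lambda>n. \<integral>\<^sup>+x. ennreal (exp (a * norm x) * \<bar>fhat n \<omega> x - fstar x\<bar>) \<partial>lebesgue)
                   \<longlonglongrightarrow> 0) \<and>
              (continuous_on UNIV fstar \<longrightarrow>
                 (AE \<omega> in M.
                    (\<lambda>n. SUP x. ennreal (exp (a * norm x) * \<bar>fhat n \<omega> x - fstar x\<bar>))
                      \<longlonglongrightarrow> 0)))))"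
proof (intro conjI allI impI)
  interpret kl_projection f0 using assms by unfold_locales
  show "\<exists>fstar. kl_minimiser f0 fstar" by (rule kl_minimiser_exists)
  show "AE x in lebesgue. f x = g x" if "kl_minimiser f0 f \<and> kl_minimiser f0 g" for f g
    using that kl_minimiser_unique by blast
  fix fstar assume fs: "kl_minimiser f0 fstar"
  have lc: "log_concave_density fstar" using fs by (simp add: kl_minimiser_iff)
  show "\<exists>a0 > 0. \<exists>b0. \<forall>x. fstar x \<le> exp (- a0 * norm x + b0)"
    by (rule log_concave_density_tail[OF lc]) blast
  fix M :: "'w measure" and X :: "nat \<Rightarrow> 'w \<Rightarrow> real ^ 'n" and fhat and a0 b0 a :: real
  assume A: "prob_space M \<and>
           prob_space.indep_vars M (\<lambda>_. borel) X UNIV \<and>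
           (\<forall>i. has_density M (X i) f0) \<and>
           (\<forall>n \<ge> CARD('n) + 1.
              AE \<omega> in M. is_log_concave_mle n (\<lambda>i. X i \<omega>) (fhat n \<omega>))"
    and B: "a0 > 0 \<and> (\<forall>x. fstar x \<le> exp (- a0 * norm x + b0)) \<and> a < a0"
  \<comment> \<open>Neither the null set nor the constants involve \<open>a\<close>,
    \<open>a0\<close> or \<open>b0\<close>; these enter only through the two deterministic results
    applied to each outcome below.\<close>
  obtain z r B K where lim: "AE \<omega> in M. log_concave_L1_limit (\<lambda>n. fhat n \<omega>) fstar z r B K"
    by (rule mle_AE_limit[OF fs, of M X "CARD('n) + 1" fhat]) (use A in auto)
  from B have gb: "\<And>x. fstar x \<le> exp (- a0 * norm x + b0)" and a: "0 < a0" "a < a0" by auto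
  from lim show "AE \<omega> in M.
      (\<lambda>n. \<integral>\<^sup>+x. ennreal (exp (a * norm x) * \<bar>fhat n \<omega> x - fstar x\<bar>) \<partial>lebesgue) \<longlonglongrightarrow> 0"
    by eventually_elim (rule log_concave_L1_limit.weighted_L1[OF _ gb a])
  assume cont: "continuous_on UNIV fstar"
  from lim show "AE \<omega> in M.
      (\<lambda>n. SUP x. ennreal (exp (a * norm x) * \<bar>fhat n \<omega> x - fstar x\<bar>)) \<longlonglongrightarrow> 0"
    by eventually_elim (rule log_concave_L1_limit.weighted_sup[OF _ gb a cont])
qed

end
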